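(* Let $A(t)\in\mathbb{C}^{p\times p}$, $t\in\mathbb{R}$, be an almost automorphic matrix such that $y'=A(t)y$ has an $\alpha$-exponential dichotomy whose projection $P$ commutes with the fundamental matrix $\Phi_A$. Let $V$ be a Banach space and define the Green operator $$(\Gamma\varphi)(t)=\int_{-\infty}^\infty G_A(t,s)\varphi(s)\,ds,\qquad t\in\mathbb{R}.$$ Then: (i) The Green matrix $G_A$ is integrally Bi-almost automorphic. (ii) The spaces $BC(\mathbb{R},V^p)$, $AP(\mathbb{R},V^p)$ and $AA(\mathbb{R},V^p)$ are invariant under $\Gamma$. Moreover, there exist two positive constants $c_1$ and $c_2$ such that $$\|\Gamma\varphi\|_\infty\le\frac{\|\varphi\|_\infty}{\alpha}\quad\text{for }\varphi\in BC(\mathbb{R},V^p),$$ $$\|(\Delta_\xi\Gamma\varphi)(t)\|\le c_1\|\varphi\|_\infty\sum_{i=1}^2\mathcal{L}_i(|\Delta_\xi A|)(t)+c_2\sum_{i=1}^2\mathcal{L}_i(|\Delta_\xi\varphi|)(t)\quad\text{for }\varphi\in AP(\mathbb{R},V^p).$$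
   Context: $\Phi_A(t)$ is a fundamental matrix of $y'=A(t)y$. The system $y'=A(t)y$ has an $\alpha$-exponential dichotomy if there exist a projection $P$ and positive constants $c,\alpha$ such that $\|G_A(t,s)\|\le c\exp(-\alpha|t-s|)$ for all $(t,s)\in\mathbb{R}^2$, where the Green matrix is $G_A(t,s)=\Phi_A(t)P\Phi_A^{-1}(s)$ for $t\ge s$ and $G_A(t,s)=-\Phi_A(t)(I-P)\Phi_A^{-1}(s)$ otherwise. The $\alpha$ in the conclusions is the dichotomy exponent. A matrix function $A$ is almost automorphic if for any real sequence $\{\xi'_n\}$ there exist a subsequence $\{\xi_n\}$ and a matrix $B(t)$ such that $A(t+\xi_n)\to B(t)$ and $B(t-\xi_n)\to A(t)$ pointwise on $\mathbb{R}$. With such $\{\xi_n\}$ and $B$, $G_A$ is integrally Bi-almost automorphic if $$\int_{-\infty}^\infty\|(G_{A_{\xi_n}}-G_B)(t,s)\|\,ds\to0\quad\text{and}\quad\int_{-\infty}^\infty\|(G_{B_{-\xi_n}}-G_A)(t,s)\|\,ds\to0\quad(n\to\infty),$$ where $A_\xi(t)=A(t+\xi)$ and all Green matrices are formed with the same projection $P$. $\Delta_\xi F(x)=F(x+\xi)-F(x)$ for $\xi\in\mathbb{R}$. $\mathcal{L}_1(\varphi)(t)=\int_{-\infty}^te^{-\alpha(t-s)}\varphi(s)\,ds$ and $\mathcal{L}_2(\varphi)(t)=\int_t^\infty e^{\alpha(t-s)}\varphi(s)\,ds$. For a Banach space $W$: $BC(\mathbb{R},W)$ is the space of bounded continuous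 functions with sup norm $\|\cdot\|_\infty$; $AP(\mathbb{R},W)$ is the set of Bohr almost periodic functions ($f\in BC(\mathbb{R},W)$ such that for each $\epsilon>0$ there is $l_\epsilon>0$ such that every interval of length $l_\epsilon$ contains $\xi$ with $\|f(t+\xi)-f(t)\|\le\epsilon$ for all $t$); $AA(\mathbb{R},W)$ is the set of almost automorphic functions: continuous $\psi:\mathbb{R}\to W$ such that every real sequence has a subsequence $\{\tau_n\}$ for which $\tilde\psi(t)=\lim_n\psi(t+\tau_n)$ and $\psi(t)=\lim_n\tilde\psi(t-\tau_n)$ for all $t\in\mathbb{R}$.
   Formalization: Two clauses are false as printed and are corrected: the bound on Γφ is 2c‖φ‖/α (c the dichotomy constant) instead of ‖φ‖/α, and invariance of AP under Γ is stated only when A itself is Bohr almost periodic. *)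

theory Defs
  imports "HOL-Analysis.Analysis"
begin

text \<open>
  Complex Banach spaces: the library class \<^class>\<open>banach\<close> is real, but the values of
  \<open>A\<close> are complex matrices, which have to act on \<open>V\<^sup>p\<close>.
\<close>

class complex_banach = banach +
  fixes scaleC :: "complex \<Rightarrow> 'a \<Rightarrow> 'a"  (infixr "*\<^sub>C" 75)
  assumes scaleC_add_right: "a *\<^sub>C (x + y) = a *\<^sub>C x + a *\<^sub>C y"
    and scaleC_add_left: "(a + b) *\<^sub>C x = a *\<^sub>C x + b *\<^sub>C x"
    and scaleC_scaleC: "a *\<^sub>C (b *\<^sub>C x) = (a * b) *\<^sub>C x"
    and scaleC_of_real: "complex_of_real r *\<^sub>C x = r *\<^sub>R x"
    and norm_scaleC: "norm (a *\<^sub>C x) = cmod a * norm x"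

instantiation complex :: complex_banach
begin

definition scaleC_complex :: "complex \<Rightarrow> complex \<Rightarrow> complex"
  where "scaleC_complex a x = a * x"

instance
  by standard (auto simp: scaleC_complex_def algebra_simps norm_mult scaleR_conv_of_real)

end

definition matrix_act :: "complex ^ 'p ^ 'p \<Rightarrow> 'v::complex_banach ^ 'p \<Rightarrow> 'v ^ 'p"
  where "matrix_act M v = (\<chi> i. \<Sum>j\<in>UNIV. (M $ i $ j) *\<^sub>C (v $ j))"


section \<open>Fundamental matrices, Green matrices, exponential dichotomy\<close>

text \<open>
  Solutions of \<open>y' = A(t) y\<close> are taken in the integrated (Caratheodory) sense: the limit
  matrices \<open>B\<close> below are only pointwise limits of translates and need not be continuous.
  For continuous \<open>A\<close> this is \<open>\<Phi>' = A \<Phi>\<close> with every \<open>\<Phi> t\<close> invertible.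
\<close>

definition fundamental_matrix ::
    "(real \<Rightarrow> complex ^ 'p ^ 'p) \<Rightarrow> (real \<Rightarrow> complex ^ 'p ^ 'p) \<Rightarrow> bool"
  where "fundamental_matrix A \<Phi> \<longleftrightarrow>
    (\<forall>t. invertible (\<Phi> t)) \<and>
    (\<forall>a b. a \<le> b \<longrightarrow> ((\<lambda>r. A r ** \<Phi> r) has_integral (\<Phi> b - \<Phi> a)) {a..b})"

definition green_matrix ::
    "(real \<Rightarrow> complex ^ 'p ^ 'p) \<Rightarrow> complex ^ 'p ^ 'p \<Rightarrow> real \<Rightarrow> real \<Rightarrow> complex ^ 'p ^ 'p"
  where "green_matrix \<Phi> P t s =
    (if t \<ge> s then \<Phi> t ** P ** matrix_inv (\<Phi> s)
     else - (\<Phi> t ** (mat 1 - P) ** matrix_inv (\<Phi> s)))"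

definition exponential_dichotomy ::
    "(real \<Rightarrow> complex ^ 'p ^ 'p) \<Rightarrow> (real \<Rightarrow> complex ^ 'p ^ 'p) \<Rightarrow> complex ^ 'p ^ 'p
      \<Rightarrow> real \<Rightarrow> real \<Rightarrow> bool"
  where "exponential_dichotomy A \<Phi> P c \<alpha> \<longleftrightarrow>
    fundamental_matrix A \<Phi> \<and> P ** P = P \<and> c > 0 \<and> \<alpha> > 0 \<and>
    (\<forall>t s. norm (green_matrix \<Phi> P t s) \<le> c * exp (- \<alpha> * \<bar>t - s\<bar>))"


section \<open>Function spaces\<close>

text \<open>The set \<open>BC\<close> of bounded continuous functions is the library's \<^const>\<open>bcontfun\<close>.\<close>

definition sup_norm :: "(real \<Rightarrow> 'w::real_normed_vector) \<Rightarrow> real"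
  where "sup_norm f = (SUP t. norm (f t))"

definition AP :: "(real \<Rightarrow> 'w::real_normed_vector) set"
  where "AP = {f \<in> bcontfun. \<forall>\<epsilon>>0. \<exists>l>0. \<forall>a. \<exists>\<xi>\<in>{a..a + l}. \<forall>t. norm (f (t + \<xi>) - f t) \<le> \<epsilon>}"

text \<open>
  \<open>translation_limit f \<xi> g\<close>: \<open>f\<close> converges to \<open>g\<close> along the translates by \<open>\<xi>\<close>, and \<open>g\<close>
  back to \<open>f\<close>. In \<open>almost_automorphic\<close> no continuity is required; this is the notion used
  for the matrix \<open>A\<close>, while \<open>AA\<close> consists of continuous functions.
\<close>

definition translation_limit ::
    "(real \<Rightarrow> 'w::real_normed_vector) \<Rightarrow> (nat \<Rightarrow> real) \<Rightarrow> (real \<Rightarrow> 'w) \<Rightarrow> bool"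
  where "translation_limit f \<xi> g \<longleftrightarrow>
    (\<forall>t. (\<lambda>n. f (t + \<xi> n)) \<longlonglongrightarrow> g t) \<and> (\<forall>t. (\<lambda>n. g (t - \<xi> n)) \<longlonglongrightarrow> f t)"

definition almost_automorphic :: "(real \<Rightarrow> 'w::real_normed_vector) \<Rightarrow> bool"
  where "almost_automorphic f \<longleftrightarrow>
    (\<forall>\<sigma> :: nat \<Rightarrow> real. \<exists>r g. strict_mono r \<and> translation_limit f (\<sigma> \<circ> r) g)"

definition AA :: "(real \<Rightarrow> 'w::real_normed_vector) set"
  where "AA = {f. continuous_on UNIV f \<and> almost_automorphic f}"


section \<open>Integral Bi-almost automorphy of the Green matrix\<close>

text \<open>
  The Green matrix \<open>\<Phi>(t) P \<Phi>(s)\<^sup>-\<^sup>1\<close> depends, for fixed \<open>P\<close>, on the choice of the fundamental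
  matrix. The fundamental matrices of the translated and of the limit systems are therefore
  normalised to have the same value at \<open>0\<close> as that of \<open>A\<close>, which determines them. The integrals
  are Lebesgue integrals of nonnegative functions, so their convergence to \<open>0\<close> includes
  that they are eventually finite.
\<close>

definition integrally_bi_almost_automorphic ::
    "(real \<Rightarrow> complex ^ 'p ^ 'p) \<Rightarrow> (real \<Rightarrow> complex ^ 'p ^ 'p) \<Rightarrow> complex ^ 'p ^ 'p \<Rightarrow> bool"
  where "integrally_bi_almost_automorphic A \<Phi> P \<longleftrightarrow>
    almost_automorphic A \<and>
    (\<forall>\<xi> B. translation_limit A \<xi> B \<longrightarrow>
      (\<exists>\<Phi>A \<Phi>B \<Psi>.
        (\<forall>n. fundamental_matrix (\<lambda>t. A (t + \<xi> n)) (\<Phi>A n) \<and> \<Phi>A n 0 = \<Phi> 0) \<and>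
        fundamental_matrix B \<Phi>B \<and> \<Phi>B 0 = \<Phi> 0 \<and>
        (\<forall>n. fundamental_matrix (\<lambda>t. B (t - \<xi> n)) (\<Psi> n) \<and> \<Psi> n 0 = \<Phi> 0) \<and>
        (\<forall>t. (\<lambda>n. \<integral>\<^sup>+ s. ennreal (norm (green_matrix (\<Phi>A n) P t s - green_matrix \<Phi>B P t s)) \<partial>lborel)
               \<longlonglongrightarrow> 0) \<and>
        (\<forall>t. (\<lambda>n. \<integral>\<^sup>+ s. ennreal (norm (green_matrix (\<Psi> n) P t s - green_matrix \<Phi> P t s)) \<partial>lborel)
               \<longlonglongrightarrow> 0)))"


section \<open>Green operator and the auxiliary convolutions\<close>

text \<open>
  The integral is the Henstock-Kurzweil one, since the Bochner integral of the library is
  limited to separable spaces and \<open>V\<close> is arbitrary.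
\<close>

definition green_operator ::
    "(real \<Rightarrow> complex ^ 'p ^ 'p) \<Rightarrow> complex ^ 'p ^ 'p
      \<Rightarrow> (real \<Rightarrow> 'v::complex_banach ^ 'p) \<Rightarrow> real \<Rightarrow> 'v ^ 'p"
  where "green_operator \<Phi> P \<phi> t = integral UNIV (\<lambda>s. matrix_act (green_matrix \<Phi> P t s) (\<phi> s))"

text \<open>Invariance includes that the defining integral of the operator exists on the space.\<close>

definition green_invariant ::
    "(real \<Rightarrow> complex ^ 'p ^ 'p) \<Rightarrow> complex ^ 'p ^ 'p
      \<Rightarrow> (real \<Rightarrow> 'v::complex_banach ^ 'p) set \<Rightarrow> bool"
  where "green_invariant \<Phi> P X \<longleftrightarrow>
    (\<forall>\<phi>\<in>X. (\<forall>t. (\<lambda>s. matrix_act (green_matrix \<Phi> P t s) (\<phi> s)) integrable_on UNIV) \<and>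
      green_operator \<Phi> P \<phi> \<in> X)"

definition translation_diff :: "real \<Rightarrow> (real \<Rightarrow> 'w::real_normed_vector) \<Rightarrow> real \<Rightarrow> 'w"
  where "translation_diff \<xi> f x = f (x + \<xi>) - f x"

definition L1 :: "real \<Rightarrow> (real \<Rightarrow> real) \<Rightarrow> real \<Rightarrow> real"
  where "L1 \<alpha> f t = integral {..t} (\<lambda>s. exp (- \<alpha> * (t - s)) * f s)"

definition L2 :: "real \<Rightarrow> (real \<Rightarrow> real) \<Rightarrow> real \<Rightarrow> real"
  where "L2 \<alpha> f t = integral {t..} (\<lambda>s. exp (\<alpha> * (t - s)) * f s)"

end

theory Submission
  imports Defs
begin

text \<open>
  As \<open>P\<close> commutes with \<open>\<Phi>\<close>, the Green matrix of the translated system is \<open>G(t + \<xi>, s + \<xi>)\<close>,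
  so it obeys the same exponential bound. A fundamental matrix of the limit system \<open>B\<close> is the
  pointwise limit of those of the translates, which are Cauchy because
  \<open>\<Phi>' t \<Phi>' s\<inverse> - \<Phi> t \<Phi> s\<inverse>\<close> is controlled by the integral of \<open>norm (A' - A)\<close>. Hence the Green matrices
  converge pointwise, \<open>B\<close> inherits the dichotomy, and dominated convergence gives the Bi-almost
  automorphy of \<open>G\<close> and, applied to \<open>G(t + \<xi>, s + \<xi>) \<phi>(s + \<xi>)\<close>, the invariance of \<open>AA\<close>.

  The same comparison on the ranges of \<open>P\<close> and \<open>mat 1 - P\<close> yields
  \<open>norm (G(t + \<xi>, s + \<xi>) - G(t, s)) \<le> c\<^sup>2 exp (- \<alpha> \<bar>t - s\<bar>) \<integral> norm (A(r + \<xi>) - A r) dr\<close>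
  with \<open>r\<close> between \<open>s\<close> and \<open>t\<close>. Integration by parts in \<open>s\<close> turns this into the difference
  inequality with \<open>c1 = c\<^sup>2 / \<alpha>\<close> and \<open>c2 = c\<close>, and common almost periods of \<open>A\<close> and \<open>\<phi>\<close> then
  give the invariance of \<open>AP\<close>.
\<close>


section \<open>Complex matrices\<close>

text \<open>Commutation says that \<Phi>(t) P \<Phi>(t)^-1 = P for every t: the splitting is the
  same at all times, for all translates and for the limit system. A single \<open>P\<close> can thus
  be compared across systems, and no convergence of projections has to be proved. The coefficient
  matrices are only known to be measurable and bounded, boundedness being a consequence of almost
  automorphy. Evolutions therefore need not be differentiable, and differential arguments become
  estimates of increments with an error quadratic in the step. Comparing full evolutions costs a
  growth factor exp (M |t - s|), which would destroy the decay. The decay survives because a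
  projected evolution of one system from r to t times one of the other system from s to r is bounded
  by a multiple of exp (- \<alpha> (t - s)) whatever r is; each factor contributes one c, hence c^2.
  As \<open>V\<close> may be non-separable, measurability is asked only of norms of differences of
  kernels. Both arguments of a kernel are always translated together, which keeps its jump at s = t
  in place.\<close>

lemma norm_vec_le_mult:
  fixes x :: "'a::real_normed_vector ^ 'n" and y :: "'b::real_normed_vector ^ 'n"
  assumes "\<And>i. norm (x $ i) \<le> norm (y $ i) * C" "0 \<le> C"
  shows "norm x \<le> norm y * C"
proof -
  have "norm x \<le> L2_set (\<lambda>i. C * norm (y $ i)) UNIV"
    unfolding norm_vec_def using assms(1) by (intro L2_set_mono) (auto simp: mult.commute)
  also have "\<dots> = norm y * C"
    unfolding norm_vec_def using assms(2) by (simp add: L2_set_right_distrib mult.commute)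
  finally show ?thesis .
qed

lemma sum_norm_mult_le:
  fixes x :: "'a::real_normed_vector ^ 'n" and y :: "'b::real_normed_vector ^ 'n"
  shows "(\<Sum>j\<in>UNIV. norm (x $ j) * norm (y $ j)) \<le> norm x * norm y"
  using L2_set_mult_ineq[of "\<lambda>j. norm (x $ j)" "\<lambda>j. norm (y $ j)" UNIV]
  by (simp add: norm_vec_def)

text \<open>Norms of vectors are Euclidean over the components, so a matrix carries its Frobenius
  norm. Cauchy-Schwarz in each row gives the constant 1 even for components in
  \<open>V\<close>.\<close>

lemma norm_matrix_act_le: "norm (matrix_act M v) \<le> norm M * norm v"
proof (rule norm_vec_le_mult)
  fix i
  have "norm (matrix_act M v $ i) \<le> (\<Sum>j\<in>UNIV. norm (M $ i $ j) * norm (v $ j))"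
    by (simp add: matrix_act_def sum_norm_le norm_scaleC)
  also have "\<dots> \<le> norm (M $ i) * norm v" by (rule sum_norm_mult_le)
  finally show "norm (matrix_act M v $ i) \<le> norm (M $ i) * norm v" .
qed simp

text \<open>Row i of the product combines the rows of \<open>N\<close> with the coefficients in row
  i of \<open>M\<close>; Cauchy-Schwarz over these rows makes the Frobenius norm
  submultiplicative.\<close>

lemma norm_matrix_mult_le:
  fixes M :: "complex ^ 'n ^ 'm" and N :: "complex ^ 'k ^ 'n"
  shows "norm (M ** N) \<le> norm M * norm N"
proof (rule norm_vec_le_mult)
  fix i
  have "(M ** N) $ i = (\<Sum>j\<in>UNIV. \<chi> l. M $ i $ j * N $ j $ l)"
    by (simp add: vec_eq_iff matrix_matrix_mult_def)
  also have "norm \<dots> \<le> (\<Sum>j\<in>UNIV. norm (M $ i $ j) * norm (N $ j))"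
  proof (rule sum_norm_le)
    fix j
    have "norm (\<chi> l. M $ i $ j * N $ j $ l) \<le> norm (N $ j) * norm (M $ i $ j)"
      by (rule norm_vec_le_mult) (auto simp: norm_mult)
    then show "norm (\<chi> l. M $ i $ j * N $ j $ l) \<le> norm (M $ i $ j) * norm (N $ j)"
      by (simp add: mult.commute)
  qed
  also have "\<dots> \<le> norm (M $ i) * norm N" by (rule sum_norm_mult_le)
  finally show "norm ((M ** N) $ i) \<le> norm (M $ i) * norm N" .
qed simp

lemma bounded_bilinear_matrix_mult:
  "bounded_bilinear ((**) :: complex ^ 'n ^ 'm \<Rightarrow> complex ^ 'k ^ 'n \<Rightarrow> _)"
proof
  show "\<exists>K. \<forall>a b. norm ((a :: complex ^ 'n ^ 'm) ** (b :: complex ^ 'k ^ 'n)) \<le> norm a * norm b * K"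
    using norm_matrix_mult_le by (intro exI[of _ 1]) auto
qed (auto simp: vec_eq_iff matrix_matrix_mult_def sum.distrib algebra_simps scaleR_sum_right)

interpretation matrix_mult: bounded_bilinear "(**) :: complex ^ 'n ^ 'm \<Rightarrow> complex ^ 'k ^ 'n \<Rightarrow> _"
  by (rule bounded_bilinear_matrix_mult)

lemma scaleC_scaleR_left: "(r *\<^sub>R a) *\<^sub>C x = r *\<^sub>R (a *\<^sub>C (x :: 'a::complex_banach))"
  by (metis scaleR_conv_of_real scaleC_scaleC scaleC_of_real)

lemma scaleC_scaleR_right: "a *\<^sub>C (r *\<^sub>R x) = r *\<^sub>R (a *\<^sub>C (x :: 'a::complex_banach))"
  by (metis mult.commute scaleC_scaleC scaleC_of_real)

lemma bounded_bilinear_matrix_act: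
  "bounded_bilinear (matrix_act :: complex ^ 'p ^ 'p \<Rightarrow> 'v::complex_banach ^ 'p \<Rightarrow> _)"
proof
  show "\<exists>K. \<forall>a b. norm (matrix_act a b :: 'v ^ 'p) \<le> norm a * norm b * K"
    using norm_matrix_act_le by (intro exI[of _ 1]) auto
qed (auto simp: vec_eq_iff matrix_act_def sum.distrib scaleC_add_left scaleC_add_right
    scaleC_scaleR_left scaleC_scaleR_right scaleR_sum_right)

interpretation matrix_act: bounded_bilinear "matrix_act :: complex ^ 'p ^ 'p \<Rightarrow> 'v::complex_banach ^ 'p \<Rightarrow> _"
  by (rule bounded_bilinear_matrix_act)

section \<open>Inverse matrices and their limits\<close>

lemma matrix_inv:
  fixes M :: "complex ^ 'p ^ 'p"
  assumes "invertible M"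
  shows matrix_inv_right: "M ** matrix_inv M = mat 1" and matrix_inv_left: "matrix_inv M ** M = mat 1"
  using someI_ex[OF assms[unfolded invertible_def]] unfolding matrix_inv_def by auto

lemma matrix_inv_unique:
  fixes M :: "complex ^ 'p ^ 'p"
  assumes "M ** N = mat 1" "N ** M = mat 1"
  shows "matrix_inv M = N"
proof -
  have "invertible M" using assms unfolding invertible_def by auto
  then have "matrix_inv M = matrix_inv M ** (M ** N)" using assms by simp
  also have "\<dots> = N" using \<open>invertible M\<close> by (simp add: matrix_mul_assoc matrix_inv_left)
  finally show ?thesis .
qed

lemma invertible_matrix_inv:
  fixes M :: "complex ^ 'p ^ 'p"
  shows "invertible M \<Longrightarrow> invertible (matrix_inv M)"
  unfolding invertible_def by (metis matrix_inv invertible_def)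

lemma matrix_inv_mult:
  fixes M N :: "complex ^ 'p ^ 'p"
  assumes "invertible M" "invertible N"
  shows "matrix_inv (M ** N) = matrix_inv N ** matrix_inv M"
proof (rule matrix_inv_unique)
  show "M ** N ** (matrix_inv N ** matrix_inv M) = mat 1"
    by (metis assms matrix_inv_right matrix_mul_assoc matrix_mul_rid)
  show "matrix_inv N ** matrix_inv M ** (M ** N) = mat 1"
    by (metis assms matrix_inv_left matrix_mul_assoc matrix_mul_rid)
qed

lemma matrix_inv_diff:
  fixes M N :: "complex ^ 'p ^ 'p"
  assumes "invertible M" "invertible N"
  shows "matrix_inv M - matrix_inv N = matrix_inv M ** (N - M) ** matrix_inv N"
proof -
  have "matrix_inv M ** (N - M) ** matrix_inv N
      = matrix_inv M ** (N ** matrix_inv N) - (matrix_inv M ** M) ** matrix_inv N"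
    by (simp add: matrix_mult.diff_left matrix_mult.diff_right matrix_mul_assoc)
  then show ?thesis using assms by (simp add: matrix_inv)
qed

lemma norm_matrix_inv_diff:
  fixes M N :: "complex ^ 'p ^ 'p"
  assumes "invertible M" "invertible N"
  shows "norm (matrix_inv M - matrix_inv N) \<le> norm (matrix_inv M) * norm (N - M) * norm (matrix_inv N)"
proof -
  have "norm (matrix_inv M - matrix_inv N) \<le> norm (matrix_inv M ** (N - M)) * norm (matrix_inv N)"
    unfolding matrix_inv_diff[OF assms] by (rule norm_matrix_mult_le)
  also have "\<dots> \<le> norm (matrix_inv M) * norm (N - M) * norm (matrix_inv N)"
    by (intro mult_right_mono norm_matrix_mult_le) auto
  finally show ?thesis .
qed

lemma tendsto_matrix_inv_bounded:
  fixes f :: "'a \<Rightarrow> complex ^ 'p ^ 'p"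
  assumes f: "(f \<longlongrightarrow> L) F" and "invertible L" and inv: "\<And>x. invertible (f x)"
    and bd: "\<forall>\<^sub>F x in F. norm (matrix_inv (f x)) \<le> C"
  shows "((\<lambda>x. matrix_inv (f x)) \<longlongrightarrow> matrix_inv L) F"
proof -
  have "((\<lambda>x. C * norm (L - f x) * norm (matrix_inv L)) \<longlongrightarrow> C * norm (L - L) * norm (matrix_inv L)) F"
    by (intro tendsto_intros f)
  then have "((\<lambda>x. C * norm (L - f x) * norm (matrix_inv L)) \<longlongrightarrow> 0) F" by simp
  then have "((\<lambda>x. matrix_inv (f x) - matrix_inv L) \<longlongrightarrow> 0) F"
  proof (rule Lim_null_comparison[rotated])
    show "\<forall>\<^sub>F x in F. norm (matrix_inv (f x) - matrix_inv L) \<le> C * norm (L - f x) * norm (matrix_inv L)"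
      using bd
    proof eventually_elim
      case (elim x)
      have "norm (matrix_inv (f x) - matrix_inv L) \<le> norm (matrix_inv (f x)) * norm (L - f x) * norm (matrix_inv L)"
        using norm_matrix_inv_diff[OF inv \<open>invertible L\<close>] .
      also have "\<dots> \<le> C * norm (L - f x) * norm (matrix_inv L)"
        using elim by (intro mult_right_mono) auto
      finally show ?case .
    qed
  qed
  then show ?thesis by (rule LIM_zero_cancel)
qed

text \<open>Close to \<open>L\<close>, the formula for a difference of inverses can be absorbed up
  to one half into the norm of the inverse itself. This gives the a priori bound 2 * norm
  (matrix_inv L).\<close>

lemma tendsto_matrix_inv:
  fixes f :: "'a \<Rightarrow> complex ^ 'p ^ 'p"
  assumes f: "(f \<longlongrightarrow> L) F" and "invertible L" and inv: "\<And>x. invertible (f x)"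
  shows "((\<lambda>x. matrix_inv (f x)) \<longlongrightarrow> matrix_inv L) F"
proof -
  have "((\<lambda>x. norm (L - f x) * norm (matrix_inv L)) \<longlongrightarrow> norm (L - L) * norm (matrix_inv L)) F"
    by (intro tendsto_intros f)
  then have "\<forall>\<^sub>F x in F. norm (L - f x) * norm (matrix_inv L) < 1/2"
    by (rule order_tendstoD) simp
  then have "\<forall>\<^sub>F x in F. norm (matrix_inv (f x)) \<le> 2 * norm (matrix_inv L)"
  proof eventually_elim
    case (elim x)
    have "norm (matrix_inv (f x) - matrix_inv L) \<le> norm (matrix_inv (f x)) * (norm (L - f x) * norm (matrix_inv L))"
      using norm_matrix_inv_diff[OF inv \<open>invertible L\<close>, of x] by (simp add: mult.assoc)
    also have "\<dots> \<le> norm (matrix_inv (f x)) * (1/2)"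
      using elim by (intro mult_left_mono) auto
    finally have "norm (matrix_inv (f x) - matrix_inv L) \<le> norm (matrix_inv (f x)) / 2" by simp
    moreover have "norm (matrix_inv (f x)) \<le> norm (matrix_inv L) + norm (matrix_inv (f x) - matrix_inv L)"
      by (metis add.commute norm_triangle_sub)
    ultimately show ?case by simp
  qed
  then show ?thesis using tendsto_matrix_inv_bounded[OF assms] by blast
qed

text \<open>The invertible matrices are not closed. A uniform bound on the inverses makes the
  inverses a Cauchy sequence, and their limit inverts \<open>L\<close>.\<close>

lemma invertible_limit:
  fixes M :: "nat \<Rightarrow> complex ^ 'p ^ 'p"
  assumes M: "M \<longlonglongrightarrow> L" and inv: "\<And>n. invertible (M n)" and bd: "\<And>n. norm (matrix_inv (M n)) \<le> C"
  shows "invertible L"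
proof -
  have "Cauchy (\<lambda>n. matrix_inv (M n))"
  proof (rule metric_CauchyI)
    fix e :: real assume "e > 0"
    have "0 \<le> C" using bd[of 0] norm_ge_zero by (metis order_trans)
    have "Cauchy M" using M by (rule LIMSEQ_imp_Cauchy)
    then obtain N where N: "\<And>m n. m \<ge> N \<Longrightarrow> n \<ge> N \<Longrightarrow> norm (M m - M n) < e / (C * C + 1)"
      using \<open>e > 0\<close> \<open>0 \<le> C\<close> unfolding Cauchy_def dist_norm
      by (metis add_nonneg_pos divide_pos_pos mult_nonneg_nonneg zero_less_one)
    have "norm (matrix_inv (M m) - matrix_inv (M n)) < e" if "m \<ge> N" "n \<ge> N" for m n
    proof -
      have "norm (matrix_inv (M m) - matrix_inv (M n)) \<le> norm (matrix_inv (M m)) * norm (M n - M m) * norm (matrix_inv (M n))"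
        by (rule norm_matrix_inv_diff[OF inv inv])
      also have "\<dots> \<le> C * norm (M n - M m) * C"
        using \<open>0 \<le> C\<close> by (intro mult_mono bd) auto
      also have "\<dots> \<le> (C * C + 1) * norm (M n - M m)" by (simp add: algebra_simps)
      also have "\<dots> < (C * C + 1) * (e / (C * C + 1))"
        using N[OF that(2,1)] \<open>0 \<le> C\<close> by (intro mult_strict_left_mono) (auto simp: add_nonneg_pos)
      also have "\<dots> = e" using \<open>0 \<le> C\<close> by (simp add: add_nonneg_eq_0_iff)
      finally show ?thesis .
    qed
    then show "\<exists>N. \<forall>m\<ge>N. \<forall>n\<ge>N. dist (matrix_inv (M m)) (matrix_inv (M n)) < e"
      unfolding dist_norm by blast
  qed
  then obtain N where N: "(\<lambda>n. matrix_inv (M n)) \<longlonglongrightarrow> N"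
    by (auto simp: Cauchy_convergent_iff convergent_def)
  have "L ** N = mat 1" "N ** L = mat 1"
    using matrix_mult.tendsto[OF M N] matrix_mult.tendsto[OF N M] inv
    by (auto simp: matrix_inv LIMSEQ_const_iff)
  then show ?thesis unfolding invertible_def by blast
qed


section \<open>Integration in Banach spaces\<close>

text \<open>For |m| = 1 no Jacobian appears. On compact intervals this is an affine change of
  variables; the integral over the line follows because large intervals have large images.\<close>

lemma has_integral_affine_UNIV:
  fixes f :: "real \<Rightarrow> 'b::banach"
  assumes f: "(f has_integral i) UNIV" and m: "\<bar>m\<bar> = 1"
  shows "((\<lambda>x. f (m * x + c)) has_integral i) UNIV"
proof -
  have "m = 1 \<or> m = -1" using m by auto
  then have mm: "m * (m * x) = x" for x by auto
  have key: "((\<lambda>x. f (m * x + c)) has_integral z) (cbox a b)"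
    if "(f has_integral z) ((\<lambda>x. m * x + c) ` cbox a b)" for a b z
  proof -
    obtain u v where uv: "(\<lambda>x. m * x + c) ` cbox a b = cbox u v"
      using interval_image_affinity_interval[of m c a b] by auto
    have "((\<lambda>x. f (m *\<^sub>R x + c)) has_integral (1 / (\<bar>m\<bar> ^ DIM(real))) *\<^sub>R z)
       ((\<lambda>x. (1 / m) *\<^sub>R x + -((1 / m) *\<^sub>R c)) ` cbox u v)"
      using that m unfolding uv by (intro has_integral_affinity) auto
    moreover have "(\<lambda>x. (1 / m) *\<^sub>R x + -((1 / m) *\<^sub>R c)) ` cbox u v = cbox a b"
      unfolding uv[symmetric] image_image using m by (auto simp: field_simps)
    ultimately show ?thesis using m by simp
  qed
  have im: "\<exists>u v. (\<lambda>x. m * x + c) ` cbox a b = cbox u v" for a b :: real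
    using interval_image_affinity_interval[of m c a b] by auto
  show ?thesis
    unfolding has_integral_alt'
  proof (simp, intro conjI allI impI)
    fix a b
    obtain u v where uv: "(\<lambda>x. m * x + c) ` cbox a b = cbox u v" using im by blast
    have "f integrable_on cbox u v"
      by (rule integrable_on_subcbox[OF has_integral_integrable[OF f]]) simp
    then show "(\<lambda>x. f (m * x + c)) integrable_on {a..b}"
      using key[of _ a b] unfolding uv by (auto simp: integrable_on_def)
  next
    fix e :: real assume "e > 0"
    then obtain B where B: "B > 0" "\<And>a b. ball 0 B \<subseteq> cbox a b \<Longrightarrow>
        norm (integral (cbox a b) f - i) < e"
      using f unfolding has_integral_alt' by auto
    \<comment> \<open>The radius B + |c| is chosen so that every point of the ball of radius B has
      its preimage in the larger ball.\<close>
    have "norm (integral {a..b} (\<lambda>x. f (m * x + c)) - i) < e" if sub: "ball 0 (B + \<bar>c\<bar>) \<subseteq> {a..b}" for a b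
    proof -
      obtain u v where uv: "(\<lambda>x. m * x + c) ` cbox a b = cbox u v" using im by blast
      have "ball 0 B \<subseteq> cbox u v"
      proof
        fix y assume "y \<in> ball (0::real) B"
        have "\<bar>m * (y - c)\<bar> \<le> \<bar>y\<bar> + \<bar>c\<bar>" using m by (simp add: abs_mult)
        then have "m * (y - c) \<in> {a..b}" using sub \<open>y \<in> ball 0 B\<close> by (auto simp: subset_iff)
        then have "m * (m * (y - c)) + c \<in> cbox u v" unfolding uv[symmetric] by auto
        then show "y \<in> cbox u v" using mm by simp
      qed
      then have n: "norm (integral (cbox u v) f - i) < e" by (rule B(2))
      have "f integrable_on cbox u v"
        by (rule integrable_on_subcbox[OF has_integral_integrable[OF f]]) simp
      then have "(f has_integral integral (cbox u v) f) (cbox u v)" by (rule integrable_integral)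
      then have "((\<lambda>x. f (m * x + c)) has_integral integral (cbox u v) f) (cbox a b)"
        by (intro key) (simp only: uv)
      then have "integral {a..b} (\<lambda>x. f (m * x + c)) = integral (cbox u v) f"
        by (simp add: integral_unique)
      then show ?thesis using n by (simp only:)
    qed
    then show "\<exists>B>0. \<forall>a b. ball 0 B \<subseteq> {a..b} \<longrightarrow> norm (integral {a..b} (\<lambda>x. f (m * x + c)) - i) < e"
      using \<open>B > 0\<close> by (intro exI[of _ "B + \<bar>c\<bar>"]) auto
  qed
qed

lemma has_integral_reflect_set:
  fixes f :: "real \<Rightarrow> 'b::banach"
  assumes "(f has_integral i) S"
  shows "((\<lambda>x. f (- x)) has_integral i) (uminus ` S)"
proof -
  have "((\<lambda>x. if x \<in> S then f x else 0) has_integral i) UNIV"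
    using assms by (simp only: has_integral_restrict_UNIV)
  from has_integral_affine_UNIV[OF this, of "-1" 0]
  have "((\<lambda>x. if - x \<in> S then f (- x) else 0) has_integral i) UNIV"
    by (simp cong: if_cong)
  moreover have "(- x \<in> S) = (x \<in> uminus ` S)" for x
    by (metis (mono_tags, opaque_lifting) add.inverse_inverse image_iff)
  ultimately show ?thesis by (simp add: has_integral_restrict_UNIV)
qed

text \<open>A Riemann sum of \<open>f\<close> differs from that of \<open>fs n\<close> by at most
  the Riemann sum of the real function \<open>norm (fs n x - f x)\<close>, which on fine divisions
  is close to its small integral. So the Cauchy criterion passes from \<open>fs n\<close> to
  \<open>f\<close>.\<close>

lemma integrable_on_cbox_limit:
  fixes f :: "'a::euclidean_space \<Rightarrow> 'b::banach"
  assumes fs: "\<And>n. fs n integrable_on cbox a b"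
    and k: "\<And>n. (\<lambda>x. norm (fs n x - f x)) integrable_on cbox a b"
    and lim: "(\<lambda>n. integral (cbox a b) (\<lambda>x. norm (fs n x - f x))) \<longlonglongrightarrow> 0"
  shows "f integrable_on cbox a b"
  unfolding integrable_Cauchy
proof (intro allI impI)
  fix e :: real assume "e > 0"
  \<comment> \<open>The sum of the norms is below its integral plus e / 6, hence below e / 3. Two
    such replacements and the Cauchy bound e / 3 for \<open>fs n\<close> add up to e.\<close>
  then obtain n where n: "integral (cbox a b) (\<lambda>x. norm (fs n x - f x)) < e / 6"
    using order_tendstoD(2)[OF lim, of "e / 6"] by (auto simp: eventually_sequentially)
  define k where "k = (\<lambda>x. norm (fs n x - f x))"
  have "(k has_integral integral (cbox a b) k) (cbox a b)"
    using assms(2)[of n] unfolding k_def by (rule integrable_integral)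
  then obtain \<gamma> where \<gamma>: "gauge \<gamma>"
    "\<And>\<D>. \<D> tagged_division_of cbox a b \<Longrightarrow> \<gamma> fine \<D> \<Longrightarrow>
        norm ((\<Sum>(x,K)\<in>\<D>. measure lborel K *\<^sub>R k x) - integral (cbox a b) k) < e / 6"
    unfolding has_integral using \<open>e > 0\<close> by (metis zero_less_divide_iff zero_less_numeral)
  obtain \<delta> where \<delta>: "gauge \<delta>"
    "\<And>\<D>1 \<D>2. \<D>1 tagged_division_of cbox a b \<Longrightarrow> \<delta> fine \<D>1 \<Longrightarrow> \<D>2 tagged_division_of cbox a b \<Longrightarrow> \<delta> fine \<D>2 \<Longrightarrow>
        norm ((\<Sum>(x,K)\<in>\<D>1. measure lborel K *\<^sub>R fs n x) - (\<Sum>(x,K)\<in>\<D>2. measure lborel K *\<^sub>R fs n x)) < e / 3"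
    using fs[of n] \<open>e > 0\<close> unfolding integrable_Cauchy by (metis zero_less_divide_iff zero_less_numeral)
  have close: "norm ((\<Sum>(x,K)\<in>\<D>. measure lborel K *\<^sub>R fs n x) - (\<Sum>(x,K)\<in>\<D>. measure lborel K *\<^sub>R f x)) < e / 3"
    if D: "\<D> tagged_division_of cbox a b" "\<gamma> fine \<D>" for \<D>
  proof -
    have "(\<Sum>(x,K)\<in>\<D>. measure lborel K *\<^sub>R fs n x) - (\<Sum>(x,K)\<in>\<D>. measure lborel K *\<^sub>R f x)
        = (\<Sum>(x,K)\<in>\<D>. measure lborel K *\<^sub>R (fs n x - f x))"
      by (simp add: sum_subtractf[symmetric] case_prod_unfold scaleR_diff_right)
    also have "norm \<dots> \<le> (\<Sum>(x,K)\<in>\<D>. measure lborel K *\<^sub>R k x)"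
      unfolding k_def case_prod_unfold by (intro sum_norm_le) simp
    also have "\<dots> < e / 3"
      using \<gamma>(2)[OF D] n unfolding k_def real_norm_def by linarith
    finally show ?thesis .
  qed
  show "\<exists>\<gamma>. gauge \<gamma> \<and> (\<forall>\<D>1 \<D>2. \<D>1 tagged_division_of cbox a b \<and> \<gamma> fine \<D>1 \<and>
      \<D>2 tagged_division_of cbox a b \<and> \<gamma> fine \<D>2 \<longrightarrow>
      norm ((\<Sum>(x,K)\<in>\<D>1. measure lborel K *\<^sub>R f x) - (\<Sum>(x,K)\<in>\<D>2. measure lborel K *\<^sub>R f x)) < e)"
  proof (intro exI conjI allI impI)
    show "gauge (\<lambda>x. \<gamma> x \<inter> \<delta> x)" using \<gamma>(1) \<delta>(1) by (rule gauge_Int)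
    fix \<D>1 \<D>2
    assume *: "\<D>1 tagged_division_of cbox a b \<and> (\<lambda>x. \<gamma> x \<inter> \<delta> x) fine \<D>1 \<and>
      \<D>2 tagged_division_of cbox a b \<and> (\<lambda>x. \<gamma> x \<inter> \<delta> x) fine \<D>2"
    let ?F = "\<lambda>\<D>. \<Sum>(x,K)\<in>\<D>. measure lborel K *\<^sub>R f x" and ?G = "\<lambda>\<D>. \<Sum>(x,K)\<in>\<D>. measure lborel K *\<^sub>R fs n x"
    from * have D: "\<D>1 tagged_division_of cbox a b" "\<gamma> fine \<D>1" "\<delta> fine \<D>1"
      "\<D>2 tagged_division_of cbox a b" "\<gamma> fine \<D>2" "\<delta> fine \<D>2"
      by (simp_all add: fine_Int)
    have tri: "norm (u - v) \<le> norm (w - z) + norm (w - u) + norm (z - v)" for u v w z :: 'b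
      using norm_triangle_ineq4[of "w - z" "w - u"] norm_triangle_ineq[of "w - z - (w - u)" "z - v"] by simp
    have "norm (?G \<D>1 - ?G \<D>2) + norm (?G \<D>1 - ?F \<D>1) + norm (?G \<D>2 - ?F \<D>2) < e / 3 + e / 3 + e / 3"
      by (intro add_strict_mono close[OF D(1,2)] close[OF D(4,5)] \<delta>(2)[OF D(1,3,4,6)])
    also have "\<dots> = e" by simp
    finally show "norm (?F \<D>1 - ?F \<D>2) < e"
      by (rule le_less_trans[OF tri])
  qed
qed

text \<open>
  The library's dominated convergence theorem has Euclidean values. Here the values lie in an
  arbitrary Banach space, and measurability is only asked of the real functions
  \<open>\<lambda>x. norm (fs n x - f x)\<close>.
\<close>

lemma dominated_convergence_banach:
  fixes f :: "'a::euclidean_space \<Rightarrow> 'b::banach"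
  assumes fs: "\<And>n. fs n integrable_on UNIV" and h: "h integrable_on UNIV"
    and bound: "\<And>n x. norm (fs n x) \<le> h x"
    and lim: "\<And>x. (\<lambda>n. fs n x) \<longlonglongrightarrow> f x"
    and meas: "\<And>n. (\<lambda>x. norm (fs n x - f x)) \<in> borel_measurable lebesgue"
  shows "f integrable_on UNIV" and "(\<lambda>n. integral UNIV (fs n)) \<longlonglongrightarrow> integral UNIV f"
proof -
  define k where "k = (\<lambda>n x. norm (fs n x - f x))"
  have fh: "norm (f x) \<le> h x" for x
    using Lim_bounded[OF tendsto_norm[OF lim]] bound by blast
  have kh: "norm (k n x) \<le> h x + h x" for n x
    unfolding k_def using norm_triangle_ineq4[of "fs n x" "f x"] bound[of n x] fh[of x] by simp
  have k0: "(\<lambda>n. k n x) \<longlonglongrightarrow> 0" for x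
    unfolding k_def using lim[of x] by (simp add: LIM_zero tendsto_norm_zero)
  have kint: "k n integrable_on UNIV" for n
  proof (rule measurable_bounded_by_integrable_imp_integrable[OF _ integrable_add[OF h h] kh])
    show "k n \<in> borel_measurable (lebesgue_on UNIV)"
      using meas[of n] by (simp add: k_def lebesgue_on_UNIV_eq)
  qed simp
  \<comment> \<open>Boxes serve for the local integrability of \<open>f\<close>, the whole line for
    the limit of the integrals.\<close>
  have lim0: "(\<lambda>n. integral S (k n)) \<longlonglongrightarrow> 0" if "S = UNIV \<or> (\<exists>a b. S = cbox a b)" for S
  proof -
    have "k n integrable_on S" for n using that integrable_on_subcbox[OF kint[of n]] kint[of n] by blast
    moreover have "(\<lambda>x. h x + h x) integrable_on S"
      using that integrable_on_subcbox[OF integrable_add[OF h h]] integrable_add[OF h h] by blast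
    ultimately show ?thesis
      using dominated_convergence(2)[of k S "\<lambda>x. h x + h x" "\<lambda>x. 0"] kh k0 by simp
  qed
  have loc: "f integrable_on cbox a b" for a b
  proof (rule integrable_on_cbox_limit)
    show "fs n integrable_on cbox a b" for n using fs by (auto intro: integrable_on_subcbox)
    show "(\<lambda>x. norm (fs n x - f x)) integrable_on cbox a b" for n
      using kint[of n] unfolding k_def by (auto intro: integrable_on_subcbox)
    show "(\<lambda>n. integral (cbox a b) (\<lambda>x. norm (fs n x - f x))) \<longlonglongrightarrow> 0"
      using lim0[of "cbox a b"] unfolding k_def by blast
  qed
  show f: "f integrable_on UNIV"
    by (rule integrable_on_all_intervals_UNIV[OF loc fh h])
  have "norm (integral UNIV (fs n) - integral UNIV f) \<le> integral UNIV (k n)" for n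
    unfolding integral_diff[OF fs f, symmetric] k_def
    using kint[of n] by (intro integral_norm_bound_integral integrable_diff fs f) (auto simp: k_def)
  then have "(\<lambda>n. integral UNIV (fs n) - integral UNIV f) \<longlonglongrightarrow> 0"
    by (intro Lim_null_comparison[OF always_eventually lim0[of UNIV]]) blast+
  then show "(\<lambda>n. integral UNIV (fs n)) \<longlonglongrightarrow> integral UNIV f" by (rule LIM_zero_cancel)
qed

text \<open>Meant for the kernel s -> G(t, s) \<phi>(s) with its jump at s = t: it is the branch for
  s > t plus a continuous difference restricted to s \<le> t.\<close>

lemma integrable_piecewise_continuous:
  fixes f g :: "real \<Rightarrow> 'b::banach"
  assumes "continuous_on UNIV f" "continuous_on UNIV g"
  shows "(\<lambda>s. if s \<le> t then f s else g s) integrable_on {a..b}"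
proof -
  have eq: "(\<lambda>s. if s \<le> t then f s else g s) = (\<lambda>s. g s + (if s \<in> {..t} then f s - g s else 0))"
    by (rule ext) simp
  have "{..t} \<inter> {a..b} = {a..min t b}" by auto
  moreover have "(\<lambda>s. f s - g s) integrable_on {a..min t b}"
    using continuous_on_diff[OF assms]
    by (intro integrable_continuous_real) (rule continuous_on_subset, auto)
  ultimately have "(\<lambda>s. if s \<in> {..t} then f s - g s else 0) integrable_on {a..b}"
    by (simp only: integrable_restrict_Int)
  moreover have "g integrable_on {a..b}"
    using assms(2) by (intro integrable_continuous_real) (rule continuous_on_subset, auto)
  ultimately show ?thesis unfolding eq by (intro integrable_add)
qed

section \<open>Exponential weights on half-lines\<close>

lemma has_integral_exp_atLeast:
  assumes "\<alpha> > (0::real)"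
  shows "((\<lambda>s. exp (\<alpha> * (t - s))) has_integral 1 / \<alpha>) {t..}"
proof -
  have "((\<lambda>s. exp (\<alpha> * t) * exp (- \<alpha> * s)) has_integral exp (\<alpha> * t) * (exp (- \<alpha> * t) / \<alpha>)) {t..}"
    by (intro has_integral_mult_right has_integral_exp_minus_to_infinity assms)
  then show ?thesis by (simp add: exp_add[symmetric] algebra_simps)
qed

lemma has_integral_exp_atMost:
  assumes "\<alpha> > (0::real)"
  shows "((\<lambda>s. exp (- \<alpha> * (t - s))) has_integral 1 / \<alpha>) {..t}"
  using has_integral_reflect_set[OF has_integral_exp_atLeast[OF assms, of "- t"]]
  by (simp add: algebra_simps)

text \<open>The value of \<open>h\<close> at t is left free, because the two branches of the Green
  matrix differ there in general.\<close>

lemma has_integral_half_lines: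
  fixes f g h :: "real \<Rightarrow> real"
  assumes "(f has_integral i) {..t}" "(g has_integral j) {t..}"
    and "\<And>s. s < t \<Longrightarrow> h s = f s" "\<And>s. s > t \<Longrightarrow> h s = g s"
  shows "(h has_integral i + j) UNIV"
proof -
  have "(h has_integral i) {..t}" using assms(3)
    by (intro has_integral_spike_finite[OF _ _ assms(1), of "{t}"]) auto
  moreover have "(h has_integral j) {t..}" using assms(4)
    by (intro has_integral_spike_finite[OF _ _ assms(2), of "{t}"]) auto
  moreover have "{..t} \<inter> {t..} = {t}" "{..t} \<union> {t..} = UNIV" by auto
  ultimately show ?thesis using has_integral_Un[of h i "{..t}" j "{t..}"] by simp
qed

lemma has_integral_exp_abs:
  assumes "\<alpha> > (0::real)"
  shows "((\<lambda>s. exp (- \<alpha> * \<bar>t - s\<bar>)) has_integral 2 / \<alpha>) UNIV"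
proof -
  have "((\<lambda>s. exp (- \<alpha> * \<bar>t - s\<bar>)) has_integral 1 / \<alpha> + 1 / \<alpha>) UNIV"
    by (rule has_integral_half_lines[OF has_integral_exp_atMost[OF assms, of t]
          has_integral_exp_atLeast[OF assms, of t]]) (auto simp: algebra_simps)
  then show ?thesis by simp
qed

text \<open>
  Increments that exceed \<open>integral {x..y} k\<close> only by \<open>O((y - x)\<^sup>2)\<close> sum up over a fine
  subdivision. This replaces differentiation in the Caratheodory setting.
\<close>

lemma norm_increment_le_integral:
  fixes K :: "real \<Rightarrow> 'a::real_normed_vector"
  assumes k: "k integrable_on {s..t}" and "s \<le> t"
    and inc: "\<And>x y. s \<le> x \<Longrightarrow> x \<le> y \<Longrightarrow> y \<le> t \<Longrightarrow> norm (K y - K x) \<le> integral {x..y} k + C * (y - x)\<^sup>2"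
  shows "norm (K t - K s) \<le> integral {s..t} k"
proof -
  \<comment> \<open>With N = n + 1 equal steps the quadratic errors sum to N * C * ((t - s) / N)^2,
    which tends to 0.\<close>
  have "norm (K t - K s) \<le> integral {s..t} k + (C * (t - s)\<^sup>2) * inverse (real (Suc n))" for n
  proof -
    define N where "N = Suc n"
    define h where "h = (t - s) / N"
    have h: "h \<ge> 0" "N * h = t - s" using \<open>s \<le> t\<close> by (auto simp: h_def N_def simp del: of_nat_Suc)
    have "norm (K (s + i * h) - K s) \<le> integral {s..s + i * h} k + i * (C * h\<^sup>2)" if "i \<le> N" for i
      using that
    proof (induction i)
      case (Suc i)
      have "Suc i * h \<le> N * h" using Suc.prems h(1) by (intro mult_right_mono) auto
      then have le: "s + Suc i * h \<le> t" using h(2) by simp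
      have le2: "s \<le> s + i * h" "s + i * h \<le> s + Suc i * h" using h(1) by (auto simp: algebra_simps)
      have "norm (K (s + Suc i * h) - K s) \<le> norm (K (s + Suc i * h) - K (s + i * h)) + norm (K (s + i * h) - K s)"
        using norm_triangle_ineq[of "K (s + Suc i * h) - K (s + i * h)" "K (s + i * h) - K s"] by simp
      also have "\<dots> \<le> (integral {s + i * h..s + Suc i * h} k + C * (s + Suc i * h - (s + i * h))\<^sup>2)
          + (integral {s..s + i * h} k + i * (C * h\<^sup>2))"
        using Suc le le2 by (intro add_mono inc) auto
      also have "\<dots> = integral {s..s + Suc i * h} k + Suc i * (C * h\<^sup>2)"
        using Henstock_Kurzweil_Integration.integral_combine[OF le2, of k] integrable_on_subinterval[OF k] le
        by (simp add: algebra_simps)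
      finally show ?case .
    qed simp
    from this[of N] have "norm (K t - K s) \<le> integral {s..t} k + N * (C * h\<^sup>2)"
      using h(2) by simp
    also have "N * (C * h\<^sup>2) = (C * (t - s)\<^sup>2) * inverse (real N)"
      by (simp add: h_def power2_eq_square N_def field_simps del: of_nat_Suc)
    finally show ?thesis by (simp add: N_def)
  qed
  moreover have "(\<lambda>n. integral {s..t} k + (C * (t - s)\<^sup>2) * inverse (real (Suc n)))
      \<longlonglongrightarrow> integral {s..t} k + (C * (t - s)\<^sup>2) * 0"
    by (intro tendsto_intros LIMSEQ_inverse_real_of_nat)
  ultimately show ?thesis using LIMSEQ_le_const by fastforce
qed

text \<open>Since \<open>u\<close> is merely continuous, the function to differentiate is its
  integral majorant \<open>w\<close>; multiplied by exp (- M (x - s)) it is nonincreasing.\<close>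

lemma gronwall:
  fixes u :: "real \<Rightarrow> real"
  assumes cont: "continuous_on {s..t} u" and "s \<le> t" and "0 \<le> M"
    and le: "\<And>x. s \<le> x \<Longrightarrow> x \<le> t \<Longrightarrow> u x \<le> C + M * integral {s..x} u"
  shows "u t \<le> C * exp (M * (t - s))"
proof -
  define w where "w x = C + M * integral {s..x} u" for x
  define v where "v x = exp (- M * (x - s)) * w x" for x
  have der: "(v has_real_derivative exp (- M * (x - s)) * (M * u x - M * w x)) (at x within {s..t})"
    if "x \<in> {s..t}" for x
    unfolding v_def w_def
    by (rule derivative_eq_intros integral_has_real_derivative[OF cont that] refl | simp add: algebra_simps)+
  have "v t \<le> v s"
  proof (rule DERIV_nonpos_imp_decreasing_open[OF \<open>s \<le> t\<close>])
    show "continuous_on {s..t} v"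
      by (rule DERIV_continuous_on[OF der])
    fix x assume x: "s < x" "x < t"
    then have "(v has_real_derivative exp (- M * (x - s)) * (M * u x - M * w x)) (at x)"
      using der[of x] by (simp add: at_within_Icc_at)
    moreover have "M * u x \<le> M * w x" using le[of x] x \<open>0 \<le> M\<close> by (intro mult_left_mono) (auto simp: w_def)
    ultimately show "\<exists>y. (v has_real_derivative y) (at x) \<and> y \<le> 0"
      by (meson diff_le_0_iff_le exp_ge_zero mult_nonneg_nonpos)
  qed
  then have "exp (- M * (t - s)) * w t \<le> C" by (simp add: v_def w_def)
  then have "exp (M * (t - s)) * (exp (- M * (t - s)) * w t) \<le> exp (M * (t - s)) * C"
    by (rule mult_left_mono) simp
  moreover have "exp (M * (t - s)) * (exp (- M * (t - s)) * w t) = w t"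
    by (simp add: exp_minus)
  ultimately have "w t \<le> C * exp (M * (t - s))" by (simp only: mult.commute)
  moreover have "u t \<le> w t" using le[of t] \<open>s \<le> t\<close> by (simp add: w_def)
  ultimately show ?thesis by simp
qed

text \<open>Reduces an inequality on a half-line to compact intervals, where the integration by
  parts takes place.\<close>

lemma integral_atMost_le:
  fixes k :: "real \<Rightarrow> real"
  assumes k: "k integrable_on {..t}" and le: "\<And>x. x \<le> t \<Longrightarrow> integral {x..t} k \<le> C"
  shows "integral {..t} k \<le> C"
proof (rule field_le_epsilon)
  fix e :: real assume "e > 0"
  then obtain B where B: "B > 0" "\<And>a b. ball 0 B \<subseteq> cbox a b \<Longrightarrow>
      norm (integral (cbox a b) (\<lambda>x. if x \<in> {..t} then k x else 0) - integral {..t} k) < e"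
    using integrable_integral[OF k] unfolding has_integral_alt' by blast
  \<comment> \<open>Large enough for [-r, r] to contain both the ball and t, so that it cuts the
    half-line down to {-r..t}.\<close>
  define r where "r = B + \<bar>t\<bar>"
  have "ball 0 B \<subseteq> cbox (- r) r" by (auto simp: r_def)
  then have "norm (integral (cbox (- r) r) (\<lambda>x. if x \<in> {..t} then k x else 0) - integral {..t} k) < e"
    by (rule B(2))
  moreover have "integral (cbox (- r) r) (\<lambda>x. if x \<in> {..t} then k x else 0) = integral ({..t} \<inter> cbox (- r) r) k"
    by (rule integral_restrict_Int)
  moreover have "{..t} \<inter> cbox (- r) r = {- r..t}" using \<open>B > 0\<close> by (auto simp: r_def)
  moreover have "- r \<le> t" using \<open>B > 0\<close> by (auto simp: r_def)
  ultimately show "integral {..t} k \<le> C + e" using le[of "- r"] by (auto simp: abs_less_iff)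
qed

lemma borel_imp_lebesgue_measurable:
  "f \<in> borel_measurable borel \<Longrightarrow> f \<in> borel_measurable lebesgue"
  by (rule measurable_completion) simp

lemma continuous_imp_lebesgue_measurable:
  fixes f :: "'a::euclidean_space \<Rightarrow> 'b::topological_space"
  shows "continuous_on UNIV f \<Longrightarrow> f \<in> borel_measurable lebesgue"
  by (intro borel_imp_lebesgue_measurable borel_measurable_continuous_onI)

lemma integrable_on_bounded_measurable:
  fixes f :: "real \<Rightarrow> 'b::euclidean_space"
  assumes "f \<in> borel_measurable lebesgue" "\<And>x. norm (f x) \<le> N"
  shows "f integrable_on {a..b}"
proof (rule measurable_bounded_by_integrable_imp_integrable[OF _ integrable_const_ivl])
  show "f \<in> borel_measurable (lebesgue_on {a..b})"
    using assms(1) by (rule measurable_restrict_space1)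
qed (use assms(2) in auto)

section \<open>Convolution of bounded measurable functions with a one-sided exponential\<close>

context
  fixes a :: "real \<Rightarrow> real" and \<alpha> t N :: real
  assumes a: "a \<in> borel_measurable lebesgue" "\<And>s. 0 \<le> a s" "\<And>s. a s \<le> N" and \<alpha>: "\<alpha> > 0"
begin

lemma integral_exp_mult_bounded_integrable: "(\<lambda>s. exp (- \<alpha> * (t - s)) * a s) integrable_on {..t}"
proof (rule measurable_bounded_by_integrable_imp_integrable)
  show "(\<lambda>s. N * exp (- \<alpha> * (t - s))) integrable_on {..t}"
    using has_integral_mult_right[OF has_integral_exp_atMost[OF \<alpha>], of N t] by (auto simp: integrable_on_def)
  have "(\<lambda>s. exp (- \<alpha> * (t - s))) \<in> borel_measurable lebesgue"
    by (intro continuous_imp_lebesgue_measurable continuous_intros)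
  then show "(\<lambda>s. exp (- \<alpha> * (t - s)) * a s) \<in> borel_measurable (lebesgue_on {..t})"
    using a(1) by (intro measurable_restrict_space1 borel_measurable_times)
  show "norm (exp (- \<alpha> * (t - s)) * a s) \<le> N * exp (- \<alpha> * (t - s))" for s
    using a(2,3)[of s] by (simp add: mult.commute)
qed simp

text \<open>Integration by parts for \<open>exp (- \<alpha> * (t - s))\<close> and \<open>integral {s..t} a\<close>.\<close>

lemma integral_exp_mult_integral_le:
  assumes "x \<le> t"
  shows "\<alpha> * integral {x..t} (\<lambda>s. exp (- \<alpha> * (t - s)) * integral {s..t} a)
    \<le> integral {x..t} (\<lambda>s. exp (- \<alpha> * (t - s)) * a s)"
proof -
  define e where "e s = exp (- \<alpha> * (t - s))" for s
  define F where "F s = integral {s..t} a" for s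
  have aint: "a integrable_on {p..q}" for p q
    using a by (intro integrable_on_bounded_measurable) auto
  have contF: "continuous_on {p..t} F" for p
    unfolding F_def using indefinite_integral_continuous_1'[OF aint] .
  have conte: "continuous_on S e" for S unfolding e_def by (intro continuous_intros)
  have eFint: "(\<lambda>s. e s * F s) integrable_on {p..q}" if "q \<le> t" for p q
    using that by (intro integrable_continuous_real continuous_on_mult conte continuous_on_subset[OF contF]) auto
  have eaint: "(\<lambda>s. e s * a s) integrable_on {p..q}" if "q \<le> t" for p q
    using integrable_on_subinterval[OF integral_exp_mult_bounded_integrable] that unfolding e_def by auto
  have e1: "0 \<le> e s" "s \<le> t \<Longrightarrow> e s \<le> 1" for s using \<alpha> by (auto simp: e_def)
  have e_int: "(e has_integral (e q - e p) / \<alpha>) {p..q}" if "p \<le> q" for p q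
  proof -
    have "((\<lambda>s. \<alpha> * e s / \<alpha>) has_integral e q / \<alpha> - e p / \<alpha>) {p..q}"
      using \<alpha> unfolding e_def
      by (intro fundamental_theorem_of_calculus that)
        (auto intro!: derivative_eq_intros simp: has_real_derivative_iff_has_vector_derivative[symmetric])
    then show ?thesis using \<alpha> by (simp add: diff_divide_distrib)
  qed
  have Fdiff: "F p = F q + integral {p..q} a" if "p \<le> q" "q \<le> t" for p q
    using Henstock_Kurzweil_Integration.integral_combine[OF that aint] by (simp add: F_def)
  have aN: "integral {p..q} a \<le> N * (q - p)" "0 \<le> integral {p..q} a" if "p \<le> q" for p q
    using integral_le[OF aint integrable_const_ivl[of N], of p q] a that
    by (auto intro!: integral_nonneg aint simp: mult.commute)
  have "N \<ge> 0" using a(2,3)[of 0] by linarith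
  \<comment> \<open>The defect of the parts formula on {r..t}, including the boundary term at r; it
    is 0 at r = t. As \<open>a\<close> is only measurable, \<open>W\<close> is shown to be constant
    through quadratic increments.\<close>
  define W where "W r = \<alpha> * integral {r..t} (\<lambda>s. e s * F s) + e r * F r - integral {r..t} (\<lambda>s. e s * a s)" for r
  have "norm (W t - W x) \<le> integral {x..t} (\<lambda>s. 0)"
  proof (rule norm_increment_le_integral[OF integrable_0 assms, where C="2 * \<alpha> * N"])
    fix p q assume pq: "x \<le> p" "p \<le> q" "q \<le> t"
    have i1: "((\<lambda>r. e r * F r) has_integral integral {p..q} (\<lambda>r. e r * F r)) {p..q}"
      using eFint[OF pq(3)] by (rule integrable_integral)
    have i2: "((\<lambda>r. e r * a r) has_integral integral {p..q} (\<lambda>r. e r * a r)) {p..q}"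
      using eaint[OF pq(3)] by (rule integrable_integral)
    have i3: "((\<lambda>r. e p * a r) has_integral e p * integral {p..q} a) {p..q}"
      using aint by (intro has_integral_mult_right integrable_integral)
    have i4: "((\<lambda>r. e r * F q) has_integral ((e q - e p) / \<alpha>) * F q) {p..q}"
      using e_int[OF pq(2)] by (rule has_integral_mult_left)
    \<comment> \<open>The increment of \<open>W\<close> as one integral whose two terms are of first
      order in q - p: \<open>F\<close> has Lipschitz constant \<open>N\<close> and \<open>e\<close>
      has \<alpha> to the left of t. Each term is at most \<alpha> N (q - p), hence the constant 2
      \<alpha> N.\<close>
    have "((\<lambda>r. \<alpha> * (e r * F r - e r * F q) + (e p * a r - e r * a r)) has_integral
        \<alpha> * (integral {p..q} (\<lambda>r. e r * F r) - ((e q - e p) / \<alpha>) * F q)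
        + (e p * integral {p..q} a - integral {p..q} (\<lambda>r. e r * a r))) {p..q}"
      by (intro has_integral_add has_integral_mult_right has_integral_diff i1 i2 i3 i4)
    also have "\<alpha> * (integral {p..q} (\<lambda>r. e r * F r) - ((e q - e p) / \<alpha>) * F q)
        + (e p * integral {p..q} a - integral {p..q} (\<lambda>r. e r * a r)) = W p - W q"
    proof -
      have "integral {p..t} (\<lambda>s. e s * F s) = integral {p..q} (\<lambda>s. e s * F s) + integral {q..t} (\<lambda>s. e s * F s)"
        by (rule Henstock_Kurzweil_Integration.integral_combine[symmetric, OF pq(2,3) eFint]) simp
      moreover have "integral {p..t} (\<lambda>s. e s * a s) = integral {p..q} (\<lambda>s. e s * a s) + integral {q..t} (\<lambda>s. e s * a s)"
        by (rule Henstock_Kurzweil_Integration.integral_combine[symmetric, OF pq(2,3) eaint]) simp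
      ultimately show ?thesis
        unfolding W_def using Fdiff[OF pq(2,3)] \<alpha> by (simp add: field_simps)
    qed
    finally have hi: "((\<lambda>r. \<alpha> * (e r * F r - e r * F q) + (e p * a r - e r * a r)) has_integral W p - W q) (cbox p q)"
      by simp
    have "norm (W p - W q) \<le> 2 * \<alpha> * N * (q - p) * measure lborel (cbox p q)"
    proof (rule has_integral_bound[OF _ hi])
      fix r assume "r \<in> cbox p q"
      then have r: "p \<le> r" "r \<le> q" by auto
      have 1: "0 \<le> F r - F q" "F r - F q \<le> N * (q - p)"
        using Fdiff[OF r(2) pq(3)] aN[OF r(2)] r mult_left_mono[OF _ \<open>N \<ge> 0\<close>, of "q - r" "q - p"] by auto
      have "e r - e p = \<alpha> * integral {p..r} e" using integral_unique[OF e_int[OF r(1)]] \<alpha> by simp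
      moreover have "integral {p..r} e \<le> integral {p..r} (\<lambda>s. 1)"
        using e1 r pq by (intro integral_le integrable_on_const integrable_continuous_real conte) auto
      ultimately have 2: "e r - e p \<le> \<alpha> * (q - p)" using r \<alpha> by auto
      have 3: "e p \<le> e r" using r \<alpha> unfolding e_def by auto
      have "e r * (F r - F q) \<le> 1 * (N * (q - p))" using 1 e1 r pq by (intro mult_mono) auto
      then have "\<alpha> * (e r * (F r - F q)) \<le> \<alpha> * (N * (q - p))" using \<alpha> by (intro mult_left_mono) auto
      moreover have "0 \<le> \<alpha> * (e r * (F r - F q))" using 1 e1 \<alpha> by auto
      moreover have "(e r - e p) * a r \<le> (\<alpha> * (q - p)) * N" using 2 3 a \<alpha> r by (intro mult_mono) auto
      moreover have "0 \<le> (e r - e p) * a r" using 3 a by auto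
      ultimately show "norm (\<alpha> * (e r * F r - e r * F q) + (e p * a r - e r * a r)) \<le> 2 * \<alpha> * N * (q - p)"
        by (auto simp: algebra_simps abs_le_iff)
    qed (use \<alpha> \<open>N \<ge> 0\<close> pq in auto)
    then show "norm (W q - W p) \<le> integral {p..q} (\<lambda>s. 0) + 2 * \<alpha> * N * (q - p)\<^sup>2"
      using pq by (simp add: power2_eq_square norm_minus_commute mult.assoc)
  qed
  then have "W x = 0" by (simp add: W_def F_def)
  \<comment> \<open>Dropping this boundary term turns the identity W x = 0 into the
    inequality.\<close>
  moreover have "0 \<le> e x * F x" using aN(2)[OF assms] e1 by (simp add: F_def)
  ultimately show ?thesis unfolding W_def e_def F_def by simp
qed

text \<open>In the application \<open>k\<close> is the norm of a difference of projected evolutions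
  and \<open>D\<close> is c^2. Integration by parts trades the inner integral of \<open>a\<close>
  for the factor 1 / \<alpha>.\<close>

lemma integral_exp_convolution_le:
  assumes k: "k integrable_on {..t}" and "0 \<le> D"
    and le: "\<And>s. s \<le> t \<Longrightarrow> k s \<le> D * (exp (- \<alpha> * (t - s)) * integral {s..t} a)"
  shows "integral {..t} k \<le> D / \<alpha> * integral {..t} (\<lambda>s. exp (- \<alpha> * (t - s)) * a s)"
proof (rule integral_atMost_le[OF k])
  fix x assume "x \<le> t"
  have aint: "a integrable_on {p..q}" for p q
    using a by (intro integrable_on_bounded_measurable) auto
  have "integral {x..t} k \<le> integral {x..t} (\<lambda>s. D * (exp (- \<alpha> * (t - s)) * integral {s..t} a))"
  proof (rule integral_le)
    show "k integrable_on {x..t}" using integrable_on_subinterval[OF k, of x t] by auto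
    show "(\<lambda>s. D * (exp (- \<alpha> * (t - s)) * integral {s..t} a)) integrable_on {x..t}"
      by (intro integrable_continuous_real continuous_intros indefinite_integral_continuous_1' aint)
  qed (use le in auto)
  also have "\<dots> \<le> D * (1 / \<alpha> * integral {x..t} (\<lambda>s. exp (- \<alpha> * (t - s)) * a s))"
    using integral_exp_mult_integral_le[OF \<open>x \<le> t\<close>] \<alpha> \<open>0 \<le> D\<close>
    by (simp add: field_simps mult_left_mono)
  also have "\<dots> \<le> D * (1 / \<alpha> * integral {..t} (\<lambda>s. exp (- \<alpha> * (t - s)) * a s))"
    using \<alpha> \<open>0 \<le> D\<close> a integral_exp_mult_bounded_integrable
    by (intro mult_left_mono integral_subset_le integrable_on_subinterval[OF integral_exp_mult_bounded_integrable]) auto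
  finally show "integral {x..t} k \<le> D / \<alpha> * integral {..t} (\<lambda>s. exp (- \<alpha> * (t - s)) * a s)" by simp
qed

end


section \<open>Evolution of linear systems\<close>

text \<open>With \<open>Q = mat 1\<close> this is the transition matrix. With \<open>P\<close> and
  \<open>mat 1 - P\<close> it is, up to sign, a branch of the Green matrix, extended to all (t, s)
  and thereby free of the jump at s = t.\<close>

definition evolution ::
    "complex ^ 'p ^ 'p \<Rightarrow> (real \<Rightarrow> complex ^ 'p ^ 'p) \<Rightarrow> real \<Rightarrow> real \<Rightarrow> complex ^ 'p ^ 'p"
  where "evolution Q \<Phi> t s = \<Phi> t ** Q ** matrix_inv (\<Phi> s)"

text \<open>Points at which the norm exceeds n can be used as translations; along a subsequence the
  translates converge at 0 and so stay bounded there.\<close>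

lemma almost_automorphic_bounded:
  assumes "almost_automorphic f"
  obtains M where "\<And>t. norm (f t) \<le> M"
proof (rule ccontr)
  assume "\<not> thesis"
  then have "\<forall>n::nat. \<exists>t. norm (f t) > real n" using that by (meson not_le)
  then obtain \<sigma> where \<sigma>: "\<And>n. norm (f (\<sigma> n)) > real n" by metis
  obtain r g where r: "strict_mono r" "translation_limit f (\<sigma> \<circ> r) g"
    using assms unfolding almost_automorphic_def by blast
  then have "(\<lambda>n. f (0 + (\<sigma> \<circ> r) n)) \<longlonglongrightarrow> g 0" unfolding translation_limit_def by blast
  then have "Bseq (\<lambda>n. f (\<sigma> (r n)))" by (simp add: convergent_imp_Bseq convergentI)
  then obtain K where K: "\<And>n. norm (f (\<sigma> (r n))) \<le> K" by (auto simp: Bseq_def)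
  obtain n where "K < real n" using reals_Archimedean2 by blast
  also have "real n \<le> real (r n)" using seq_suble[OF r(1)] by simp
  also have "\<dots> < norm (f (\<sigma> (r n)))" by (rule \<sigma>)
  finally show False using K[of n] by simp
qed

lemma Cauchy_if_norm_diff_le:
  fixes x :: "nat \<Rightarrow> 'a::real_normed_vector"
  assumes le: "\<And>m n. norm (x m - x n) \<le> e m + e n" and e: "e \<longlonglongrightarrow> (0::real)"
  shows "Cauchy x"
proof (rule metric_CauchyI)
  fix d :: real assume "d > 0"
  then obtain N where N: "\<And>n. n \<ge> N \<Longrightarrow> e n < d / 2"
    using order_tendstoD(2)[OF e, of "d / 2"] by (auto simp: eventually_sequentially)
  have "dist (x m) (x n) < d" if "m \<ge> N" "n \<ge> N" for m n
    unfolding dist_norm using le[of m n] N[OF that(1)] N[OF that(2)] by linarith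
  then show "\<exists>N. \<forall>m\<ge>N. \<forall>n\<ge>N. dist (x m) (x n) < d" by blast
qed

section \<open>Regularity and algebra of a single fundamental matrix\<close>

context
  fixes A \<Phi> :: "real \<Rightarrow> complex ^ 'p ^ 'p"
  assumes fm: "fundamental_matrix A \<Phi>"
begin

lemma fundamental_matrix_invertible: "invertible (\<Phi> t)"
  using fm unfolding fundamental_matrix_def by blast

lemma fundamental_matrix_has_integral:
  "a \<le> b \<Longrightarrow> ((\<lambda>r. A r ** \<Phi> r) has_integral (\<Phi> b - \<Phi> a)) {a..b}"
  using fm unfolding fundamental_matrix_def by blast

lemma fundamental_matrix_mult:
  assumes "invertible C"
  shows "fundamental_matrix A (\<lambda>t. \<Phi> t ** C)"
  unfolding fundamental_matrix_def
proof (intro conjI allI impI)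
  show "invertible (\<Phi> t ** C)" for t
    using fundamental_matrix_invertible assms by (rule invertible_mult)
  fix a b :: real assume "a \<le> b"
  from has_integral_linear[OF fundamental_matrix_has_integral[OF this] matrix_mult.bounded_linear_left[of C]]
  show "((\<lambda>r. A r ** (\<Phi> r ** C)) has_integral (\<Phi> b ** C - \<Phi> a ** C)) {a..b}"
    by (simp add: o_def matrix_mul_assoc matrix_mult.diff_left)
qed

lemma fundamental_matrix_shift: "fundamental_matrix (\<lambda>t. A (t + h)) (\<lambda>t. \<Phi> (t + h))"
  unfolding fundamental_matrix_def
proof (intro conjI allI impI fundamental_matrix_invertible)
  fix a b :: real assume "a \<le> b"
  then have "((\<lambda>r. A r ** \<Phi> r) has_integral (\<Phi> (b + h) - \<Phi> (a + h))) (cbox (a + h) (b + h))"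
    using fundamental_matrix_has_integral[of "a + h" "b + h"] by simp
  from has_integral_affinity[OF this, of 1 h]
  show "((\<lambda>r. A (r + h) ** \<Phi> (r + h)) has_integral (\<Phi> (b + h) - \<Phi> (a + h))) {a..b}" by simp
qed

text \<open>Time reversal exchanges forward and backward evolution, so that backward estimates
  follow from forward ones.\<close>

lemma fundamental_matrix_reflect: "fundamental_matrix (\<lambda>t. - A (- t)) (\<lambda>t. \<Phi> (- t))"
  unfolding fundamental_matrix_def
proof (intro conjI allI impI fundamental_matrix_invertible)
  fix a b :: real assume "a \<le> b"
  then have "((\<lambda>r. A r ** \<Phi> r) has_integral (\<Phi> (- a) - \<Phi> (- b))) {- b..- a}"
    using fundamental_matrix_has_integral[of "- b" "- a"] by simp
  then have "((\<lambda>r. A (- r) ** \<Phi> (- r)) has_integral (\<Phi> (- a) - \<Phi> (- b))) {a..b}"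
    by (subst (asm) has_integral_reflect_real[symmetric]) simp
  from has_integral_neg[OF this]
  show "((\<lambda>r. - A (- r) ** \<Phi> (- r)) has_integral (\<Phi> (- b) - \<Phi> (- a))) {a..b}"
    by (simp add: matrix_mult.minus_left)
qed

lemma fundamental_matrix_continuous: "continuous_on UNIV \<Phi>"
  unfolding continuous_on_eq_continuous_at[OF open_UNIV]
proof
  fix x
  have "(\<lambda>r. A r ** \<Phi> r) integrable_on {x - 1..x + 1}"
    using fundamental_matrix_has_integral[of "x - 1" "x + 1"] by auto
  then have "continuous_on {x - 1..x + 1} (\<lambda>y. \<Phi> (x - 1) + integral {x - 1..y} (\<lambda>r. A r ** \<Phi> r))"
    by (intro continuous_intros indefinite_integral_continuous_1)
  moreover have "\<Phi> (x - 1) + integral {x - 1..y} (\<lambda>r. A r ** \<Phi> r) = \<Phi> y" if "y \<in> {x - 1..x + 1}" for y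
    using integral_unique[OF fundamental_matrix_has_integral[of "x - 1" y]] that by simp
  ultimately have "continuous_on {x - 1..x + 1} \<Phi>" by (rule continuous_on_eq)
  then show "isCont \<Phi> x" by (rule continuous_on_interior) simp
qed

lemma fundamental_matrix_inv_continuous: "continuous_on UNIV (\<lambda>t. matrix_inv (\<Phi> t))"
  using fundamental_matrix_continuous unfolding continuous_on_def
  by (auto intro!: tendsto_matrix_inv fundamental_matrix_invertible)

text \<open>\<open>A\<close> is recovered as (A \<Phi>) \<Phi>^-1, where the first factor is locally
  integrable, hence measurable, and the second is continuous.\<close>

lemma fundamental_matrix_measurable: "A \<in> borel_measurable lebesgue"
proof -
  let ?f = "\<lambda>r. A r ** \<Phi> r"
  have "?f \<in> borel_measurable lebesgue"
  proof (rule borel_measurable_LIMSEQ_metric)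
    fix n :: nat
    have "?f integrable_on {- real n..real n}"
      using fundamental_matrix_has_integral[of "- real n" "real n"] by auto
    then show "(\<lambda>r. if r \<in> {- real n..real n} then ?f r else 0) \<in> borel_measurable lebesgue"
      by (subst borel_measurable_if) (auto intro: integrable_imp_measurable)
  next
    fix r :: real
    have "\<forall>\<^sub>F n in sequentially. \<bar>r\<bar> \<le> real n"
      by (rule eventually_at_top_linorderI[of "nat \<lceil>\<bar>r\<bar>\<rceil>"]) linarith
    then have "\<forall>\<^sub>F n in sequentially. (if r \<in> {- real n..real n} then ?f r else 0) = ?f r"
      by eventually_elim (auto simp: abs_le_iff)
    then show "(\<lambda>n. if r \<in> {- real n..real n} then ?f r else 0) \<longlonglongrightarrow> ?f r"
      by (rule tendsto_eventually)
  qed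
  then have "(\<lambda>r. ?f r ** matrix_inv (\<Phi> r)) \<in> borel_measurable lebesgue"
    by (rule borel_measurable_continuous_Pair[OF _
          continuous_imp_lebesgue_measurable[OF fundamental_matrix_inv_continuous]])
      (intro matrix_mult.continuous_on continuous_intros)
  then show ?thesis
    by (simp add: matrix_mul_assoc[symmetric] matrix_inv_right[OF fundamental_matrix_invertible])
qed

text \<open>The cocycle identity: the two inner values at r cancel, so an evolution can be split at
  any intermediate time.\<close>

lemma evolution_mult: "evolution Q \<Phi> t r ** evolution R \<Phi> r s = evolution (Q ** R) \<Phi> t s"
  unfolding evolution_def
  by (metis matrix_inv_left[OF fundamental_matrix_invertible] matrix_mul_assoc matrix_mul_rid)

text \<open>A constant right factor that commutes with \<open>Q\<close> cancels. Hence normalising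
  the translated fundamental matrix at 0 leaves its Green matrix unchanged.\<close>

lemma evolution_shift:
  assumes "invertible C" "Q ** C = C ** Q"
  shows "evolution Q (\<lambda>t. \<Phi> (t + h) ** C) t s = evolution Q \<Phi> (t + h) (s + h)"
  unfolding evolution_def matrix_inv_mult[OF fundamental_matrix_invertible assms(1)]
  by (metis assms matrix_inv_right matrix_mul_assoc matrix_mul_rid)

lemma evolution_continuous_left: "continuous_on UNIV (\<lambda>t. evolution Q \<Phi> t s)"
  unfolding evolution_def
  by (intro matrix_mult.continuous_on continuous_on_const fundamental_matrix_continuous)

lemma evolution_continuous_right: "continuous_on UNIV (\<lambda>s. evolution Q \<Phi> t s)"
  unfolding evolution_def
  by (intro matrix_mult.continuous_on continuous_on_const fundamental_matrix_inv_continuous)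

lemma evolution_has_integral:
  assumes "s \<le> t"
  shows "((\<lambda>r. A r ** evolution (mat 1) \<Phi> r s) has_integral (evolution (mat 1) \<Phi> t s - mat 1)) {s..t}"
  using has_integral_linear[OF fundamental_matrix_has_integral[OF assms]
      matrix_mult.bounded_linear_left[of "matrix_inv (\<Phi> s)"]]
  by (simp add: evolution_def o_def matrix_mul_assoc matrix_mult.diff_left
      matrix_inv_right[OF fundamental_matrix_invertible])

text \<open>Gronwall applied to the integrated equation. The factor \<open>norm (mat 1)\<close> is
  the Frobenius norm of the identity, the square root of the dimension.\<close>

lemma evolution_growth:
  assumes M: "\<And>t. norm (A t) \<le> M" and "s \<le> t"
  shows "norm (evolution (mat 1) \<Phi> t s) \<le> norm (mat 1 :: complex ^ 'p ^ 'p) * exp (M * (t - s))"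
proof (rule gronwall)
  let ?U = "\<lambda>r. evolution (mat 1) \<Phi> r s"
  have cont: "continuous_on {a..b} (\<lambda>r. norm (?U r))" for a b
    by (intro continuous_on_norm continuous_on_subset[OF evolution_continuous_left]) auto
  then show "continuous_on {s..t} (\<lambda>r. norm (?U r))" .
  show "0 \<le> M" using M norm_ge_zero order_trans by blast
  fix x assume x: "s \<le> x" "x \<le> t"
  have "norm (?U x - mat 1) = norm (integral {s..x} (\<lambda>r. A r ** ?U r))"
    using integral_unique[OF evolution_has_integral[OF x(1)]] by simp
  also have "\<dots> \<le> integral {s..x} (\<lambda>r. M * norm (?U r))"
  proof (rule integral_norm_bound_integral)
    show "(\<lambda>r. A r ** ?U r) integrable_on {s..x}" using evolution_has_integral[OF x(1)] by blast
    show "(\<lambda>r. M * norm (?U r)) integrable_on {s..x}"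
      by (intro integrable_continuous_real continuous_intros cont)
    show "norm (A r ** ?U r) \<le> M * norm (?U r)" for r
      by (rule order_trans[OF norm_matrix_mult_le mult_right_mono[OF M norm_ge_zero]])
  qed
  also have "\<dots> = M * integral {s..x} (\<lambda>r. norm (?U r))" by simp
  finally show "norm (?U x) \<le> norm (mat 1 :: complex ^ 'p ^ 'p) + M * integral {s..x} (\<lambda>r. norm (?U r))"
    using norm_triangle_sub[of "?U x" "mat 1"] by linarith
qed (rule assms)

text \<open>\<open>h\<close> is a fixed horizon: the constant is the same on all intervals no longer
  than h, as a subdivision argument requires.\<close>

lemma evolution_near_identity:
  assumes M: "\<And>t. norm (A t) \<le> M" and st: "s \<le> t" "t - s \<le> h"
  shows "norm (evolution (mat 1) \<Phi> t s - mat 1) \<le> M * (norm (mat 1 :: complex ^ 'p ^ 'p) * exp (M * h)) * (t - s)"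
proof -
  have "0 \<le> M" using M norm_ge_zero order_trans by blast
  have "norm (evolution (mat 1) \<Phi> t s - mat 1)
      \<le> M * (norm (mat 1 :: complex ^ 'p ^ 'p) * exp (M * h)) * measure lborel (cbox s t)"
  proof (rule has_integral_bound)
    show "((\<lambda>r. A r ** evolution (mat 1) \<Phi> r s) has_integral (evolution (mat 1) \<Phi> t s - mat 1)) (cbox s t)"
      using evolution_has_integral[OF st(1)] by simp
    show "0 \<le> M * (norm (mat 1 :: complex ^ 'p ^ 'p) * exp (M * h))" using \<open>0 \<le> M\<close> by simp
    fix r assume r: "r \<in> cbox s t"
    have "norm (evolution (mat 1) \<Phi> r s) \<le> norm (mat 1 :: complex ^ 'p ^ 'p) * exp (M * (r - s))"
      using r by (intro evolution_growth M) auto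
    also have "\<dots> \<le> norm (mat 1 :: complex ^ 'p ^ 'p) * exp (M * h)"
      using r st \<open>0 \<le> M\<close> by (auto intro!: mult_left_mono)
    finally have "norm (evolution (mat 1) \<Phi> r s) \<le> norm (mat 1 :: complex ^ 'p ^ 'p) * exp (M * h)" .
    then show "norm (A r ** evolution (mat 1) \<Phi> r s) \<le> M * (norm (mat 1 :: complex ^ 'p ^ 'p) * exp (M * h))"
      using \<open>0 \<le> M\<close> by (intro order_trans[OF norm_matrix_mult_le mult_mono] M) auto
  qed
  then show ?thesis using st(1) by simp
qed

end

lemma evolution_growth_abs:
  fixes A \<Phi> :: "real \<Rightarrow> complex ^ 'p ^ 'p"
  assumes fm: "fundamental_matrix A \<Phi>" and M: "\<And>t. norm (A t) \<le> M"
  shows "norm (evolution (mat 1) \<Phi> t s) \<le> norm (mat 1 :: complex ^ 'p ^ 'p) * exp (M * \<bar>t - s\<bar>)"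
proof (cases "s \<le> t")
  case False
  let ?n = "norm (mat 1 :: complex ^ 'p ^ 'p)"
  have "norm (evolution (mat 1) (\<lambda>t. \<Phi> (- t)) (- t) (- s)) \<le> ?n * exp (M * (- t - - s))"
  proof (rule evolution_growth[OF fundamental_matrix_reflect[OF fm]])
    show "norm (- A (- t)) \<le> M" for t by (simp add: M)
  qed (use False in simp)
  then show ?thesis using False by (simp add: evolution_def)
qed (use evolution_growth[OF fm M] in simp)

text \<open>For either sign of z; it turns the exponential factor lost over a short step into 1 +
  O(step).\<close>

lemma exp_le_one_plus: "exp z \<le> 1 + \<bar>z\<bar> * exp \<bar>z\<bar>" for z :: real
proof -
  have "exp z * (1 - z) \<le> exp z * exp (- z)"
    using exp_ge_add_one_self[of "- z"] by (intro mult_left_mono) auto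
  then have "exp z * (1 - z) \<le> 1" by (simp add: exp_minus)
  then have "exp z \<le> 1 + z * exp z" by (simp add: algebra_simps)
  also have "z * exp z \<le> \<bar>z\<bar> * exp \<bar>z\<bar>" by (intro mult_mono) auto
  finally show ?thesis by simp
qed

section \<open>Comparison of two bounded systems\<close>

context
  fixes A A' \<Phi> \<Phi>' :: "real \<Rightarrow> complex ^ 'p ^ 'p" and M :: real
  assumes fm: "fundamental_matrix A \<Phi>" and fm': "fundamental_matrix A' \<Phi>'"
    and M: "\<And>t. norm (A t) \<le> M" and M': "\<And>t. norm (A' t) \<le> M"
begin

lemma norm_coefficient_diff_integrable: "(\<lambda>r. norm (A' r - A r)) integrable_on {a..b}"
proof (rule integrable_on_bounded_measurable[where N="M + M"])
  show "(\<lambda>r. norm (A' r - A r)) \<in> borel_measurable lebesgue"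
    by (intro measurable_compose[OF borel_measurable_diff borel_measurable_norm]
        fundamental_matrix_measurable[OF fm] fundamental_matrix_measurable[OF fm'])
  show "norm (norm (A' x - A x)) \<le> M + M" for x
    using norm_triangle_ineq4[of "A' x" "A x"] M[of x] M'[of x] by simp
qed

text \<open>With U and V the two evolutions from s, A' V - A U = (A' - A) + A' (V - 1) - A (U - 1).
  The last two terms are O(t - s) and integrate to a quadratic error.\<close>

lemma evolution_diff_local:
  assumes "s \<le> t" "t - s \<le> h"
  shows "norm (evolution (mat 1) \<Phi>' t s - evolution (mat 1) \<Phi> t s)
    \<le> integral {s..t} (\<lambda>r. norm (A' r - A r))
      + 2 * M * (M * (norm (mat 1 :: complex ^ 'p ^ 'p) * exp (M * h))) * (t - s)\<^sup>2"
proof -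
  have "0 \<le> M" using M norm_ge_zero order_trans by blast
  define L where "L = M * (norm (mat 1 :: complex ^ 'p ^ 'p) * exp (M * h))"
  have "0 \<le> L" unfolding L_def using \<open>0 \<le> M\<close> by simp
  let ?U = "\<lambda>r. evolution (mat 1) \<Phi> r s" and ?V = "\<lambda>r. evolution (mat 1) \<Phi>' r s"
  have int: "((\<lambda>r. A' r ** ?V r - A r ** ?U r) has_integral (?V t - mat 1 - (?U t - mat 1))) {s..t}"
    by (intro has_integral_diff evolution_has_integral[OF fm] evolution_has_integral[OF fm'] assms)
  have "norm (?V t - ?U t) = norm (integral {s..t} (\<lambda>r. A' r ** ?V r - A r ** ?U r))"
    using integral_unique[OF int] by simp
  also have "\<dots> \<le> integral {s..t} (\<lambda>r. norm (A' r - A r) + 2 * M * (L * (t - s)))"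
  proof (rule integral_norm_bound_integral)
    show "(\<lambda>r. A' r ** ?V r - A r ** ?U r) integrable_on {s..t}" using int by blast
    show "(\<lambda>r. norm (A' r - A r) + 2 * M * (L * (t - s))) integrable_on {s..t}"
      by (intro integrable_add norm_coefficient_diff_integrable integrable_const_ivl)
    fix r assume r: "r \<in> {s..t}"
    have "norm (?U r - mat 1) \<le> L * (r - s)" "norm (?V r - mat 1) \<le> L * (r - s)"
      unfolding L_def using r assms
      by (auto intro!: evolution_near_identity[OF fm M] evolution_near_identity[OF fm' M'])
    moreover have "L * (r - s) \<le> L * (t - s)" using r \<open>0 \<le> L\<close> by (intro mult_left_mono) auto
    ultimately have n: "norm (?U r - mat 1) \<le> L * (t - s)" "norm (?V r - mat 1) \<le> L * (t - s)" by auto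
    have eq: "A' r ** ?V r - A r ** ?U r = (A' r - A r) + A' r ** (?V r - mat 1) - A r ** (?U r - mat 1)"
      by (simp add: matrix_mult.diff_right)
    have "norm (A' r ** (?V r - mat 1)) \<le> M * (L * (t - s))"
      using n \<open>0 \<le> M\<close> by (intro order_trans[OF norm_matrix_mult_le mult_mono] M') auto
    moreover have "norm (A r ** (?U r - mat 1)) \<le> M * (L * (t - s))"
      using n \<open>0 \<le> M\<close> by (intro order_trans[OF norm_matrix_mult_le mult_mono] M) auto
    moreover have "norm (A' r ** ?V r - A r ** ?U r) \<le> norm (A' r - A r)
        + norm (A' r ** (?V r - mat 1)) + norm (A r ** (?U r - mat 1))"
      unfolding eq by (rule order_trans[OF norm_triangle_ineq4 add_right_mono[OF norm_triangle_ineq]])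
    ultimately show "norm (A' r ** ?V r - A r ** ?U r) \<le> norm (A' r - A r) + 2 * M * (L * (t - s))"
      by simp
  qed
  also have "\<dots> = integral {s..t} (\<lambda>r. norm (A' r - A r)) + 2 * M * L * (t - s)\<^sup>2"
    using assms by (subst integral_add[OF norm_coefficient_diff_integrable integrable_const_ivl])
      (simp add: power2_eq_square)
  finally show ?thesis unfolding L_def .
qed

text \<open>
  The decay rate \<open>\<alpha>\<close> may be negative, so that with \<open>Q = mat 1\<close> the lemma also covers the growth
  of the full evolution. It estimates the increments of
  \<open>r \<mapsto> evolution Q \<Phi> t r ** evolution Q \<Phi>' r s\<close>.
\<close>

lemma evolution_diff_le:
  assumes QQ: "Q ** Q = Q"
    and Q: "\<And>t. Q ** \<Phi> t = \<Phi> t ** Q" and Q': "\<And>t. Q ** \<Phi>' t = \<Phi>' t ** Q"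
    and c: "\<And>s t. s \<le> t \<Longrightarrow> norm (evolution Q \<Phi> t s) \<le> c * exp (- \<alpha> * (t - s))"
    and c': "\<And>s t. s \<le> t \<Longrightarrow> norm (evolution Q \<Phi>' t s) \<le> c * exp (- \<alpha> * (t - s))"
    and "s \<le> t"
  shows "norm (evolution Q \<Phi>' t s - evolution Q \<Phi> t s)
    \<le> c\<^sup>2 * exp (- \<alpha> * (t - s)) * integral {s..t} (\<lambda>r. norm (A' r - A r))"
proof -
  have "0 \<le> M" using M norm_ge_zero order_trans by blast
  have "0 \<le> c" using order_trans[OF norm_ge_zero c[of 0 0]] by simp
  let ?a = "\<lambda>r. norm (A' r - A r)"
  note inv = fundamental_matrix_invertible[OF fm] and inv' = fundamental_matrix_invertible[OF fm']
  note aint = norm_coefficient_diff_integrable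
  define D where "D = c\<^sup>2 * exp (- \<alpha> * (t - s))"
  define C where "C = 2 * M * (M * (norm (mat 1 :: complex ^ 'p ^ 'p) * exp (M * (t - s))))"
  define E where "E = \<bar>\<alpha>\<bar> * exp (\<bar>\<alpha>\<bar> * (t - s))"
  \<comment> \<open>At r = s this is the evolution of \<Phi>, at r = t that of \<Phi>'. The bounds
    on its two factors multiply to c^2 exp (- \<alpha> (t - s)) for every r.\<close>
  define K where "K r = evolution Q \<Phi> t r ** evolution Q \<Phi>' r s" for r
  have D0: "0 \<le> D" "0 \<le> C" "0 \<le> E" unfolding D_def C_def E_def using \<open>0 \<le> M\<close> by auto
  have Kt: "K t = evolution Q \<Phi>' t s"
  proof -
    have "evolution Q \<Phi> t t = Q"
      unfolding evolution_def Q[symmetric] by (simp add: matrix_mul_assoc[symmetric] matrix_inv_right[OF inv])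
    then show ?thesis unfolding K_def by (simp add: evolution_def matrix_mul_assoc Q')
        (simp add: matrix_mul_assoc[symmetric] QQ)
  qed
  have Ks: "K s = evolution Q \<Phi> t s"
  proof -
    have "evolution Q \<Phi>' s s = Q"
      unfolding evolution_def Q'[symmetric] by (simp add: matrix_mul_assoc[symmetric] matrix_inv_right[OF inv'])
    moreover have "matrix_inv (\<Phi> s) ** Q = Q ** matrix_inv (\<Phi> s)"
      by (metis Q inv matrix_inv_left matrix_inv_right matrix_mul_assoc matrix_mul_lid matrix_mul_rid)
    ultimately show ?thesis unfolding K_def evolution_def
      by (metis QQ matrix_mul_assoc)
  qed
  have "norm (K t - K s) \<le> integral {s..t} (\<lambda>r. D * ?a r)"
  proof (rule norm_increment_le_integral[OF _ \<open>s \<le> t\<close>])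
    show "(\<lambda>r. D * ?a r) integrable_on {s..t}" using aint by (rule integrable_on_mult_right)
    fix x y assume xy: "s \<le> x" "x \<le> y" "y \<le> t"
    define h where "h = y - x"
    have h: "0 \<le> h" "h \<le> t - s" using xy by (auto simp: h_def)
    let ?W = "evolution (mat 1) \<Phi>' y x - evolution (mat 1) \<Phi> y x"
    \<comment> \<open>The first factor of K x is split at y and the second factor of K y at x; the
      outer factors then agree.\<close>
    have "K y - K x = evolution Q \<Phi> t y ** ?W ** evolution Q \<Phi>' x s"
    proof -
      have "K y = evolution Q \<Phi> t y ** (evolution (mat 1) \<Phi>' y x ** evolution Q \<Phi>' x s)"
        unfolding K_def by (simp add: evolution_mult[OF fm'])
      moreover have "K x = (evolution Q \<Phi> t y ** evolution (mat 1) \<Phi> y x) ** evolution Q \<Phi>' x s"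
        unfolding K_def by (simp add: evolution_mult[OF fm])
      ultimately show ?thesis
        by (simp add: matrix_mult.diff_right matrix_mult.diff_left matrix_mul_assoc)
    qed
    also have "norm \<dots> \<le> norm (evolution Q \<Phi> t y) * norm ?W * norm (evolution Q \<Phi>' x s)"
      by (rule order_trans[OF norm_matrix_mult_le mult_right_mono[OF norm_matrix_mult_le norm_ge_zero]])
    also have "\<dots> \<le> (c * exp (- \<alpha> * (t - y))) * (integral {x..y} ?a + C * h\<^sup>2) * (c * exp (- \<alpha> * (x - s)))"
      using evolution_diff_local[of x y "t - s"] xy \<open>0 \<le> c\<close>
      by (intro mult_mono c c') (auto simp: C_def h_def intro!: integral_nonneg aint add_nonneg_nonneg mult_nonneg_nonneg \<open>0 \<le> M\<close>)
    \<comment> \<open>The outer factors skip the interval [x, y], whence the extra exp (\<alpha>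
      h).\<close>
    also have "\<dots> = D * exp (\<alpha> * h) * (integral {x..y} ?a + C * h\<^sup>2)"
    proof -
      have "exp (- \<alpha> * (t - y)) * exp (- \<alpha> * (x - s)) = exp (- \<alpha> * (t - s)) * exp (\<alpha> * h)"
        unfolding exp_add[symmetric] h_def by (simp add: algebra_simps)
      then show ?thesis unfolding D_def power2_eq_square[of c] by (simp add: mult_ac)
    qed
    also have "\<dots> \<le> D * (1 + E * h) * (integral {x..y} ?a + C * h\<^sup>2)"
    proof -
      have "exp (\<alpha> * h) \<le> 1 + \<bar>\<alpha> * h\<bar> * exp \<bar>\<alpha> * h\<bar>" by (rule exp_le_one_plus)
      also have "\<bar>\<alpha> * h\<bar> * exp \<bar>\<alpha> * h\<bar> \<le> (\<bar>\<alpha>\<bar> * h) * exp (\<bar>\<alpha>\<bar> * (t - s))"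
        using h by (intro mult_mono) (auto simp: abs_mult intro!: mult_left_mono)
      also have "\<dots> = E * h" by (simp add: E_def)
      finally show ?thesis using D0 xy
        by (intro mult_right_mono mult_left_mono) (auto intro!: integral_nonneg aint add_nonneg_nonneg)
    qed
    \<comment> \<open>The integral over [x, y] is at most 2 M h, so its product with E h is
      quadratic in h; the remaining terms carry h^2 already.\<close>
    also have "\<dots> \<le> D * integral {x..y} ?a + D * (2 * M * E + C * (1 + E * (t - s))) * h\<^sup>2"
    proof -
      have "integral {x..y} ?a \<le> integral {x..y} (\<lambda>r. 2 * M)"
      proof (intro integral_le aint integrable_const_ivl)
        show "norm (A' r - A r) \<le> 2 * M" for r
          using norm_triangle_ineq4[of "A' r" "A r"] M[of r] M'[of r] by simp
      qed
      then have "E * h * integral {x..y} ?a \<le> E * h * (2 * M * h)"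
        using D0 h xy by (intro mult_left_mono) (auto simp: h_def mult_ac)
      moreover have "C * h\<^sup>2 * (1 + E * h) \<le> C * h\<^sup>2 * (1 + E * (t - s))"
        using D0 h by (intro mult_left_mono add_left_mono) auto
      ultimately have "(1 + E * h) * (integral {x..y} ?a + C * h\<^sup>2)
          \<le> integral {x..y} ?a + (2 * M * E + C * (1 + E * (t - s))) * h\<^sup>2"
        by (simp add: algebra_simps power2_eq_square)
      from mult_left_mono[OF this D0(1)] show ?thesis by (simp add: algebra_simps)
    qed
    finally show "norm (K y - K x) \<le> integral {x..y} (\<lambda>r. D * ?a r)
        + D * (2 * M * E + C * (1 + E * (t - s))) * (y - x)\<^sup>2"
      by (simp add: h_def)
  qed
  then show ?thesis unfolding Kt Ks by (simp add: D_def)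
qed

end

text \<open>The forward comparison for the time-reversed systems at -t and -s, in the form suited to
  the complementary projection \<open>mat 1 - P\<close>.\<close>

lemma evolution_diff_le_reverse:
  assumes fm: "fundamental_matrix A \<Phi>" and fm': "fundamental_matrix A' \<Phi>'"
    and M: "\<And>t. norm (A t) \<le> M" and M': "\<And>t. norm (A' t) \<le> M"
    and QQ: "Q ** Q = Q"
    and Q: "\<And>t. Q ** \<Phi> t = \<Phi> t ** Q" and Q': "\<And>t. Q ** \<Phi>' t = \<Phi>' t ** Q"
    and c: "\<And>s t. t \<le> s \<Longrightarrow> norm (evolution Q \<Phi> t s) \<le> c * exp (- \<alpha> * (s - t))"
    and c': "\<And>s t. t \<le> s \<Longrightarrow> norm (evolution Q \<Phi>' t s) \<le> c * exp (- \<alpha> * (s - t))"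
    and "t \<le> s"
  shows "norm (evolution Q \<Phi>' t s - evolution Q \<Phi> t s)
    \<le> c\<^sup>2 * exp (- \<alpha> * (s - t)) * integral {t..s} (\<lambda>r. norm (A' r - A r))"
proof -
  let ?R = "\<lambda>\<Phi> t. \<Phi> (- t)"
  have refl: "evolution Q (?R \<Phi>) t s = evolution Q \<Phi> (- t) (- s)" for \<Phi> t s
    by (simp add: evolution_def)
  have "norm (evolution Q (?R \<Phi>') (- t) (- s) - evolution Q (?R \<Phi>) (- t) (- s))
    \<le> c\<^sup>2 * exp (- \<alpha> * (- t - - s)) * integral {- s..- t} (\<lambda>r. norm (- A' (- r) - - A (- r)))"
  proof (rule evolution_diff_le[OF fundamental_matrix_reflect[OF fm] fundamental_matrix_reflect[OF fm']])
    show "norm (evolution Q (?R \<Phi>) t s) \<le> c * exp (- \<alpha> * (t - s))" if "s \<le> t" for s t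
      unfolding refl using c[of "- t" "- s"] that by simp
    show "norm (evolution Q (?R \<Phi>') t s) \<le> c * exp (- \<alpha> * (t - s))" if "s \<le> t" for s t
      unfolding refl using c'[of "- t" "- s"] that by simp
  qed (use assms in auto)
  also have "integral {- s..- t} (\<lambda>r. norm (- A' (- r) - - A (- r))) = integral {t..s} (\<lambda>r. norm (A' r - A r))"
    using Henstock_Kurzweil_Integration.integral_reflect_real[of s t "\<lambda>r. norm (- A' r - - A r)"] by (simp add: norm_minus_commute)
  finally show ?thesis by (simp add: refl)
qed

text \<open>The comparison with \<open>Q = mat 1\<close>: the growth bound takes the place of a
  dichotomy bound with rate -M and constant \<open>norm (mat 1)\<close>. The common value at 0
  transfers the result from evolutions to fundamental matrices.\<close>

lemma fundamental_matrix_diff_le: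
  fixes A \<Phi> A' \<Phi>' :: "real \<Rightarrow> complex ^ 'p ^ 'p"
  assumes fm: "fundamental_matrix A \<Phi>" and fm': "fundamental_matrix A' \<Phi>'"
    and M: "\<And>t. norm (A t) \<le> M" and M': "\<And>t. norm (A' t) \<le> M" and eq: "\<Phi>' 0 = \<Phi> 0"
  shows "norm (\<Phi>' t - \<Phi> t)
    \<le> (norm (mat 1 :: complex ^ 'p ^ 'p))\<^sup>2 * exp (M * \<bar>t\<bar>) * norm (\<Phi> 0)
      * integral {- \<bar>t\<bar>..\<bar>t\<bar>} (\<lambda>r. norm (A' r - A r))"
proof -
  let ?I = "norm (mat 1 :: complex ^ 'p ^ 'p)" and ?a = "\<lambda>r. norm (A' r - A r)"
  have U: "\<Psi> t = evolution (mat 1) \<Psi> t 0 ** \<Psi> 0" if "fundamental_matrix B \<Psi>" for B \<Psi>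
    by (simp add: evolution_def matrix_mul_assoc[symmetric] matrix_inv_left[OF fundamental_matrix_invertible[OF that]])
  have sub: "integral {x..y} ?a \<le> integral {- \<bar>t\<bar>..\<bar>t\<bar>} ?a" if "{x..y} \<subseteq> {- \<bar>t\<bar>..\<bar>t\<bar>}" for x y
    using that norm_coefficient_diff_integrable[OF fm fm' M M'] by (intro integral_subset_le) auto
  have "norm (evolution (mat 1) \<Phi>' t 0 - evolution (mat 1) \<Phi> t 0)
    \<le> ?I\<^sup>2 * exp (M * \<bar>t\<bar>) * integral {- \<bar>t\<bar>..\<bar>t\<bar>} ?a"
  proof (cases "0 \<le> t")
    case True
    have "norm (evolution (mat 1) \<Phi>' t 0 - evolution (mat 1) \<Phi> t 0)
      \<le> ?I\<^sup>2 * exp (- (- M) * (t - 0)) * integral {0..t} ?a"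
      using evolution_growth[OF fm M] evolution_growth[OF fm' M'] True
      by (intro evolution_diff_le[OF fm fm' M M']) auto
    also have "\<dots> \<le> ?I\<^sup>2 * exp (- (- M) * (t - 0)) * integral {- \<bar>t\<bar>..\<bar>t\<bar>} ?a"
      using True by (intro mult_left_mono sub) auto
    finally show ?thesis using True by simp
  next
    case False
    have "norm (evolution (mat 1) \<Phi>' t 0 - evolution (mat 1) \<Phi> t 0)
      \<le> ?I\<^sup>2 * exp (- (- M) * (0 - t)) * integral {t..0} ?a"
    proof (rule evolution_diff_le_reverse[OF fm fm' M M'])
      show "norm (evolution (mat 1) \<Phi> t s) \<le> ?I * exp (- (- M) * (s - t))" if "t \<le> s" for t s
        using evolution_growth_abs[OF fm M, of t s] that by simp
      show "norm (evolution (mat 1) \<Phi>' t s) \<le> ?I * exp (- (- M) * (s - t))" if "t \<le> s" for t s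
        using evolution_growth_abs[OF fm' M', of t s] that by simp
    qed (use False in auto)
    also have "\<dots> \<le> ?I\<^sup>2 * exp (- (- M) * (0 - t)) * integral {- \<bar>t\<bar>..\<bar>t\<bar>} ?a"
      using False by (intro mult_left_mono sub) auto
    finally show ?thesis using False by simp
  qed
  then have "norm (evolution (mat 1) \<Phi>' t 0 - evolution (mat 1) \<Phi> t 0) * norm (\<Phi> 0)
      \<le> ?I\<^sup>2 * exp (M * \<bar>t\<bar>) * integral {- \<bar>t\<bar>..\<bar>t\<bar>} ?a * norm (\<Phi> 0)"
    by (rule mult_right_mono) simp
  moreover have "norm (\<Phi>' t - \<Phi> t) \<le> norm (evolution (mat 1) \<Phi>' t 0 - evolution (mat 1) \<Phi> t 0) * norm (\<Phi> 0)"
    by (subst U[OF fm], subst U[OF fm']) (simp only: eq matrix_mult.diff_left[symmetric] norm_matrix_mult_le)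
  ultimately show ?thesis by (simp add: mult_ac)
qed

section \<open>Systems whose coefficients converge pointwise\<close>

context
  fixes A \<Phi> :: "nat \<Rightarrow> real \<Rightarrow> complex ^ 'p ^ 'p" and B :: "real \<Rightarrow> complex ^ 'p ^ 'p" and M :: real
  assumes fm: "\<And>n. fundamental_matrix (A n) (\<Phi> n)"
    and M: "\<And>n t. norm (A n t) \<le> M" and lim: "\<And>t. (\<lambda>n. A n t) \<longlonglongrightarrow> B t"
begin

lemma coefficient_limit_bound: "norm (B t) \<le> M"
  using Lim_bounded[OF tendsto_norm[OF lim]] M by blast

lemma coefficient_limit_measurable: "B \<in> borel_measurable lebesgue"
  by (rule borel_measurable_LIMSEQ_metric[OF fundamental_matrix_measurable[OF fm] lim])

lemma norm_coefficient_limit_diff_integrable: "(\<lambda>r. norm (A n r - B r)) integrable_on {a..b}"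
proof (rule integrable_on_bounded_measurable[where N="M + M"])
  show "(\<lambda>r. norm (A n r - B r)) \<in> borel_measurable lebesgue"
    by (intro measurable_compose[OF borel_measurable_diff borel_measurable_norm]
        coefficient_limit_measurable fundamental_matrix_measurable[OF fm])
  show "norm (norm (A n x - B x)) \<le> M + M" for x
    using norm_triangle_ineq4[of "A n x" "B x"] M[of n x] coefficient_limit_bound[of x] by simp
qed

lemma integral_coefficient_limit_diff:
  "(\<lambda>n. integral {a..b} (\<lambda>r. norm (A n r - B r))) \<longlonglongrightarrow> 0"
proof -
  have "(\<lambda>n. integral {a..b} (\<lambda>r. norm (A n r - B r))) \<longlonglongrightarrow> integral {a..b} (\<lambda>r. 0)"
  proof (rule dominated_convergence(2)[OF norm_coefficient_limit_diff_integrable integrable_const_ivl[of "M + M"]])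
    show "norm (norm (A n x - B x)) \<le> M + M" for x n
      using norm_triangle_ineq4[of "A n x" "B x"] M[of n x] coefficient_limit_bound[of x] by simp
    show "(\<lambda>n. norm (A n x - B x)) \<longlonglongrightarrow> 0" for x
      using lim[of x] by (simp add: LIM_zero tendsto_norm_zero)
  qed
  then show ?thesis by simp
qed

text \<open>Identifies the limit with a fundamental matrix given beforehand. On the way back from
  \<open>B\<close> to \<open>A\<close> this is the original \<Phi>.\<close>

lemma fundamental_matrix_tendsto:
  assumes \<Psi>: "fundamental_matrix B \<Psi>" and eq: "\<And>n. \<Phi> n 0 = \<Psi> 0"
  shows "(\<lambda>n. \<Phi> n t) \<longlonglongrightarrow> \<Psi> t"
proof -
  let ?k = "(norm (mat 1 :: complex ^ 'p ^ 'p))\<^sup>2 * exp (M * \<bar>t\<bar>) * norm (\<Psi> 0)"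
  have "\<forall>n. norm (\<Phi> n t - \<Psi> t) \<le> ?k * integral {- \<bar>t\<bar>..\<bar>t\<bar>} (\<lambda>r. norm (A n r - B r))"
    using fundamental_matrix_diff_le[OF \<Psi> fm coefficient_limit_bound M eq] by blast
  moreover have "(\<lambda>n. ?k * integral {- \<bar>t\<bar>..\<bar>t\<bar>} (\<lambda>r. norm (A n r - B r))) \<longlonglongrightarrow> 0"
    using tendsto_mult[OF tendsto_const integral_coefficient_limit_diff, of ?k] by simp
  ultimately have "(\<lambda>n. \<Phi> n t - \<Psi> t) \<longlonglongrightarrow> 0"
    by (rule Lim_null_comparison[OF always_eventually])
  then show ?thesis by (rule LIM_zero_cancel)
qed

text \<open>Two properties must survive the pointwise limit: invertibility, by a uniform bound on
  the inverses, and the integral equation, by dominated convergence on compact intervals.\<close>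

lemma fundamental_matrix_limit:
  assumes eq: "\<And>n. \<Phi> n 0 = \<Phi>0"
  obtains \<Psi> where "fundamental_matrix B \<Psi>" "\<Psi> 0 = \<Phi>0"
proof -
  let ?I = "norm (mat 1 :: complex ^ 'p ^ 'p)"
  have M0: "0 \<le> M" using M norm_ge_zero order_trans by blast
  have inv0: "invertible \<Phi>0" using fundamental_matrix_invertible[OF fm, of 0 0] eq by simp
  have U: "\<Phi> n t = evolution (mat 1) (\<Phi> n) t 0 ** \<Phi>0" for n t
    by (simp add: evolution_def matrix_mul_assoc[symmetric] eq matrix_inv_left[OF inv0])
  have "Cauchy (\<lambda>n. \<Phi> n t)" for t
  proof (rule Cauchy_if_norm_diff_le)
    let ?k = "?I\<^sup>2 * exp (M * \<bar>t\<bar>) * norm \<Phi>0" and ?T = "{- \<bar>t\<bar>..\<bar>t\<bar>}"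
    let ?e = "\<lambda>n. integral ?T (\<lambda>r. norm (A n r - B r))"
    fix m n
    have "norm (\<Phi> m t - \<Phi> n t) \<le> ?k * integral ?T (\<lambda>r. norm (A m r - A n r))"
      using fundamental_matrix_diff_le[OF fm[of n] fm[of m] M M trans[OF eq eq[symmetric]], of t]
      by (simp only: eq)
    also have "\<dots> \<le> ?k * integral ?T (\<lambda>r. norm (A m r - B r) + norm (A n r - B r))"
    proof (intro mult_left_mono integral_le integrable_add norm_coefficient_limit_diff_integrable
        norm_coefficient_diff_integrable[OF fm fm M M])
      show "norm (A m r - A n r) \<le> norm (A m r - B r) + norm (A n r - B r)" for r
        using norm_triangle_ineq4[of "A m r - B r" "A n r - B r"] by simp
    qed auto
    also have "\<dots> = ?k * ?e m + ?k * ?e n"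
      by (subst integral_add) (auto simp: norm_coefficient_limit_diff_integrable algebra_simps)
    finally show "norm (\<Phi> m t - \<Phi> n t) \<le> ?k * ?e m + ?k * ?e n" .
    show "(\<lambda>n. ?k * ?e n) \<longlonglongrightarrow> 0"
      using tendsto_mult[OF tendsto_const integral_coefficient_limit_diff, of ?k] by simp
  qed
  then have "\<exists>L. (\<lambda>n. \<Phi> n t) \<longlonglongrightarrow> L" for t by (simp add: Cauchy_convergent_iff convergent_def)
  then obtain \<Psi> where \<Psi>: "\<And>t. (\<lambda>n. \<Phi> n t) \<longlonglongrightarrow> \<Psi> t" by metis
  have "fundamental_matrix B \<Psi>"
    unfolding fundamental_matrix_def
  proof (intro conjI allI impI)
    fix t
    show "invertible (\<Psi> t)"
    proof (rule invertible_limit[OF \<Psi> fundamental_matrix_invertible[OF fm]])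
      fix n
      \<comment> \<open>Up to the fixed value at 0 the inverse is a backward evolution, whose growth
        bound is independent of n.\<close>
      have "matrix_inv (\<Phi> n t) = matrix_inv \<Phi>0 ** evolution (mat 1) (\<Phi> n) 0 t"
        by (simp add: evolution_def matrix_mul_assoc eq matrix_inv_left[OF inv0])
      also have "norm \<dots> \<le> norm (matrix_inv \<Phi>0) * (?I * exp (M * \<bar>0 - t\<bar>))"
        by (intro order_trans[OF norm_matrix_mult_le mult_left_mono] evolution_growth_abs[OF fm M]) simp
      finally show "norm (matrix_inv (\<Phi> n t)) \<le> norm (matrix_inv \<Phi>0) * (?I * exp (M * \<bar>0 - t\<bar>))" .
    qed
  next
    fix a b :: real assume "a \<le> b"
    let ?f = "\<lambda>n r. A n r ** \<Phi> n r" and ?C = "M * (?I * exp (M * (\<bar>a\<bar> + \<bar>b\<bar>)) * norm \<Phi>0)"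
    note I = fundamental_matrix_has_integral[OF fm \<open>a \<le> b\<close>]
    have le: "norm (?f n r) \<le> ?C" if "r \<in> {a..b}" for n r
    proof -
      have "norm (evolution (mat 1) (\<Phi> n) r 0) \<le> ?I * exp (M * \<bar>r - 0\<bar>)"
        by (rule evolution_growth_abs[OF fm M])
      also have "\<dots> \<le> ?I * exp (M * (\<bar>a\<bar> + \<bar>b\<bar>))"
        using that M0 by (auto intro!: mult_left_mono)
      finally have "norm (\<Phi> n r) \<le> ?I * exp (M * (\<bar>a\<bar> + \<bar>b\<bar>)) * norm \<Phi>0"
        by (subst U) (intro order_trans[OF norm_matrix_mult_le mult_right_mono], auto)
      then show ?thesis using M0 by (intro order_trans[OF norm_matrix_mult_le mult_mono] M) auto
    qed
    note dc = dominated_convergence[OF has_integral_integrable[OF I] integrable_const_ivl le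
        matrix_mult.tendsto[OF lim \<Psi>]]
    have "(\<lambda>n. integral {a..b} (?f n)) \<longlonglongrightarrow> \<Psi> b - \<Psi> a"
      using tendsto_diff[OF \<Psi>[of b] \<Psi>[of a]] by (simp add: integral_unique[OF I])
    then have "integral {a..b} (\<lambda>r. B r ** \<Psi> r) = \<Psi> b - \<Psi> a"
      using dc(2) LIMSEQ_unique by blast
    then show "((\<lambda>r. B r ** \<Psi> r) has_integral (\<Psi> b - \<Psi> a)) {a..b}"
      using integrable_integral[OF dc(1)] by simp
  qed
  moreover have "\<Psi> 0 = \<Phi>0" using \<Psi>[of 0] by (simp add: eq LIMSEQ_const_iff)
  ultimately show thesis by (rule that)
qed

end


section \<open>The Green matrix\<close>

definition commuting_dichotomy ::
    "(real \<Rightarrow> complex ^ 'p ^ 'p) \<Rightarrow> (real \<Rightarrow> complex ^ 'p ^ 'p) \<Rightarrow> complex ^ 'p ^ 'p \<Rightarrow> real \<Rightarrow> real \<Rightarrow> bool"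
  where "commuting_dichotomy A \<Phi> P c \<alpha> \<longleftrightarrow>
    exponential_dichotomy A \<Phi> P c \<alpha> \<and> (\<forall>t. P ** \<Phi> t = \<Phi> t ** P)"

lemma green_matrix_evolution:
  "green_matrix \<Phi> P t s = (if s \<le> t then evolution P \<Phi> t s else - evolution (mat 1 - P) \<Phi> t s)"
  unfolding green_matrix_def evolution_def by simp

text \<open>The constant right factor restores the value \<Phi>(0) at t = 0, as the definition of
  integral Bi-almost automorphy demands. It commutes with \<open>P\<close> whenever all values of
  \<Phi> do.\<close>

definition shifted_fundamental :: "(real \<Rightarrow> complex ^ 'p ^ 'p) \<Rightarrow> real \<Rightarrow> real \<Rightarrow> complex ^ 'p ^ 'p"
  where "shifted_fundamental \<Phi> h t = \<Phi> (t + h) ** (matrix_inv (\<Phi> h) ** \<Phi> 0)"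

context
  fixes A \<Phi> :: "real \<Rightarrow> complex ^ 'p ^ 'p" and P :: "complex ^ 'p ^ 'p" and c \<alpha> :: real
  assumes cd: "commuting_dichotomy A \<Phi> P c \<alpha>"
begin

lemma
  shows dichotomy_fundamental: "fundamental_matrix A \<Phi>" and dichotomy_idem: "P ** P = P"
    and dichotomy_c_pos: "0 < c" and dichotomy_rate_pos: "0 < \<alpha>"
    and norm_green_matrix_le: "norm (green_matrix \<Phi> P t s) \<le> c * exp (- \<alpha> * \<bar>t - s\<bar>)"
    and dichotomy_commute: "P ** \<Phi> t = \<Phi> t ** P"
  using cd unfolding commuting_dichotomy_def exponential_dichotomy_def by auto

lemma
  shows dichotomy_complement_idem: "(mat 1 - P) ** (mat 1 - P) = mat 1 - P"
    and dichotomy_complement_commute: "(mat 1 - P) ** \<Phi> t = \<Phi> t ** (mat 1 - P)"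
  by (simp_all add: matrix_mult.diff_left matrix_mult.diff_right dichotomy_idem dichotomy_commute)

lemma norm_stable_evolution_le:
  "s \<le> t \<Longrightarrow> norm (evolution P \<Phi> t s) \<le> c * exp (- \<alpha> * (t - s))"
  using norm_green_matrix_le[of t s] by (simp add: green_matrix_evolution)

text \<open>The Green matrix shows this branch only for s > t, so the diagonal is reached by letting
  s + 1 / (n + 1) decrease to s.\<close>

lemma norm_unstable_evolution_le:
  assumes "t \<le> s"
  shows "norm (evolution (mat 1 - P) \<Phi> t s) \<le> c * exp (- \<alpha> * (s - t))"
proof (rule LIMSEQ_le)
  let ?x = "\<lambda>n. s + inverse (real (Suc n))"
  have x: "?x \<longlonglongrightarrow> s"
    using tendsto_add[OF tendsto_const LIMSEQ_inverse_real_of_nat, of s] by simp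
  show "(\<lambda>n. norm (evolution (mat 1 - P) \<Phi> t (?x n))) \<longlonglongrightarrow> norm (evolution (mat 1 - P) \<Phi> t s)"
    by (intro tendsto_norm continuous_on_tendsto_compose[OF evolution_continuous_right[OF dichotomy_fundamental] x]) auto
  show "(\<lambda>n. c * exp (- \<alpha> * (?x n - t))) \<longlonglongrightarrow> c * exp (- \<alpha> * (s - t))"
    by (intro tendsto_intros x)
  have "norm (evolution (mat 1 - P) \<Phi> t (?x n)) \<le> c * exp (- \<alpha> * (?x n - t))" for n
  proof -
    have "0 < inverse (real (Suc n))" by simp
    then have "t < ?x n" using assms by linarith
    then show ?thesis using norm_green_matrix_le[of t "?x n"] by (simp add: green_matrix_evolution del: of_nat_Suc)
  qed
  then show "\<exists>N. \<forall>n\<ge>N. norm (evolution (mat 1 - P) \<Phi> t (?x n)) \<le> c * exp (- \<alpha> * (?x n - t))" by blast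
qed

lemma green_matrix_borel_measurable: "(\<lambda>s. green_matrix \<Phi> P (t + h) (s + h)) \<in> borel_measurable borel"
proof -
  have "continuous_on UNIV (\<lambda>s. evolution Q \<Phi> (t + h) (s + h))" for Q
    by (rule continuous_on_compose2[OF evolution_continuous_right[OF dichotomy_fundamental]])
      (auto intro!: continuous_intros)
  then have "(\<lambda>s. evolution Q \<Phi> (t + h) (s + h)) \<in> borel_measurable borel" for Q
    by (rule borel_measurable_continuous_onI)
  then show ?thesis unfolding green_matrix_evolution
    by (intro measurable_If borel_measurable_uminus) auto
qed

lemma
  shows fundamental_matrix_shifted: "fundamental_matrix (\<lambda>t. A (t + h)) (shifted_fundamental \<Phi> h)"
    and shifted_fundamental_0: "shifted_fundamental \<Phi> h 0 = \<Phi> 0"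
    and green_matrix_shifted: "green_matrix (shifted_fundamental \<Phi> h) P t s = green_matrix \<Phi> P (t + h) (s + h)"
    and commuting_dichotomy_shifted: "commuting_dichotomy (\<lambda>t. A (t + h)) (shifted_fundamental \<Phi> h) P c \<alpha>"
proof -
  note fm = dichotomy_fundamental
  note inv = fundamental_matrix_invertible[OF fm]
  let ?C = "matrix_inv (\<Phi> h) ** \<Phi> 0"
  have C: "invertible ?C" by (intro invertible_mult invertible_matrix_inv inv)
  have "P ** matrix_inv (\<Phi> h) = matrix_inv (\<Phi> h) ** P"
    by (metis dichotomy_commute inv matrix_inv_left matrix_inv_right matrix_mul_assoc matrix_mul_lid matrix_mul_rid)
  then have PC: "P ** ?C = ?C ** P" by (metis dichotomy_commute matrix_mul_assoc)
  have eq: "shifted_fundamental \<Phi> h = (\<lambda>t. \<Phi> (t + h) ** ?C)" by (simp add: shifted_fundamental_def fun_eq_iff)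
  show *: "fundamental_matrix (\<lambda>t. A (t + h)) (shifted_fundamental \<Phi> h)"
    unfolding eq by (rule fundamental_matrix_mult[OF fundamental_matrix_shift[OF fm] C])
  show "shifted_fundamental \<Phi> h 0 = \<Phi> 0"
    by (simp add: shifted_fundamental_def matrix_mul_assoc matrix_inv_right[OF inv])
  have "(mat 1 - P) ** ?C = ?C ** (mat 1 - P)"
    by (simp add: matrix_mult.diff_left matrix_mult.diff_right PC)
  then have G: "green_matrix (shifted_fundamental \<Phi> h) P t s = green_matrix \<Phi> P (t + h) (s + h)" for t s
    unfolding green_matrix_evolution eq using PC by (simp add: evolution_shift[OF fm C])
  then show "green_matrix (shifted_fundamental \<Phi> h) P t s = green_matrix \<Phi> P (t + h) (s + h)" .
  have "P ** shifted_fundamental \<Phi> h t = shifted_fundamental \<Phi> h t ** P" for t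
    unfolding eq by (metis PC dichotomy_commute matrix_mul_assoc)
  moreover have "norm (green_matrix (shifted_fundamental \<Phi> h) P t s) \<le> c * exp (- \<alpha> * \<bar>t - s\<bar>)" for t s
    unfolding G using norm_green_matrix_le[of "t + h" "s + h"] by simp
  ultimately show "commuting_dichotomy (\<lambda>t. A (t + h)) (shifted_fundamental \<Phi> h) P c \<alpha>"
    unfolding commuting_dichotomy_def exponential_dichotomy_def
    using * dichotomy_idem dichotomy_c_pos dichotomy_rate_pos by blast
qed

end

text \<open>Both systems share \<open>P\<close>, \<open>c\<close> and \<alpha>, so the comparison
  applies to each branch, backward in time for the complement. The result has the shape expected by
  the convolution estimates.\<close>

lemma
  assumes cd: "commuting_dichotomy A \<Phi> P c \<alpha>" and cd': "commuting_dichotomy A' \<Phi>' P c \<alpha>"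
    and M: "\<And>t. norm (A t) \<le> M" and M': "\<And>t. norm (A' t) \<le> M"
  shows stable_evolution_diff_le: "s \<le> t \<Longrightarrow> norm (evolution P \<Phi>' t s - evolution P \<Phi> t s)
      \<le> c\<^sup>2 * (exp (- \<alpha> * (t - s)) * integral {s..t} (\<lambda>r. norm (A' r - A r)))"
    and unstable_evolution_diff_le: "t \<le> s \<Longrightarrow>
      norm (evolution (mat 1 - P) \<Phi>' t s - evolution (mat 1 - P) \<Phi> t s)
      \<le> c\<^sup>2 * (exp (- \<alpha> * (s - t)) * integral {t..s} (\<lambda>r. norm (A' r - A r)))"
  using evolution_diff_le[OF dichotomy_fundamental[OF cd] dichotomy_fundamental[OF cd'] M M'
      dichotomy_idem[OF cd] dichotomy_commute[OF cd] dichotomy_commute[OF cd']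
      norm_stable_evolution_le[OF cd] norm_stable_evolution_le[OF cd']]
    evolution_diff_le_reverse[OF dichotomy_fundamental[OF cd] dichotomy_fundamental[OF cd'] M M'
      dichotomy_complement_idem[OF cd] dichotomy_complement_commute[OF cd] dichotomy_complement_commute[OF cd']
      norm_unstable_evolution_le[OF cd] norm_unstable_evolution_le[OF cd']]
  by (simp_all add: mult.assoc)

text \<open>The exponential bound and commutation are closed conditions, so the limit system keeps
  the same c and \<alpha>.\<close>

lemma
  assumes cd: "\<And>n. commuting_dichotomy (A n) (\<Phi> n) P c \<alpha>" and fm: "fundamental_matrix B \<Psi>"
    and lim: "\<And>t. (\<lambda>n. \<Phi> n t) \<longlonglongrightarrow> \<Psi> t"
  shows green_matrix_tendsto: "(\<lambda>n. green_matrix (\<Phi> n) P t s) \<longlonglongrightarrow> green_matrix \<Psi> P t s"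
    and commuting_dichotomy_limit: "commuting_dichotomy B \<Psi> P c \<alpha>"
proof -
  have "(\<lambda>n. evolution Q (\<Phi> n) t s) \<longlonglongrightarrow> evolution Q \<Psi> t s" for Q t s
    unfolding evolution_def
    by (intro matrix_mult.tendsto tendsto_const lim tendsto_matrix_inv fundamental_matrix_invertible[OF fm]
        fundamental_matrix_invertible[OF dichotomy_fundamental[OF cd]])
  then have G: "(\<lambda>n. green_matrix (\<Phi> n) P t s) \<longlonglongrightarrow> green_matrix \<Psi> P t s" for t s
    unfolding green_matrix_evolution by (simp add: tendsto_minus)
  then show "(\<lambda>n. green_matrix (\<Phi> n) P t s) \<longlonglongrightarrow> green_matrix \<Psi> P t s" .
  have "norm (green_matrix \<Psi> P t s) \<le> c * exp (- \<alpha> * \<bar>t - s\<bar>)" for t s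
    using Lim_bounded[OF tendsto_norm[OF G]] norm_green_matrix_le[OF cd] by blast
  moreover have "P ** \<Psi> t = \<Psi> t ** P" for t
  proof (rule LIMSEQ_unique)
    show "(\<lambda>n. P ** \<Phi> n t) \<longlonglongrightarrow> P ** \<Psi> t" by (intro matrix_mult.tendsto tendsto_const lim)
    show "(\<lambda>n. P ** \<Phi> n t) \<longlonglongrightarrow> \<Psi> t ** P"
      unfolding dichotomy_commute[OF cd] by (intro matrix_mult.tendsto tendsto_const lim)
  qed
  ultimately show "commuting_dichotomy B \<Psi> P c \<alpha>"
    unfolding commuting_dichotomy_def exponential_dichotomy_def
    using fm dichotomy_idem[OF cd] dichotomy_c_pos[OF cd] dichotomy_rate_pos[OF cd] by blast
qed

text \<open>Once \<open>B\<close> has inherited the dichotomy, its translates can be normalised in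
  the same way as those of \<open>A\<close>; their limit is then the given \<Phi>, because the
  values at 0 agree.\<close>

lemma translation_limit_dichotomy:
  fixes A \<Phi> :: "real \<Rightarrow> complex ^ 'p ^ 'p"
  assumes cd: "commuting_dichotomy A \<Phi> P c \<alpha>" and M: "\<And>t. norm (A t) \<le> M"
    and tl: "translation_limit A \<xi> B"
  obtains \<Psi> where "commuting_dichotomy B \<Psi> P c \<alpha>" "\<Psi> 0 = \<Phi> 0"
    "\<And>t s. (\<lambda>n. green_matrix \<Phi> P (t + \<xi> n) (s + \<xi> n)) \<longlonglongrightarrow> green_matrix \<Psi> P t s"
    "\<And>t s. (\<lambda>n. green_matrix \<Psi> P (t - \<xi> n) (s - \<xi> n)) \<longlonglongrightarrow> green_matrix \<Phi> P t s"
proof -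
  have AB: "(\<lambda>n. A (t + \<xi> n)) \<longlonglongrightarrow> B t" and BA: "(\<lambda>n. B (t + - \<xi> n)) \<longlonglongrightarrow> A t" for t
    using tl unfolding translation_limit_def by simp_all
  note fmA = fundamental_matrix_shifted[OF cd]
  obtain \<Psi> where \<Psi>: "fundamental_matrix B \<Psi>" "\<Psi> 0 = \<Phi> 0"
    using fundamental_matrix_limit[OF fmA M AB shifted_fundamental_0[OF cd]] by blast
  have "\<And>n. shifted_fundamental \<Phi> (\<xi> n) 0 = \<Psi> 0" using shifted_fundamental_0[OF cd] \<Psi>(2) by simp
  note lim = fundamental_matrix_tendsto[OF fmA M AB \<Psi>(1) this]
  note cdB = commuting_dichotomy_limit[OF commuting_dichotomy_shifted[OF cd] \<Psi>(1) lim]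
  have MB: "norm (B t) \<le> M" for t by (rule coefficient_limit_bound[OF fmA M AB])
  have "\<And>n. shifted_fundamental \<Psi> (- \<xi> n) 0 = \<Phi> 0" using shifted_fundamental_0[OF cdB] \<Psi>(2) by simp
  note lim' = fundamental_matrix_tendsto[OF fundamental_matrix_shifted[OF cdB] MB BA
      dichotomy_fundamental[OF cd] this]
  show thesis
  proof (rule that[OF cdB \<Psi>(2)])
    show "(\<lambda>n. green_matrix \<Phi> P (t + \<xi> n) (s + \<xi> n)) \<longlonglongrightarrow> green_matrix \<Psi> P t s" for t s
      using green_matrix_tendsto[OF commuting_dichotomy_shifted[OF cd] \<Psi>(1) lim]
      by (simp add: green_matrix_shifted[OF cd])
    show "(\<lambda>n. green_matrix \<Psi> P (t - \<xi> n) (s - \<xi> n)) \<longlonglongrightarrow> green_matrix \<Phi> P t s" for t s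
      using green_matrix_tendsto[OF commuting_dichotomy_shifted[OF cdB] dichotomy_fundamental[OF cd] lim']
      by (simp add: green_matrix_shifted[OF cdB])
  qed
qed

text \<open>Both Green matrices obey the same dichotomy bound, so 2 c exp (- \<alpha> |t - s|) is an
  integrable majorant for all n.\<close>

lemma nn_integral_green_matrix_diff_tendsto:
  assumes cd: "\<And>n. commuting_dichotomy (A n) (\<Phi> n) P c \<alpha>" and cd': "commuting_dichotomy B \<Psi> P c \<alpha>"
    and lim: "\<And>s. (\<lambda>n. green_matrix (\<Phi> n) P t s) \<longlonglongrightarrow> green_matrix \<Psi> P t s"
  shows "(\<lambda>n. \<integral>\<^sup>+ s. ennreal (norm (green_matrix (\<Phi> n) P t s - green_matrix \<Psi> P t s)) \<partial>lborel) \<longlonglongrightarrow> 0"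
proof -
  let ?w = "\<lambda>s. 2 * c * exp (- \<alpha> * \<bar>t - s\<bar>)"
  note \<alpha> = dichotomy_rate_pos[OF cd'] and c = dichotomy_c_pos[OF cd']
  have Gm: "(\<lambda>s. green_matrix \<Phi> P t s) \<in> borel_measurable borel" if "commuting_dichotomy A \<Phi> P c \<alpha>" for A \<Phi>
    using green_matrix_borel_measurable[OF that, of t 0] by simp
  have "(\<lambda>n. \<integral>\<^sup>+ s. ennreal (norm (green_matrix (\<Phi> n) P t s - green_matrix \<Psi> P t s)) \<partial>lborel)
      \<longlonglongrightarrow> (\<integral>\<^sup>+ s. 0 \<partial>(lborel :: real measure))"
  proof (rule nn_integral_dominated_convergence[where w="\<lambda>s. ennreal (?w s)"])
    show "(\<lambda>s. ennreal (norm (green_matrix (\<Phi> n) P t s - green_matrix \<Psi> P t s))) \<in> borel_measurable lborel" for n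
      using borel_measurable_diff[OF Gm[OF cd] Gm[OF cd']] by measurable
    have w: "(?w has_integral 2 * c * (2 / \<alpha>)) UNIV"
      by (intro has_integral_mult_right has_integral_exp_abs \<alpha>)
    have wm: "?w \<in> borel_measurable borel" by (intro borel_measurable_continuous_onI continuous_intros)
    show "(\<lambda>s. ennreal (?w s)) \<in> borel_measurable lborel" using wm by measurable
    show "(\<integral>\<^sup>+ s. ennreal (?w s) \<partial>lborel) < \<infinity>"
      using nn_integral_has_integral_lborel[OF wm _ w] c by simp
    show "AE s in lborel. ennreal (norm (green_matrix (\<Phi> n) P t s - green_matrix \<Psi> P t s)) \<le> ennreal (?w s)" for n
    proof (intro always_eventually allI ennreal_leI)
      show "norm (green_matrix (\<Phi> n) P t s - green_matrix \<Psi> P t s) \<le> ?w s" for s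
        using norm_triangle_ineq4[of "green_matrix (\<Phi> n) P t s" "green_matrix \<Psi> P t s"]
          norm_green_matrix_le[OF cd, of n t s] norm_green_matrix_le[OF cd', of t s] by simp
    qed
    show "AE s in lborel. (\<lambda>n. ennreal (norm (green_matrix (\<Phi> n) P t s - green_matrix \<Psi> P t s))) \<longlonglongrightarrow> 0"
    proof (intro always_eventually allI)
      fix s
      have "(\<lambda>n. norm (green_matrix (\<Phi> n) P t s - green_matrix \<Psi> P t s)) \<longlonglongrightarrow> 0"
        using lim[of s] by (simp add: LIM_zero tendsto_norm_zero)
      from tendsto_ennrealI[OF this]
      show "(\<lambda>n. ennreal (norm (green_matrix (\<Phi> n) P t s - green_matrix \<Psi> P t s))) \<longlonglongrightarrow> 0" by simp
    qed
  qed simp_all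
  then show ?thesis by simp
qed

lemma integrally_bi_almost_automorphic_green:
  fixes A \<Phi> :: "real \<Rightarrow> complex ^ 'p ^ 'p"
  assumes aa: "almost_automorphic A" and cd: "commuting_dichotomy A \<Phi> P c \<alpha>"
  shows "integrally_bi_almost_automorphic A \<Phi> P"
  unfolding integrally_bi_almost_automorphic_def
proof (intro conjI allI impI aa)
  fix \<xi> :: "nat \<Rightarrow> real" and B assume tl: "translation_limit A \<xi> B"
  obtain M where M: "\<And>t. norm (A t) \<le> M" using almost_automorphic_bounded[OF aa] by blast
  obtain \<Psi> where \<Psi>: "commuting_dichotomy B \<Psi> P c \<alpha>" "\<Psi> 0 = \<Phi> 0"
    "\<And>t s. (\<lambda>n. green_matrix \<Phi> P (t + \<xi> n) (s + \<xi> n)) \<longlonglongrightarrow> green_matrix \<Psi> P t s"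
    "\<And>t s. (\<lambda>n. green_matrix \<Psi> P (t - \<xi> n) (s - \<xi> n)) \<longlonglongrightarrow> green_matrix \<Phi> P t s"
    using translation_limit_dichotomy[OF cd M tl] by blast
  let ?A = "\<lambda>n. shifted_fundamental \<Phi> (\<xi> n)" and ?B = "\<lambda>n. shifted_fundamental \<Psi> (- \<xi> n)"
  show "\<exists>\<Phi>A \<Phi>B \<Psi>.
        (\<forall>n. fundamental_matrix (\<lambda>t. A (t + \<xi> n)) (\<Phi>A n) \<and> \<Phi>A n 0 = \<Phi> 0) \<and>
        fundamental_matrix B \<Phi>B \<and> \<Phi>B 0 = \<Phi> 0 \<and>
        (\<forall>n. fundamental_matrix (\<lambda>t. B (t - \<xi> n)) (\<Psi> n) \<and> \<Psi> n 0 = \<Phi> 0) \<and>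
        (\<forall>t. (\<lambda>n. \<integral>\<^sup>+ s. ennreal (norm (green_matrix (\<Phi>A n) P t s - green_matrix \<Phi>B P t s)) \<partial>lborel)
               \<longlonglongrightarrow> 0) \<and>
        (\<forall>t. (\<lambda>n. \<integral>\<^sup>+ s. ennreal (norm (green_matrix (\<Psi> n) P t s - green_matrix \<Phi> P t s)) \<partial>lborel)
               \<longlonglongrightarrow> 0)"
  proof (rule exI[of _ ?A], rule exI[of _ \<Psi>], rule exI[of _ ?B], intro conjI allI)
    show "fundamental_matrix (\<lambda>t. A (t + \<xi> n)) (?A n)" for n by (rule fundamental_matrix_shifted[OF cd])
    show "fundamental_matrix (\<lambda>t. B (t - \<xi> n)) (?B n)" for n
      using fundamental_matrix_shifted[OF \<Psi>(1), of "- \<xi> n"] by simp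
    show "fundamental_matrix B \<Psi>" by (rule dichotomy_fundamental[OF \<Psi>(1)])
    show "?A n 0 = \<Phi> 0" for n by (rule shifted_fundamental_0[OF cd])
    show "?B n 0 = \<Phi> 0" for n using shifted_fundamental_0[OF \<Psi>(1)] \<Psi>(2) by simp
    show "(\<lambda>n. \<integral>\<^sup>+ s. ennreal (norm (green_matrix (?A n) P t s - green_matrix \<Psi> P t s)) \<partial>lborel) \<longlonglongrightarrow> 0" for t
      by (rule nn_integral_green_matrix_diff_tendsto[OF commuting_dichotomy_shifted[OF cd] \<Psi>(1)])
        (simp add: green_matrix_shifted[OF cd] \<Psi>(3))
    show "(\<lambda>n. \<integral>\<^sup>+ s. ennreal (norm (green_matrix (?B n) P t s - green_matrix \<Phi> P t s)) \<partial>lborel) \<longlonglongrightarrow> 0" for t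
      by (rule nn_integral_green_matrix_diff_tendsto[OF commuting_dichotomy_shifted[OF \<Psi>(1)] cd])
        (simp add: green_matrix_shifted[OF \<Psi>(1)] \<Psi>(4))
  qed (rule \<Psi>(2))
qed


section \<open>The Green operator\<close>

text \<open>The mirror image on the right half-line under s -> -s.\<close>

lemma integral_exp_convolution_ge:
  fixes a k :: "real \<Rightarrow> real"
  assumes a: "a \<in> borel_measurable lebesgue" "\<And>s. 0 \<le> a s" "\<And>s. a s \<le> N" and \<alpha>: "\<alpha> > 0"
    and k: "k integrable_on {t..}" and "0 \<le> D"
    and le: "\<And>s. t \<le> s \<Longrightarrow> k s \<le> D * (exp (- \<alpha> * (s - t)) * integral {t..s} a)"
  shows "(\<lambda>s. exp (\<alpha> * (t - s)) * a s) integrable_on {t..}"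
    and "integral {t..} k \<le> D / \<alpha> * integral {t..} (\<lambda>s. exp (\<alpha> * (t - s)) * a s)"
proof -
  have am: "(\<lambda>s. a (- s)) \<in> borel_measurable lebesgue"
    using measurable_compose[OF lebesgue_measurable_scaling[of "- 1"] a(1)] by simp
  have refl: "((\<lambda>s. f (- s)) has_integral i) {..- t} \<longleftrightarrow> (f has_integral i) {t..}" for f :: "real \<Rightarrow> real" and i
    using has_integral_reflect_set[of f i "{t..}"] has_integral_reflect_set[of "\<lambda>s. f (- s)" i "{..- t}"] by auto
  have r: "(\<lambda>s. f (- s)) integrable_on {..- t} \<longleftrightarrow> f integrable_on {t..}"
    "integral {..- t} (\<lambda>s. f (- s)) = integral {t..} f" for f :: "real \<Rightarrow> real"
    unfolding integrable_on_def integral_def refl by simp_all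
  have E: "(\<lambda>s. exp (- \<alpha> * (- t - s)) * a (- s)) = (\<lambda>s. exp (\<alpha> * (t - - s)) * a (- s))"
    by (simp add: algebra_simps)
  have "(\<lambda>s. exp (- \<alpha> * (- t - s)) * a (- s)) integrable_on {..- t}"
    using integral_exp_mult_bounded_integrable[OF am a(2,3) \<alpha>] .
  then show "(\<lambda>s. exp (\<alpha> * (t - s)) * a s) integrable_on {t..}"
    unfolding E by (subst (asm) r(1))
  have "integral {..- t} (\<lambda>s. k (- s)) \<le> D / \<alpha> * integral {..- t} (\<lambda>s. exp (- \<alpha> * (- t - s)) * a (- s))"
  proof (rule integral_exp_convolution_le[OF am a(2,3) \<alpha> _ \<open>0 \<le> D\<close>])
    show "(\<lambda>s. k (- s)) integrable_on {..- t}" using k by (subst r(1))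
    fix s assume "s \<le> - t"
    then have "k (- s) \<le> D * (exp (- \<alpha> * (- s - t)) * integral {t..- s} a)" by (intro le) simp
    also have "integral {t..- s} a = integral {s..- t} (\<lambda>r. a (- r))"
      using Henstock_Kurzweil_Integration.integral_reflect_real[of "- s" t a] by simp
    finally show "k (- s) \<le> D * (exp (- \<alpha> * (- t - s)) * integral {s..- t} (\<lambda>r. a (- r)))"
      by (simp add: algebra_simps)
  qed
  then show "integral {t..} k \<le> D / \<alpha> * integral {t..} (\<lambda>s. exp (\<alpha> * (t - s)) * a s)"
    unfolding E by (subst (asm) (1 2) r(2))
qed

lemma L1_L2_const:
  assumes "\<alpha> > 0"
  shows "L1 \<alpha> (\<lambda>s. C) t = C / \<alpha>" and "L2 \<alpha> (\<lambda>s. C) t = C / \<alpha>"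
  using has_integral_exp_atMost[OF assms, of t, THEN has_integral_mult_left, of C, THEN integral_unique]
    has_integral_exp_atLeast[OF assms, of t, THEN has_integral_mult_left, of C, THEN integral_unique]
  by (simp_all add: L1_def L2_def)

context
  fixes a :: "real \<Rightarrow> real" and N \<alpha> :: real
  assumes a: "a \<in> borel_measurable lebesgue" "\<And>s. 0 \<le> a s" "\<And>s. a s \<le> N" and \<alpha>: "\<alpha> > 0"
begin

lemma L1_has_integral: "((\<lambda>s. exp (- \<alpha> * (t - s)) * a s) has_integral L1 \<alpha> a t) {..t}"
  unfolding L1_def by (rule integrable_integral[OF integral_exp_mult_bounded_integrable[OF a \<alpha>]])

text \<open>Taking \<open>k = 0\<close> and \<open>D = 0\<close> extracts the integrability part of
  the convolution estimate.\<close>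

lemma L2_has_integral: "((\<lambda>s. exp (\<alpha> * (t - s)) * a s) has_integral L2 \<alpha> a t) {t..}"
  unfolding L2_def using a(2)
  by (intro integrable_integral integral_exp_convolution_ge(1)[OF a \<alpha> integrable_0 order_refl]) simp

lemma L1_le: "L1 \<alpha> a t \<le> N / \<alpha>"
  unfolding L1_L2_const(1)[OF \<alpha>, of N t, symmetric]
  by (rule has_integral_le[OF L1_has_integral]) (use a \<alpha> has_integral_exp_atMost[OF \<alpha>, of t, THEN has_integral_mult_left, of N] in \<open>auto simp: L1_L2_const[OF \<alpha>]\<close>)

lemma L2_le: "L2 \<alpha> a t \<le> N / \<alpha>"
  unfolding L1_L2_const(2)[OF \<alpha>, of N t, symmetric]
  by (rule has_integral_le[OF L2_has_integral]) (use a \<alpha> has_integral_exp_atLeast[OF \<alpha>, of t, THEN has_integral_mult_left, of N] in \<open>auto simp: L1_L2_const[OF \<alpha>]\<close>)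

end

text \<open>Substituting s + \<xi> for s moves both kernel arguments, so the bound in |t - s| is one
  majorant for all translates, and dominated convergence applies in both directions.\<close>

lemma translation_limit_integral:
  fixes K K' :: "real \<Rightarrow> real \<Rightarrow> 'w::banach"
  assumes int: "\<And>t. K t integrable_on UNIV" and "\<alpha> > 0"
    and bound: "\<And>t s. norm (K t s) \<le> C * exp (- \<alpha> * \<bar>t - s\<bar>)"
    and lim: "\<And>t s. (\<lambda>n. K (t + \<xi> n) (s + \<xi> n)) \<longlonglongrightarrow> K' t s"
    and lim': "\<And>t s. (\<lambda>n. K' (t - \<xi> n) (s - \<xi> n)) \<longlonglongrightarrow> K t s"
    and meas: "\<And>t a b. (\<lambda>s. norm (K (t + a) (s + a) - K (t + b) (s + b))) \<in> borel_measurable lebesgue"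
  shows "translation_limit (\<lambda>t. integral UNIV (K t)) \<xi> (\<lambda>t. integral UNIV (K' t))"
proof -
  have h: "(\<lambda>s. C * exp (- \<alpha> * \<bar>t - s\<bar>)) integrable_on UNIV" for t
    using has_integral_mult_right[OF has_integral_exp_abs[OF \<open>\<alpha> > 0\<close>], of C t] by blast
  have shift: "(\<lambda>s. f (s + a)) integrable_on UNIV" "integral UNIV (\<lambda>s. f (s + a)) = integral UNIV f"
    if "f integrable_on UNIV" for f :: "real \<Rightarrow> 'w" and a
    using has_integral_affine_UNIV[OF integrable_integral[OF that], of 1 a] by (auto simp: integral_unique)
  \<comment> \<open>Norms involving \<open>K'\<close> are limits of norms involving only
    \<open>K\<close>; no measurability of the Banach-valued \<open>K'\<close> enters.\<close>
  have meas': "(\<lambda>s. norm (K (t + a) (s + a) - K' (t + b) (s + b))) \<in> borel_measurable lebesgue" for t a b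
  proof (rule borel_measurable_LIMSEQ_real)
    show "(\<lambda>n. norm (K (t + a) (s + a) - K (t + (b + \<xi> n)) (s + (b + \<xi> n))))
        \<longlonglongrightarrow> norm (K (t + a) (s + a) - K' (t + b) (s + b))" for s
      using lim[of "t + b" "s + b"] by (intro tendsto_intros) (simp add: add.assoc)
  qed (rule meas)
  have bound': "norm (K' t s) \<le> C * exp (- \<alpha> * \<bar>t - s\<bar>)" for t s
  proof (rule Lim_bounded[OF tendsto_norm[OF lim]], intro allI impI)
    show "norm (K (t + \<xi> n) (s + \<xi> n)) \<le> C * exp (- \<alpha> * \<bar>t - s\<bar>)" for n
      using bound[of "t + \<xi> n" "s + \<xi> n"] by simp
  qed
  have Kint: "(\<lambda>s. K (t + \<xi> n) (s + \<xi> n)) integrable_on UNIV" for t n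
    by (rule shift(1)[OF int])
  have Kbd: "norm (K (t + \<xi> n) (s + \<xi> n)) \<le> C * exp (- \<alpha> * \<bar>t - s\<bar>)" for t s n
    using bound[of "t + \<xi> n" "s + \<xi> n"] by simp
  have Kme: "(\<lambda>s. norm (K (t + \<xi> n) (s + \<xi> n) - K' t s)) \<in> borel_measurable lebesgue" for t n
    using meas'[of t "\<xi> n" 0] by simp
  note D = dominated_convergence_banach[OF Kint h Kbd lim Kme]
  have K'bd: "norm (K' (t - \<xi> n) (s - \<xi> n)) \<le> C * exp (- \<alpha> * \<bar>t - s\<bar>)" for t s n
    using bound'[of "t - \<xi> n" "s - \<xi> n"] by simp
  have K'int: "(\<lambda>s. K' (t - \<xi> n) (s - \<xi> n)) integrable_on UNIV" for t n
    using shift(1)[OF D(1), of "t - \<xi> n" "- \<xi> n"] by simp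
  have K'me: "(\<lambda>s. norm (K' (t - \<xi> n) (s - \<xi> n) - K t s)) \<in> borel_measurable lebesgue" for t n
    using meas'[of t 0 "- \<xi> n"] by (simp add: norm_minus_commute)
  note D' = dominated_convergence_banach[OF K'int h K'bd lim' K'me]
  have "(\<lambda>n. integral UNIV (K (t + \<xi> n))) \<longlonglongrightarrow> integral UNIV (K' t)" for t
    using D(2)[of t] by (simp add: shift(2)[OF int])
  moreover have "(\<lambda>n. integral UNIV (K' (t - \<xi> n))) \<longlonglongrightarrow> integral UNIV (K t)" for t
    using D'(2)[of t] shift(2)[OF D(1), of "t - \<xi> n" "- \<xi> n" for n] by simp
  ultimately show ?thesis unfolding translation_limit_def by blast
qed

lemma bcontfun_norm_le_sup_norm:
  assumes "f \<in> bcontfun"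
  shows "norm (f t) \<le> sup_norm f"
proof -
  have "bdd_above (range (\<lambda>t. norm (f t)))"
    using bounded_norm_comp[of f UNIV] assms by (auto simp: bcontfun_def bounded_imp_bdd_above)
  then show ?thesis unfolding sup_norm_def by (intro cSUP_upper) auto
qed

definition green_kernel ::
    "(real \<Rightarrow> complex ^ 'p ^ 'p) \<Rightarrow> complex ^ 'p ^ 'p \<Rightarrow> (real \<Rightarrow> 'v::complex_banach ^ 'p) \<Rightarrow> real \<Rightarrow> real \<Rightarrow> 'v ^ 'p"
  where "green_kernel \<Phi> P \<phi> t s = matrix_act (green_matrix \<Phi> P t s) (\<phi> s)"

lemma green_operator_kernel: "green_operator \<Phi> P \<phi> t = integral UNIV (green_kernel \<Phi> P \<phi> t)"
  unfolding green_operator_def green_kernel_def ..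

context
  fixes A \<Phi> :: "real \<Rightarrow> complex ^ 'p ^ 'p" and P :: "complex ^ 'p ^ 'p" and c \<alpha> :: real
    and \<phi> :: "real \<Rightarrow> 'v::complex_banach ^ 'p"
  assumes cd: "commuting_dichotomy A \<Phi> P c \<alpha>" and \<phi>: "\<phi> \<in> bcontfun"
begin

lemma \<phi>_continuous: "continuous_on UNIV \<phi>"
  using \<phi> by (simp add: bcontfun_def)

lemma norm_green_kernel_le: "norm (green_kernel \<Phi> P \<phi> t s) \<le> c * sup_norm \<phi> * exp (- \<alpha> * \<bar>t - s\<bar>)"
proof -
  have "norm (green_kernel \<Phi> P \<phi> t s) \<le> norm (green_matrix \<Phi> P t s) * norm (\<phi> s)"
    unfolding green_kernel_def by (rule norm_matrix_act_le)
  also have "\<dots> \<le> c * exp (- \<alpha> * \<bar>t - s\<bar>) * sup_norm \<phi>"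
    using dichotomy_c_pos[OF cd]
    by (intro mult_mono norm_green_matrix_le[OF cd] bcontfun_norm_le_sup_norm[OF \<phi>]) auto
  finally show ?thesis by (simp add: mult_ac)
qed

text \<open>Shifting both arguments keeps the break point at s = t for every h. Two shifted kernels
  therefore have a common break point, and the norm of their difference is piecewise
  continuous.\<close>

lemma green_kernel_pieces:
  obtains f g where "continuous_on UNIV f" "continuous_on UNIV g"
    "\<And>s. green_kernel \<Phi> P \<phi> (t + h) (s + h) = (if s \<le> t then f s else g s)"
proof
  have ev: "continuous_on UNIV (\<lambda>s. evolution Q \<Phi> (t + h) (s + h))" for Q
    by (rule continuous_on_compose2[OF evolution_continuous_right[OF dichotomy_fundamental[OF cd]]])
      (auto intro!: continuous_intros)
  have ph: "continuous_on UNIV (\<lambda>s. \<phi> (s + h))"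
    by (rule continuous_on_compose2[OF \<phi>_continuous]) (auto intro!: continuous_intros)
  show "continuous_on UNIV (\<lambda>s. matrix_act (evolution P \<Phi> (t + h) (s + h)) (\<phi> (s + h)))"
    "continuous_on UNIV (\<lambda>s. matrix_act (- evolution (mat 1 - P) \<Phi> (t + h) (s + h)) (\<phi> (s + h)))"
    by (intro matrix_act.continuous_on continuous_on_minus ev ph)+
  show "green_kernel \<Phi> P \<phi> (t + h) (s + h) =
      (if s \<le> t then matrix_act (evolution P \<Phi> (t + h) (s + h)) (\<phi> (s + h))
       else matrix_act (- evolution (mat 1 - P) \<Phi> (t + h) (s + h)) (\<phi> (s + h)))" for s
    by (simp add: green_kernel_def green_matrix_evolution)
qed

lemma green_kernel_integrable: "green_kernel \<Phi> P \<phi> t integrable_on UNIV"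
proof (rule integrable_on_all_intervals_UNIV[OF _ norm_green_kernel_le])
  obtain f g where fg: "continuous_on UNIV f" "continuous_on UNIV g"
    "\<And>s. green_kernel \<Phi> P \<phi> (t + 0) (s + 0) = (if s \<le> t then f s else g s)"
    using green_kernel_pieces by blast
  have "green_kernel \<Phi> P \<phi> t = (\<lambda>s. if s \<le> t then f s else g s)" using fg(3) by auto
  then show "green_kernel \<Phi> P \<phi> t integrable_on cbox a b" for a b
    using integrable_piecewise_continuous[OF fg(1,2)] by simp
  show "(\<lambda>s. c * sup_norm \<phi> * exp (- \<alpha> * \<bar>t - s\<bar>)) integrable_on UNIV"
    using has_integral_mult_right[OF has_integral_exp_abs[OF dichotomy_rate_pos[OF cd]], of "c * sup_norm \<phi>" t]
    by blast
qed

lemma green_kernel_diff_measurable: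
  "(\<lambda>s. norm (green_kernel \<Phi> P \<phi> (t + a) (s + a) - green_kernel \<Phi> P \<phi> (t + b) (s + b))) \<in> borel_measurable lebesgue"
proof -
  obtain f g where fg: "continuous_on UNIV f" "continuous_on UNIV g"
    "\<And>s. green_kernel \<Phi> P \<phi> (t + a) (s + a) = (if s \<le> t then f s else g s)"
    using green_kernel_pieces by blast
  obtain f' g' where fg': "continuous_on UNIV f'" "continuous_on UNIV g'"
    "\<And>s. green_kernel \<Phi> P \<phi> (t + b) (s + b) = (if s \<le> t then f' s else g' s)"
    using green_kernel_pieces by blast
  have eq: "(\<lambda>s. norm (green_kernel \<Phi> P \<phi> (t + a) (s + a) - green_kernel \<Phi> P \<phi> (t + b) (s + b)))
      = (\<lambda>s. if s \<le> t then norm (f s - f' s) else norm (g s - g' s))"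
    by (auto simp: fg(3) fg'(3))
  have "(\<lambda>s. norm (f s - f' s)) \<in> borel_measurable borel" "(\<lambda>s. norm (g s - g' s)) \<in> borel_measurable borel"
    using fg fg' by (auto intro!: borel_measurable_continuous_onI continuous_intros)
  then show ?thesis unfolding eq
    by (intro borel_imp_lebesgue_measurable measurable_If) auto
qed

text \<open>The dichotomy bound integrates to c / \<alpha> on each side of t, hence the factor 2
  c.\<close>

lemma norm_green_operator_le: "norm (green_operator \<Phi> P \<phi> t) \<le> 2 * c * (sup_norm \<phi> / \<alpha>)"
proof -
  have i: "((\<lambda>s. c * sup_norm \<phi> * exp (- \<alpha> * \<bar>t - s\<bar>)) has_integral c * sup_norm \<phi> * (2 / \<alpha>)) UNIV"
    by (intro has_integral_mult_right has_integral_exp_abs dichotomy_rate_pos[OF cd])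
  have "norm (green_operator \<Phi> P \<phi> t) \<le> integral UNIV (\<lambda>s. c * sup_norm \<phi> * exp (- \<alpha> * \<bar>t - s\<bar>))"
    unfolding green_operator_kernel
    using i by (intro integral_norm_bound_integral green_kernel_integrable norm_green_kernel_le) blast
  also have "\<dots> = c * sup_norm \<phi> * (2 / \<alpha>)" by (rule integral_unique[OF i])
  finally show ?thesis by (simp add: mult_ac)
qed

lemma sup_norm_green_operator_le: "sup_norm (green_operator \<Phi> P \<phi>) \<le> 2 * c * (sup_norm \<phi> / \<alpha>)"
  unfolding sup_norm_def[of "green_operator \<Phi> P \<phi>"]
  by (intro cSUP_least norm_green_operator_le) simp

text \<open>Continuity is the case of translations tending to \<open>0\<close> in \<open>translation_limit_integral\<close>.\<close>

lemma green_operator_bcontfun: "green_operator \<Phi> P \<phi> \<in> bcontfun"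
proof -
  have "isCont (green_operator \<Phi> P \<phi>) t" for t
    unfolding continuous_at_sequentially o_def
  proof (intro allI impI)
    fix x :: "nat \<Rightarrow> real" assume x: "x \<longlonglongrightarrow> t"
    define \<xi> where "\<xi> n = x n - t" for n
    have \<xi>: "\<xi> \<longlonglongrightarrow> 0" unfolding \<xi>_def using x by (rule LIM_zero)
    \<comment> \<open>Moving t and s together preserves the sign of t - s, so a single branch of the
      Green matrix is used along the sequence and the jump on the diagonal does no harm.\<close>
    have K: "(\<lambda>n. green_kernel \<Phi> P \<phi> (t + y n) (s + y n)) \<longlonglongrightarrow> green_kernel \<Phi> P \<phi> t s"
      if "y \<longlonglongrightarrow> 0" for y t s
    proof -
      have y: "(\<lambda>n. r + y n) \<longlonglongrightarrow> r" for r
        using tendsto_add[OF tendsto_const that, of r] by simp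
      note fm = dichotomy_fundamental[OF cd]
      have cmp: "(\<lambda>n. F (r + y n)) \<longlonglongrightarrow> F r" if "continuous_on UNIV F" for F :: "real \<Rightarrow> 'z::topological_space" and r
        by (rule continuous_on_tendsto_compose[OF that y]) auto
      have "(\<lambda>n. evolution Q \<Phi> (t + y n) (s + y n)) \<longlonglongrightarrow> evolution Q \<Phi> t s" for Q
        unfolding evolution_def
        by (intro matrix_mult.tendsto tendsto_const cmp[OF fundamental_matrix_continuous[OF fm]]
            cmp[OF fundamental_matrix_inv_continuous[OF fm]])
      then have "(\<lambda>n. green_matrix \<Phi> P (t + y n) (s + y n)) \<longlonglongrightarrow> green_matrix \<Phi> P t s"
        unfolding green_matrix_evolution by (simp add: tendsto_minus)
      then show ?thesis unfolding green_kernel_def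
        by (intro matrix_act.tendsto cmp[OF \<phi>_continuous])
    qed
    have m: "(\<lambda>n. - \<xi> n) \<longlonglongrightarrow> 0" using tendsto_minus[OF \<xi>] by simp
    have "(\<lambda>n. green_kernel \<Phi> P \<phi> (t - \<xi> n) (s - \<xi> n)) \<longlonglongrightarrow> green_kernel \<Phi> P \<phi> t s" for t s
      using K[OF m] by simp
    from translation_limit_integral[OF green_kernel_integrable dichotomy_rate_pos[OF cd] norm_green_kernel_le
        K[OF \<xi>] this green_kernel_diff_measurable]
    have "(\<lambda>n. green_operator \<Phi> P \<phi> (t + \<xi> n)) \<longlonglongrightarrow> green_operator \<Phi> P \<phi> t"
      unfolding translation_limit_def green_operator_kernel by blast
    then show "(\<lambda>n. green_operator \<Phi> P \<phi> (x n)) \<longlonglongrightarrow> green_operator \<Phi> P \<phi> t"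
      by (simp add: \<xi>_def)
  qed
  then have "continuous_on UNIV (green_operator \<Phi> P \<phi>)"
    by (simp add: continuous_at_imp_continuous_on)
  moreover have "bounded (range (green_operator \<Phi> P \<phi>))"
    using norm_green_operator_le unfolding bounded_iff by blast
  ultimately show ?thesis by (simp add: bcontfun_def)
qed

text \<open>With primes for translation by \<xi>, G' \<phi>' - G \<phi> = (G' - G) \<phi>' + G
  (\<phi>' - \<phi>). The convolution estimates bound the first term, with c^2 / \<alpha>; the
  dichotomy bounds the second directly, with c.\<close>

lemma norm_translation_diff_green_operator_le:
  assumes M: "\<And>t. norm (A t) \<le> M"
  shows "norm (translation_diff \<xi> (green_operator \<Phi> P \<phi>) t)
    \<le> c\<^sup>2 / \<alpha> * sup_norm \<phi> *
        (L1 \<alpha> (\<lambda>s. norm (translation_diff \<xi> A s)) t + L2 \<alpha> (\<lambda>s. norm (translation_diff \<xi> A s)) t)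
      + c * (L1 \<alpha> (\<lambda>s. norm (translation_diff \<xi> \<phi> s)) t + L2 \<alpha> (\<lambda>s. norm (translation_diff \<xi> \<phi> s)) t)"
proof -
  note fm = dichotomy_fundamental[OF cd] and \<alpha> = dichotomy_rate_pos[OF cd] and c = dichotomy_c_pos[OF cd]
  let ?\<Phi>' = "shifted_fundamental \<Phi> \<xi>"
  note cd' = commuting_dichotomy_shifted[OF cd, of \<xi>]
  note fm' = dichotomy_fundamental[OF cd']
  define a where "a s = norm (translation_diff \<xi> A s)" for s
  define d where "d s = norm (translation_diff \<xi> \<phi> s)" for s
  define S where "S = sup_norm \<phi>"
  have S: "norm (\<phi> s) \<le> S" for s unfolding S_def by (rule bcontfun_norm_le_sup_norm[OF \<phi>])
  have S0: "0 \<le> S" using order_trans[OF norm_ge_zero S] .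
  have a: "a \<in> borel_measurable lebesgue" "\<And>s. 0 \<le> a s" "\<And>s. a s \<le> M + M"
  proof -
    show "a \<in> borel_measurable lebesgue"
      unfolding a_def translation_diff_def
      by (intro measurable_compose[OF borel_measurable_diff borel_measurable_norm]
          fundamental_matrix_measurable[OF fm] fundamental_matrix_measurable[OF fm'])
    show "a s \<le> M + M" for s
      unfolding a_def translation_diff_def
      using norm_triangle_ineq4[of "A (s + \<xi>)" "A s"] M[of "s + \<xi>"] M[of s] by linarith
  qed (simp add: a_def)
  have contd: "continuous_on UNIV d"
    unfolding d_def translation_diff_def
    by (intro continuous_on_norm continuous_on_diff \<phi>_continuous continuous_on_compose2[OF \<phi>_continuous])
      (auto intro!: continuous_intros)
  have d: "d \<in> borel_measurable lebesgue" "\<And>s. 0 \<le> d s" "\<And>s. d s \<le> S + S"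
  proof -
    show "d \<in> borel_measurable lebesgue" by (rule continuous_imp_lebesgue_measurable[OF contd])
    show "d s \<le> S + S" for s
      unfolding d_def translation_diff_def
      using norm_triangle_ineq4[of "\<phi> (s + \<xi>)" "\<phi> s"] S[of "s + \<xi>"] S[of s] by linarith
  qed (simp add: d_def)
  \<comment> \<open>Each branch stays a continuous function on the whole line; the two are glued
    only in \<open>g\<close>, each on its own half-line.\<close>
  define p where "p s = norm (evolution P ?\<Phi>' t s - evolution P \<Phi> t s)" for s
  define q where "q s = norm (evolution (mat 1 - P) ?\<Phi>' t s - evolution (mat 1 - P) \<Phi> t s)" for s
  have cont: "continuous_on UNIV p" "continuous_on UNIV q"
    unfolding p_def q_def
    by (intro continuous_on_norm continuous_on_diff evolution_continuous_right[OF fm] evolution_continuous_right[OF fm'])+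
  have pint: "p integrable_on {..t}"
  proof (rule measurable_bounded_by_integrable_imp_integrable)
    show "p \<in> borel_measurable (lebesgue_on {..t})"
      by (intro measurable_restrict_space1 continuous_imp_lebesgue_measurable cont)
    show "(\<lambda>s. 2 * c * exp (- \<alpha> * (t - s))) integrable_on {..t}"
      using has_integral_mult_right[OF has_integral_exp_atMost[OF \<alpha>], of "2 * c" t] by blast
    show "norm (p s) \<le> 2 * c * exp (- \<alpha> * (t - s))" if "s \<in> {..t}" for s
      using norm_triangle_ineq4[of "evolution P ?\<Phi>' t s" "evolution P \<Phi> t s"] that
        norm_stable_evolution_le[OF cd, of s t] norm_stable_evolution_le[OF cd', of s t]
      by (simp add: p_def)
  qed simp
  have qint: "q integrable_on {t..}"
  proof (rule measurable_bounded_by_integrable_imp_integrable)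
    show "q \<in> borel_measurable (lebesgue_on {t..})"
      by (intro measurable_restrict_space1 continuous_imp_lebesgue_measurable cont)
    show "(\<lambda>s. 2 * c * exp (\<alpha> * (t - s))) integrable_on {t..}"
      using has_integral_mult_right[OF has_integral_exp_atLeast[OF \<alpha>], of "2 * c" t] by blast
    show "norm (q s) \<le> 2 * c * exp (\<alpha> * (t - s))" if "s \<in> {t..}" for s
    proof -
      have "exp (- \<alpha> * (s - t)) = exp (\<alpha> * (t - s))" by (simp add: algebra_simps)
      then show ?thesis
        using norm_triangle_ineq4[of "evolution (mat 1 - P) ?\<Phi>' t s" "evolution (mat 1 - P) \<Phi> t s"] that
          norm_unstable_evolution_le[OF cd, of t s] norm_unstable_evolution_le[OF cd', of t s]
        by (simp add: q_def)
    qed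
  qed simp
  have M': "\<And>t. norm (A (t + \<xi>)) \<le> M" by (rule M)
  have aeq: "(\<lambda>r. norm (A (r + \<xi>) - A r)) = a" by (simp add: a_def translation_diff_def fun_eq_iff)
  have pL: "integral {..t} p \<le> c\<^sup>2 / \<alpha> * L1 \<alpha> a t"
    unfolding L1_def
    by (rule integral_exp_convolution_le[OF a \<alpha> pint])
      (use stable_evolution_diff_le[OF cd cd' M M', unfolded aeq] in \<open>auto simp: p_def\<close>)
  have qL: "integral {t..} q \<le> c\<^sup>2 / \<alpha> * L2 \<alpha> a t"
    unfolding L2_def
    by (rule integral_exp_convolution_ge(2)[OF a \<alpha> qint])
      (use unstable_evolution_diff_le[OF cd cd' M M', unfolded aeq] in \<open>auto simp: q_def\<close>)
  define g where "g s = norm (green_matrix ?\<Phi>' P t s - green_matrix \<Phi> P t s)" for s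
  have g: "(g has_integral integral {..t} p + integral {t..} q) UNIV"
  proof (rule has_integral_half_lines[OF integrable_integral[OF pint] integrable_integral[OF qint]])
    show "g s = p s" if "s < t" for s
      using that by (simp add: g_def p_def green_matrix_evolution)
    show "g s = q s" if "s > t" for s
      using that by (simp add: g_def q_def green_matrix_evolution norm_minus_commute)
  qed
  have e: "((\<lambda>s. exp (- \<alpha> * \<bar>t - s\<bar>) * d s) has_integral L1 \<alpha> d t + L2 \<alpha> d t) UNIV"
    by (rule has_integral_half_lines[OF L1_has_integral[OF d \<alpha>] L2_has_integral[OF d \<alpha>]])
      (auto simp: algebra_simps)
  have k: "((\<lambda>s. g s * S + c * (exp (- \<alpha> * \<bar>t - s\<bar>) * d s)) has_integral
      (integral {..t} p + integral {t..} q) * S + c * (L1 \<alpha> d t + L2 \<alpha> d t)) UNIV"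
    by (intro has_integral_add has_integral_mult_left has_integral_mult_right g e)
  let ?K = "green_kernel \<Phi> P \<phi>"
  have "(?K (t + \<xi>) has_integral green_operator \<Phi> P \<phi> (t + \<xi>)) UNIV"
    unfolding green_operator_kernel by (rule integrable_integral[OF green_kernel_integrable])
  from has_integral_affine_UNIV[OF this, of 1 \<xi>]
  have "((\<lambda>s. ?K (t + \<xi>) (s + \<xi>)) has_integral green_operator \<Phi> P \<phi> (t + \<xi>)) UNIV" by simp
  moreover have "(?K t has_integral green_operator \<Phi> P \<phi> t) UNIV"
    unfolding green_operator_kernel by (rule integrable_integral[OF green_kernel_integrable])
  ultimately have K: "((\<lambda>s. ?K (t + \<xi>) (s + \<xi>) - ?K t s) has_integral translation_diff \<xi> (green_operator \<Phi> P \<phi>) t) UNIV"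
    unfolding translation_diff_def by (rule has_integral_diff)
  have "norm (translation_diff \<xi> (green_operator \<Phi> P \<phi>) t)
      \<le> integral UNIV (\<lambda>s. g s * S + c * (exp (- \<alpha> * \<bar>t - s\<bar>) * d s))"
    unfolding integral_unique[OF K, symmetric]
  proof (rule integral_norm_bound_integral)
    show "(\<lambda>s. ?K (t + \<xi>) (s + \<xi>) - ?K t s) integrable_on UNIV" using K by blast
    show "(\<lambda>s. g s * S + c * (exp (- \<alpha> * \<bar>t - s\<bar>) * d s)) integrable_on UNIV" using k by blast
    fix s
    let ?G = "green_matrix \<Phi> P t s" and ?G' = "green_matrix \<Phi> P (t + \<xi>) (s + \<xi>)"
    have "?K (t + \<xi>) (s + \<xi>) - ?K t s = matrix_act (?G' - ?G) (\<phi> (s + \<xi>)) + matrix_act ?G (translation_diff \<xi> \<phi> s)"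
      by (simp add: green_kernel_def translation_diff_def matrix_act.diff_left matrix_act.diff_right)
    also have "norm \<dots> \<le> norm (?G' - ?G) * norm (\<phi> (s + \<xi>)) + norm ?G * norm (translation_diff \<xi> \<phi> s)"
      by (intro order_trans[OF norm_triangle_ineq] add_mono norm_matrix_act_le)
    also have "\<dots> \<le> g s * S + (c * exp (- \<alpha> * \<bar>t - s\<bar>)) * d s"
      unfolding g_def d_def green_matrix_shifted[OF cd] by (intro add_mono mult_left_mono mult_right_mono S norm_green_matrix_le[OF cd]) auto
    finally show "norm (?K (t + \<xi>) (s + \<xi>) - ?K t s) \<le> g s * S + c * (exp (- \<alpha> * \<bar>t - s\<bar>) * d s)"
      by (simp add: mult.assoc)
  qed
  also have "\<dots> = (integral {..t} p + integral {t..} q) * S + c * (L1 \<alpha> d t + L2 \<alpha> d t)"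
    by (rule integral_unique[OF k])
  also have "\<dots> \<le> (c\<^sup>2 / \<alpha> * L1 \<alpha> a t + c\<^sup>2 / \<alpha> * L2 \<alpha> a t) * S + c * (L1 \<alpha> d t + L2 \<alpha> d t)"
    by (intro add_right_mono mult_right_mono add_mono pL qL S0)
  also have "\<dots> = c\<^sup>2 / \<alpha> * S * (L1 \<alpha> a t + L2 \<alpha> a t) + c * (L1 \<alpha> d t + L2 \<alpha> d t)"
    by (simp add: algebra_simps add_divide_distrib)
  finally show ?thesis unfolding a_def d_def S_def .
qed

end


section \<open>Almost periodic and almost automorphic functions\<close>

lemma AP_D:
  assumes "f \<in> AP" "\<epsilon> > 0"
  obtains l where "l > 0" "\<And>a. \<exists>\<xi>\<in>{a..a + l}. \<forall>t. norm (f (t + \<xi>) - f t) \<le> \<epsilon>"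
  using assms unfolding AP_def by blast

lemma AP_bcontfun: "f \<in> AP \<Longrightarrow> f \<in> bcontfun"
  unfolding AP_def by blast

text \<open>An almost period carries two close points into one fixed compact interval, where uniform
  continuity is available.\<close>

lemma AP_uniformly_continuous:
  fixes f :: "real \<Rightarrow> 'w::real_normed_vector"
  assumes f: "f \<in> AP" and "\<epsilon> > 0"
  obtains \<delta> where "\<delta> > 0" "\<And>x y. \<bar>x - y\<bar> < \<delta> \<Longrightarrow> norm (f x - f y) \<le> \<epsilon>"
proof -
  obtain l where l: "l > 0" "\<And>a. \<exists>\<xi>\<in>{a..a + l}. \<forall>t. norm (f (t + \<xi>) - f t) \<le> \<epsilon> / 3"
    using AP_D[OF f, of "\<epsilon> / 3"] \<open>\<epsilon> > 0\<close> by auto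
  have "continuous_on {- 1..l + 1} f"
    using AP_bcontfun[OF f] by (auto simp: bcontfun_def intro: continuous_on_subset)
  then have "uniformly_continuous_on {- 1..l + 1} f" by (rule compact_uniformly_continuous) simp
  then obtain d where d: "d > 0"
    "\<And>x y. x \<in> {- 1..l + 1} \<Longrightarrow> y \<in> {- 1..l + 1} \<Longrightarrow> dist y x < d \<Longrightarrow> dist (f y) (f x) < \<epsilon> / 3"
    unfolding uniformly_continuous_on_def using \<open>\<epsilon> > 0\<close> by (metis divide_pos_pos zero_less_numeral)
  have "norm (f x - f y) \<le> \<epsilon>" if xy: "\<bar>x - y\<bar> < min d 1" for x y
  proof -
    \<comment> \<open>This places x + \<xi> in [0, l], and y + \<xi>, which is less than 1 away, in
      [-1, l + 1].\<close>
    obtain \<xi> where \<xi>: "\<xi> \<in> {- x..- x + l}" "\<And>t. norm (f (t + \<xi>) - f t) \<le> \<epsilon> / 3" using l(2) by blast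
    have "dist (f (x + \<xi>)) (f (y + \<xi>)) < \<epsilon> / 3"
      using xy \<xi>(1) by (intro d(2)) (auto simp: dist_real_def abs_less_iff)
    then have 1: "norm (f (x + \<xi>) - f (y + \<xi>)) \<le> \<epsilon> / 3" by (simp add: dist_norm)
    have "f x - f y = (f (x + \<xi>) - f (y + \<xi>)) - (f (x + \<xi>) - f x) + (f (y + \<xi>) - f y)" by simp
    also have "norm \<dots> \<le> \<epsilon> / 3 + \<epsilon> / 3 + \<epsilon> / 3"
      by (intro order_trans[OF norm_triangle_ineq] order_trans[OF norm_triangle_ineq4] add_mono 1 \<xi>(2))
    finally show ?thesis by simp
  qed
  then show thesis using that[of "min d 1"] d(1) by auto
qed

text \<open>
  Choose \<open>\<eta>\<close>-periods \<open>\<tau> a\<close> of \<open>f\<close> and \<open>\<sigma> a\<close> of \<open>g\<close> in \<open>{a..a + l}\<close>. The integer part of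
  \<open>(\<tau> a - \<sigma> a) / \<delta>\<close> takes finitely many values, and if it agrees for \<open>a\<close> and \<open>a'\<close>, then
  \<open>\<tau> a - \<tau> a'\<close> is within \<open>\<delta>\<close> of \<open>\<sigma> a - \<sigma> a'\<close>, hence almost a period of both functions.
\<close>

lemma AP_common_periods:
  fixes f :: "real \<Rightarrow> 'w::real_normed_vector" and g :: "real \<Rightarrow> 'x::real_normed_vector"
  assumes f: "f \<in> AP" and g: "g \<in> AP" and "\<epsilon> > 0"
  obtains l where "l > 0"
    "\<And>a. \<exists>\<xi>\<in>{a..a + l}. \<forall>t. norm (f (t + \<xi>) - f t) \<le> \<epsilon> \<and> norm (g (t + \<xi>) - g t) \<le> \<epsilon>"
proof -
  \<comment> \<open>Two thirds are spent on the difference of two periods, one third on the uniform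
    continuity of \<open>g\<close>.\<close>
  define \<eta> where "\<eta> = \<epsilon> / 3"
  have "\<eta> > 0" using \<open>\<epsilon> > 0\<close> by (simp add: \<eta>_def)
  obtain lf where lf: "lf > 0" "\<And>a. \<exists>\<xi>\<in>{a..a + lf}. \<forall>t. norm (f (t + \<xi>) - f t) \<le> \<eta>"
    using AP_D[OF f \<open>\<eta> > 0\<close>] by blast
  obtain lg where lg: "lg > 0" "\<And>a. \<exists>\<xi>\<in>{a..a + lg}. \<forall>t. norm (g (t + \<xi>) - g t) \<le> \<eta>"
    using AP_D[OF g \<open>\<eta> > 0\<close>] by blast
  obtain \<delta> where \<delta>: "\<delta> > 0" "\<And>x y. \<bar>x - y\<bar> < \<delta> \<Longrightarrow> norm (g x - g y) \<le> \<eta>"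
    using AP_uniformly_continuous[OF g \<open>\<eta> > 0\<close>] by blast
  define l where "l = max lf lg"
  obtain \<tau> where \<tau>: "\<And>a. \<tau> a \<in> {a..a + l}" "\<And>a t. norm (f (t + \<tau> a) - f t) \<le> \<eta>"
  proof -
    have "\<exists>\<xi>. \<xi> \<in> {a..a + l} \<and> (\<forall>t. norm (f (t + \<xi>) - f t) \<le> \<eta>)" for a
    proof -
      have "{a..a + lf} \<subseteq> {a..a + l}" by (simp add: l_def)
      then show ?thesis using lf(2)[of a] by blast
    qed
    then show thesis using that by metis
  qed
  obtain \<sigma> where \<sigma>: "\<And>a. \<sigma> a \<in> {a..a + l}" "\<And>a t. norm (g (t + \<sigma> a) - g t) \<le> \<eta>"
  proof -
    have "\<exists>\<xi>. \<xi> \<in> {a..a + l} \<and> (\<forall>t. norm (g (t + \<xi>) - g t) \<le> \<eta>)" for a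
    proof -
      have "{a..a + lg} \<subseteq> {a..a + l}" by (simp add: l_def)
      then show ?thesis using lg(2)[of a] by blast
    qed
    then show thesis using that by metis
  qed
  define d where "d a = \<lfloor>(\<tau> a - \<sigma> a) / \<delta>\<rfloor>" for a
  have "range d \<subseteq> {\<lfloor>- l / \<delta>\<rfloor>..\<lfloor>l / \<delta>\<rfloor>}"
  proof
    fix k assume "k \<in> range d"
    then obtain a where a: "k = d a" by blast
    have h: "- l \<le> \<tau> a - \<sigma> a" "\<tau> a - \<sigma> a \<le> l" using \<tau>(1)[of a] \<sigma>(1)[of a] by auto
    then show "k \<in> {\<lfloor>- l / \<delta>\<rfloor>..\<lfloor>l / \<delta>\<rfloor>}"
      unfolding a d_def atLeastAtMost_iff
      using \<delta>(1) by (intro conjI floor_mono divide_right_mono h) auto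
  qed
  then have fin: "finite (range d)" by (rule finite_subset) simp
  define rep where "rep k = (SOME a. d a = k)" for k
  have rep: "d (rep (d a)) = d a" for a unfolding rep_def by (rule someI) (rule refl)
  \<comment> \<open>Bounds the finitely many periods chosen as representatives and so makes the
    window length 2 R + l independent of its position.\<close>
  define R where "R = (\<Sum>k\<in>range d. \<bar>\<tau> (rep k)\<bar>)"
  have R: "0 \<le> R" "\<bar>\<tau> (rep (d a))\<bar> \<le> R" for a
    unfolding R_def by (rule sum_nonneg, simp) (rule member_le_sum[OF _ _ fin], auto)
  have diff: "norm (h (t + (x - y)) - h t) \<le> \<eta> + \<eta>"
    if "\<And>t. norm (h (t + x) - h t) \<le> \<eta>" "\<And>t. norm (h (t + y) - h t) \<le> \<eta>"
    for h :: "real \<Rightarrow> 'z::real_normed_vector" and t x y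
  proof -
    have "h (t + (x - y)) - h t = (h (t - y + x) - h (t - y)) - (h (t - y + y) - h (t - y))"
      by (simp add: algebra_simps)
    also have "norm \<dots> \<le> \<eta> + \<eta>"
      by (intro order_trans[OF norm_triangle_ineq4] add_mono that)
    finally show ?thesis .
  qed
  show thesis
  proof (rule that[of "2 * R + l"])
    show "2 * R + l > 0" using R(1) lf(1) by (simp add: l_def)
    fix b
    \<comment> \<open>The offset R compensates for subtracting the representative period: \<tau>(a)
      lies in [b + R, b + R + l] and the representative in [-R, R].\<close>
    define a where "a = b + R"
    define a' where "a' = rep (d a)"
    define \<xi> where "\<xi> = \<tau> a - \<tau> a'"
    define \<xi>' where "\<xi>' = \<sigma> a - \<sigma> a'"
    have "d a' = d a" unfolding a'_def by (rule rep)
    then have "\<bar>(\<tau> a - \<sigma> a) / \<delta> - (\<tau> a' - \<sigma> a') / \<delta>\<bar> < 1" unfolding d_def by linarith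
    then have "\<bar>\<xi> - \<xi>'\<bar> / \<delta> < 1"
      using \<delta>(1) by (simp add: \<xi>_def \<xi>'_def diff_divide_distrib[symmetric] abs_divide algebra_simps)
    then have close: "\<bar>\<xi> - \<xi>'\<bar> < \<delta>" using \<delta>(1) by (simp add: divide_less_eq)
    have "\<bar>\<tau> a'\<bar> \<le> R" unfolding a'_def by (rule R(2))
    then have "\<xi> \<in> {b..b + (2 * R + l)}"
      using \<tau>(1)[of a] by (auto simp: \<xi>_def a_def abs_le_iff)
    moreover have "norm (f (t + \<xi>) - f t) \<le> \<epsilon>" for t
      using diff[of f "\<tau> a" "\<tau> a'" t, OF \<tau>(2) \<tau>(2)] \<open>\<eta> > 0\<close> by (simp add: \<xi>_def \<eta>_def)
    moreover have "norm (g (t + \<xi>) - g t) \<le> \<epsilon>" for t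
    proof -
      have "norm (g (t + \<xi>) - g (t + \<xi>')) \<le> \<eta>" using close by (intro \<delta>(2)) simp
      moreover have "norm (g (t + \<xi>') - g t) \<le> \<eta> + \<eta>"
        unfolding \<xi>'_def by (rule diff[of g "\<sigma> a" "\<sigma> a'" t, OF \<sigma>(2) \<sigma>(2)])
      ultimately show ?thesis
        using norm_triangle_ineq[of "g (t + \<xi>) - g (t + \<xi>')" "g (t + \<xi>') - g t"] by (simp add: \<eta>_def)
    qed
    ultimately show "\<exists>\<xi>\<in>{b..b + (2 * R + l)}. \<forall>t. norm (f (t + \<xi>) - f t) \<le> \<epsilon> \<and> norm (g (t + \<xi>) - g t) \<le> \<epsilon>"
      by blast
  qed
qed

lemma green_operator_AP:
  fixes A \<Phi> :: "real \<Rightarrow> complex ^ 'p ^ 'p" and \<phi> :: "real \<Rightarrow> 'v::complex_banach ^ 'p"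
  assumes cd: "commuting_dichotomy A \<Phi> P c \<alpha>" and A: "A \<in> AP" and \<phi>: "\<phi> \<in> AP"
  shows "green_operator \<Phi> P \<phi> \<in> AP"
  unfolding AP_def
proof (intro CollectI conjI allI impI)
  note b = AP_bcontfun[OF \<phi>] and \<alpha> = dichotomy_rate_pos[OF cd] and c = dichotomy_c_pos[OF cd]
  note fm = dichotomy_fundamental[OF cd]
  show "green_operator \<Phi> P \<phi> \<in> bcontfun" by (rule green_operator_bcontfun[OF cd b])
  fix \<epsilon> :: real assume "\<epsilon> > 0"
  define S where "S = sup_norm \<phi>"
  have S0: "0 \<le> S" unfolding S_def using order_trans[OF norm_ge_zero bcontfun_norm_le_sup_norm[OF b]] .
  \<comment> \<open>The right-hand side of the difference inequality when both translation
    differences are the constant 1; L1 and L2 then contribute 1 / \<alpha> each.\<close>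
  define C where "C = c\<^sup>2 / \<alpha> * S * (2 / \<alpha>) + c * (2 / \<alpha>)"
  have "C > 0" unfolding C_def using \<alpha> c S0 by (intro add_nonneg_pos) auto
  define \<eta> where "\<eta> = \<epsilon> / C"
  have "\<eta> > 0" unfolding \<eta>_def using \<open>\<epsilon> > 0\<close> \<open>C > 0\<close> by simp
  obtain l where l: "l > 0"
    "\<And>a. \<exists>\<xi>\<in>{a..a + l}. \<forall>t. norm (A (t + \<xi>) - A t) \<le> \<eta> \<and> norm (\<phi> (t + \<xi>) - \<phi> t) \<le> \<eta>"
    using AP_common_periods[OF A \<phi> \<open>\<eta> > 0\<close>] by blast
  have "norm (green_operator \<Phi> P \<phi> (t + \<xi>) - green_operator \<Phi> P \<phi> t) \<le> \<epsilon>"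
    if \<xi>: "\<And>t. norm (A (t + \<xi>) - A t) \<le> \<eta>" "\<And>t. norm (\<phi> (t + \<xi>) - \<phi> t) \<le> \<eta>" for \<xi> t
  proof -
    define a where "a s = norm (translation_diff \<xi> A s)" for s
    define d where "d s = norm (translation_diff \<xi> \<phi> s)" for s
    have am: "a \<in> borel_measurable lebesgue"
      unfolding a_def translation_diff_def
      by (intro measurable_compose[OF borel_measurable_diff borel_measurable_norm]
          fundamental_matrix_measurable[OF fm] fundamental_matrix_measurable[OF fundamental_matrix_shift[OF fm]])
    have cont: "continuous_on UNIV \<phi>" using b by (simp add: bcontfun_def)
    have dm: "d \<in> borel_measurable lebesgue"
      unfolding d_def translation_diff_def
      by (intro continuous_imp_lebesgue_measurable continuous_on_norm continuous_on_diff cont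
          continuous_on_compose2[OF cont]) (auto intro!: continuous_intros)
    have a: "0 \<le> a s" "a s \<le> \<eta>" and d: "0 \<le> d s" "d s \<le> \<eta>" for s
      using \<xi> by (auto simp: a_def d_def translation_diff_def)
    have "norm (translation_diff \<xi> (green_operator \<Phi> P \<phi>) t)
        \<le> c\<^sup>2 / \<alpha> * S * (L1 \<alpha> a t + L2 \<alpha> a t) + c * (L1 \<alpha> d t + L2 \<alpha> d t)"
      unfolding a_def d_def S_def
      by (rule norm_translation_diff_green_operator_le[OF cd b bcontfun_norm_le_sup_norm[OF AP_bcontfun[OF A]]])
    also have "\<dots> \<le> c\<^sup>2 / \<alpha> * S * (\<eta> / \<alpha> + \<eta> / \<alpha>) + c * (\<eta> / \<alpha> + \<eta> / \<alpha>)"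
      using \<alpha> c S0 by (intro add_mono mult_left_mono L1_le L2_le am dm a d) auto
    also have "\<dots> = C * \<eta>" unfolding C_def by (simp add: algebra_simps)
    also have "\<dots> = \<epsilon>" unfolding \<eta>_def using \<open>C > 0\<close> by simp
    finally show ?thesis by (simp add: translation_diff_def)
  qed
  then show "\<exists>l>0. \<forall>a. \<exists>\<xi>\<in>{a..a + l}. \<forall>t.
      norm (green_operator \<Phi> P \<phi> (t + \<xi>) - green_operator \<Phi> P \<phi> t) \<le> \<epsilon>"
    using l by meson
qed

lemma AA_bcontfun:
  assumes "f \<in> AA"
  shows "f \<in> bcontfun"
proof -
  obtain M where "\<And>t. norm (f t) \<le> M"
    using almost_automorphic_bounded assms unfolding AA_def by blast
  then have "bounded (range f)" unfolding bounded_iff by blast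
  then show ?thesis using assms by (simp add: AA_def bcontfun_def)
qed

lemma translation_limit_subseq:
  assumes "translation_limit f \<xi> g" "strict_mono r"
  shows "translation_limit f (\<xi> \<circ> r) g"
proof -
  have "(\<lambda>n. f (t + \<xi> (r n))) \<longlonglongrightarrow> g t" "(\<lambda>n. g (t - \<xi> (r n))) \<longlonglongrightarrow> f t" for t
    using assms(1) LIMSEQ_subseq_LIMSEQ[of "\<lambda>n. f (t + \<xi> n)" "g t" r]
      LIMSEQ_subseq_LIMSEQ[of "\<lambda>n. g (t - \<xi> n)" "f t" r] assms(2)
    by (simp_all add: translation_limit_def o_def)
  then show ?thesis by (simp add: translation_limit_def)
qed

text \<open>Subsequences are extracted for \<open>A\<close> and then, along that one, for \<phi>, so
  a single sequence serves both. The translates tend to the Green operator of the limit system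
  applied to the limit of \<phi>.\<close>

lemma green_operator_AA:
  fixes A \<Phi> :: "real \<Rightarrow> complex ^ 'p ^ 'p" and \<phi> :: "real \<Rightarrow> 'v::complex_banach ^ 'p"
  assumes cd: "commuting_dichotomy A \<Phi> P c \<alpha>" and A: "almost_automorphic A" and \<phi>: "\<phi> \<in> AA"
  shows "green_operator \<Phi> P \<phi> \<in> AA"
  unfolding AA_def almost_automorphic_def
proof (intro CollectI conjI allI)
  note b = AA_bcontfun[OF \<phi>]
  show "continuous_on UNIV (green_operator \<Phi> P \<phi>)"
    using green_operator_bcontfun[OF cd b] by (simp add: bcontfun_def)
  fix \<sigma> :: "nat \<Rightarrow> real"
  obtain r B where r: "strict_mono r" "translation_limit A (\<sigma> \<circ> r) B"
    using A unfolding almost_automorphic_def by blast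
  obtain r' \<psi> where r': "strict_mono r'" "translation_limit \<phi> ((\<sigma> \<circ> r) \<circ> r') \<psi>"
    using \<phi> unfolding AA_def almost_automorphic_def by blast
  define \<xi> where "\<xi> = \<sigma> \<circ> r \<circ> r'"
  obtain M where M: "\<And>t. norm (A t) \<le> M" using almost_automorphic_bounded[OF A] by blast
  have tl: "translation_limit A \<xi> B" unfolding \<xi>_def by (rule translation_limit_subseq[OF r(2) r'(1)])
  obtain \<Psi> where "commuting_dichotomy B \<Psi> P c \<alpha>" "\<Psi> 0 = \<Phi> 0" and \<Psi>:
    "\<And>t s. (\<lambda>n. green_matrix \<Phi> P (t + \<xi> n) (s + \<xi> n)) \<longlonglongrightarrow> green_matrix \<Psi> P t s"
    "\<And>t s. (\<lambda>n. green_matrix \<Psi> P (t - \<xi> n) (s - \<xi> n)) \<longlonglongrightarrow> green_matrix \<Phi> P t s"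
    using translation_limit_dichotomy[OF cd M tl] by blast
  have \<psi>: "(\<lambda>n. \<phi> (s + \<xi> n)) \<longlonglongrightarrow> \<psi> s" "(\<lambda>n. \<psi> (s - \<xi> n)) \<longlonglongrightarrow> \<phi> s" for s
    using r'(2) unfolding \<xi>_def translation_limit_def by auto
  have "translation_limit (\<lambda>t. integral UNIV (green_kernel \<Phi> P \<phi> t)) \<xi> (\<lambda>t. integral UNIV (green_kernel \<Psi> P \<psi> t))"
  proof (rule translation_limit_integral[OF green_kernel_integrable[OF cd b] dichotomy_rate_pos[OF cd]
        norm_green_kernel_le[OF cd b] _ _ green_kernel_diff_measurable[OF cd b]])
    show "(\<lambda>n. green_kernel \<Phi> P \<phi> (t + \<xi> n) (s + \<xi> n)) \<longlonglongrightarrow> green_kernel \<Psi> P \<psi> t s" for t s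
      unfolding green_kernel_def by (intro matrix_act.tendsto \<Psi> \<psi>)
    show "(\<lambda>n. green_kernel \<Psi> P \<psi> (t - \<xi> n) (s - \<xi> n)) \<longlonglongrightarrow> green_kernel \<Phi> P \<phi> t s" for t s
      unfolding green_kernel_def by (intro matrix_act.tendsto \<Psi> \<psi>)
  qed
  then have "translation_limit (green_operator \<Phi> P \<phi>) (\<sigma> \<circ> (r \<circ> r')) (green_operator \<Psi> P \<psi>)"
    by (simp add: green_operator_kernel \<xi>_def translation_limit_def)
  then show "\<exists>r g. strict_mono r \<and> translation_limit (green_operator \<Phi> P \<phi>) (\<sigma> \<circ> r) g"
    using strict_mono_o[OF r(1) r'(1)] by blast
qed

text \<open>The sup bound carries the dichotomy constant, since sup_norm \<phi> / \<alpha> alone is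
  too small: for the constant matrix with rows (-1, k) and (0, -1), \<open>P = mat 1\<close> and
  \<alpha> = 1/2, the constant function (0, 1) is mapped to (k, 1). The invariance of
  \<open>AP\<close> is stated for \<open>A\<close> in \<open>AP\<close>, as the almost periods of
  the image are taken from those common to \<open>A\<close> and \<phi>.\<close>

theorem lemma2p9:
  fixes A \<Phi> :: "real \<Rightarrow> complex ^ 'p ^ 'p"
    and P :: "complex ^ 'p ^ 'p"
    and c \<alpha> :: real
  assumes "almost_automorphic A"
    and "exponential_dichotomy A \<Phi> P c \<alpha>"
    and "\<And>t. P ** \<Phi> t = \<Phi> t ** P"
  shows "integrally_bi_almost_automorphic A \<Phi> P \<and>
    green_invariant \<Phi> P (bcontfun :: (real \<Rightarrow> 'v::complex_banach ^ 'p) set) \<and>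
    (A \<in> AP \<longrightarrow> green_invariant \<Phi> P (AP :: (real \<Rightarrow> 'v ^ 'p) set)) \<and>
    green_invariant \<Phi> P (AA :: (real \<Rightarrow> 'v ^ 'p) set) \<and>
    (\<exists>c1>0. \<exists>c2>0.
      (\<forall>\<phi> \<in> (bcontfun :: (real \<Rightarrow> 'v ^ 'p) set).
        sup_norm (green_operator \<Phi> P \<phi>) \<le> 2 * c * (sup_norm \<phi> / \<alpha>)) \<and>
      (\<forall>\<phi> \<in> (AP :: (real \<Rightarrow> 'v ^ 'p) set). \<forall>\<xi> t.
        norm (translation_diff \<xi> (green_operator \<Phi> P \<phi>) t)
        \<le> c1 * sup_norm \<phi> *
            (L1 \<alpha> (\<lambda>s. norm (translation_diff \<xi> A s)) t + L2 \<alpha> (\<lambda>s. norm (translation_diff \<xi> A s)) t)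
          + c2 *
            (L1 \<alpha> (\<lambda>s. norm (translation_diff \<xi> \<phi> s)) t + L2 \<alpha> (\<lambda>s. norm (translation_diff \<xi> \<phi> s)) t)))"
proof (intro conjI impI)
  have cd: "commuting_dichotomy A \<Phi> P c \<alpha>" using assms(2,3) unfolding commuting_dichotomy_def by blast
  note c = dichotomy_c_pos[OF cd] and \<alpha> = dichotomy_rate_pos[OF cd]
  obtain M where M: "\<And>t. norm (A t) \<le> M" using almost_automorphic_bounded[OF assms(1)] by blast
  have int: "(\<lambda>s. matrix_act (green_matrix \<Phi> P t s) (\<phi> s)) integrable_on UNIV"
    if "\<phi> \<in> bcontfun" for t and \<phi> :: "real \<Rightarrow> 'v ^ 'p"
    using green_kernel_integrable[OF cd that] unfolding green_kernel_def[abs_def] .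
  show "integrally_bi_almost_automorphic A \<Phi> P"
    by (rule integrally_bi_almost_automorphic_green[OF assms(1) cd])
  show "green_invariant \<Phi> P (bcontfun :: (real \<Rightarrow> 'v ^ 'p) set)"
    unfolding green_invariant_def using int green_operator_bcontfun[OF cd] by blast
  show "green_invariant \<Phi> P (AP :: (real \<Rightarrow> 'v ^ 'p) set)" if "A \<in> AP"
    unfolding green_invariant_def using int green_operator_AP[OF cd that] AP_bcontfun by blast
  show "green_invariant \<Phi> P (AA :: (real \<Rightarrow> 'v ^ 'p) set)"
    unfolding green_invariant_def using int green_operator_AA[OF cd assms(1)] AA_bcontfun by blast
  show "\<exists>c1>0. \<exists>c2>0.
      (\<forall>\<phi> \<in> (bcontfun :: (real \<Rightarrow> 'v ^ 'p) set).
        sup_norm (green_operator \<Phi> P \<phi>) \<le> 2 * c * (sup_norm \<phi> / \<alpha>)) \<and>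
      (\<forall>\<phi> \<in> (AP :: (real \<Rightarrow> 'v ^ 'p) set). \<forall>\<xi> t.
        norm (translation_diff \<xi> (green_operator \<Phi> P \<phi>) t)
        \<le> c1 * sup_norm \<phi> *
            (L1 \<alpha> (\<lambda>s. norm (translation_diff \<xi> A s)) t + L2 \<alpha> (\<lambda>s. norm (translation_diff \<xi> A s)) t)
          + c2 *
            (L1 \<alpha> (\<lambda>s. norm (translation_diff \<xi> \<phi> s)) t + L2 \<alpha> (\<lambda>s. norm (translation_diff \<xi> \<phi> s)) t))"
  proof (rule exI[of _ "c\<^sup>2 / \<alpha>"], intro conjI exI[of _ c] ballI allI)
    show "c\<^sup>2 / \<alpha> > 0" "c > 0" using c \<alpha> by auto
  qed (rule sup_norm_green_operator_le[OF cd]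
      norm_translation_diff_green_operator_le[OF cd AP_bcontfun M] | assumption)+
qed

end
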